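(* Consider the quasi-static MIMO channel without CSI described in the context, and let $0<\epsilon<1$. Assume there exists $Q^*\in\mathcal{U}_t$ such that $$\inf_{Q\in\mathcal{U}_t}\Pr[\log\det(I_r+\mathbb{H}^HQ\mathbb{H})\le C^{\mathrm{no}}_\epsilon]=\Pr[\log\det(I_r+\mathbb{H}^HQ^*\mathbb{H})\le C^{\mathrm{no}}_\epsilon],$$ i.e., the infimum is attained. Let $t^*=\mathrm{rank}(Q^* )$, let $U\in\mathbb{C}^{t^*\times t}$ satisfy $U^HU=Q^*$, and let $n\ge t^*+r$. Then for every $0<\tau<\epsilon$ there exists an $(n,M,\epsilon)_{\mathrm{no}}$ code with $$\frac{\log M}{n}\ge\frac1n\log\frac{\tau}{\Pr\big[\prod_{j=1}^rB_j\le\gamma_n\big]},$$ where $B_j\sim\mathrm{Beta}(n-t^*-j+1,t^* )$, $j=1,\dots,r$, are independent and $\gamma_n\in[0,1]$ is chosen so that $$\Pr\big[\sin^2\{I_{n,t^*},\ \sqrt n\,I_{n,t^*}U\mathbb{H}+\mathbb{W}\}\le\gamma_n\big]\ge1-\epsilon+\tau.$$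
   Context: Fix integers $t,r\ge1$, $\rho>0$. For blocklength $n$, input $X\in\mathbb{C}^{n\times t}$ yields $\mathbb{Y}=X\mathbb{H}+\mathbb{W}$, where $\mathbb{H}\in\mathbb{C}^{t\times r}$ is random and constant over the block, and $\mathbb{W}\in\mathbb{C}^{n\times r}$ has i.i.d. $\mathcal{CN}(0,1)$ entries independent of $\mathbb{H}$ and the message. An $(n,M,\epsilon)_{\mathrm{no}}$ code: codewords $C_1,\dots,C_M\in\mathbb{C}^{n\times t}$ with $\|C_j\|_F^2\le n\rho$ and a decoder $g:\mathbb{C}^{n\times r}\to\{1,\dots,M\}$ with $\max_j\Pr[g(C_j\mathbb{H}+\mathbb{W})\ne j]\le\epsilon$. $\mathcal{U}_t=\{Q\in\mathbb{C}^{t\times t}:Q\succeq0,\operatorname{tr}Q\le\rho\}$; $F_{\mathrm{no}}(R)=\inf_{Q\in\mathcal{U}_t}\Pr[\log\det(I_r+\mathbb{H}^HQ\mathbb{H})<R]$; $C^{\mathrm{no}}_\epsilon=\sup\{R:F_{\mathrm{no}}(R)\le\epsilon\}$. $I_{n,k}$ is the $n\times k$ matrix of the first $k$ columns of $I_n$. Principal angles: for subspaces $\mathcal{A},\mathcal{B}\subseteq\mathbb{C}^n$ with $a=\dim\mathcal{A}\le\dim\mathcal{B}$, define recursively $\cos\theta_k=\max|\langle\mathbf{a},\mathbf{b}\rangle|$ over unit vectors $\mathbf{a}\in\mathcal{A},\mathbf{b}\in\mathcal{B}$ orthogonal to the previously chosen maximizers $\mathbf{a}_1,\dots,\mathbf{a}_{k-1}$,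 resp. $\mathbf{b}_1,\dots,\mathbf{b}_{k-1}$; set $\sin\{\mathcal{A},\mathcal{B}\}=\prod_{k=1}^a\sin\theta_k$ (lower-dimensional subspace in the role of $\mathcal{A}$). For matrices, $\sin\{A,B\}=\sin\{\mathrm{span}(A),\mathrm{span}(B)\}$. *)

theory Defs
  imports "HOL-Probability.Probability" "Jordan_Normal_Form.Matrix"
    "Jordan_Normal_Form.Schur_Decomposition" "Jordan_Normal_Form.DL_Rank"
begin

definition cmat_trace :: "complex mat \<Rightarrow> complex" where
  "cmat_trace A = (\<Sum>i<dim_row A. A $$ (i, i))"

definition frob_sq :: "complex mat \<Rightarrow> real" where
  "frob_sq A = (\<Sum>i<dim_row A. \<Sum>j<dim_col A. (cmod (A $$ (i, j)))\<^sup>2)"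

definition psd :: "complex mat \<Rightarrow> bool" where
  "psd Q \<longleftrightarrow> Q \<in> carrier_mat (dim_row Q) (dim_row Q) \<and> mat_adjoint Q = Q \<and>
     (\<forall>x \<in> carrier_vec (dim_row Q). (Q *\<^sub>v x) \<bullet>c x \<in> \<real> \<and> 0 \<le> Re ((Q *\<^sub>v x) \<bullet>c x))"

definition input_set :: "nat \<Rightarrow> real \<Rightarrow> complex mat set" where
  "input_set t \<rho> = {Q \<in> carrier_mat t t. psd Q \<and> Re (cmat_trace Q) \<le> \<rho>}"

definition logdet_io :: "complex mat \<Rightarrow> complex mat \<Rightarrow> real" where
  "logdet_io Q Hm = ln (Re (det (1\<^sub>m (dim_col Hm) + mat_adjoint Hm * Q * Hm)))"

definition Ink :: "nat \<Rightarrow> nat \<Rightarrow> complex mat" where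
  "Ink n k = mat n k (\<lambda>(i, j). if i = j then 1 else 0)"

definition F_no :: "'w measure \<Rightarrow> ('w \<Rightarrow> complex mat) \<Rightarrow> nat \<Rightarrow> real \<Rightarrow> real \<Rightarrow> real" where
  "F_no \<Omega> H t \<rho> R =
     Inf ((\<lambda>Q. measure \<Omega> {\<omega> \<in> space \<Omega>. logdet_io Q (H \<omega>) < R}) ` input_set t \<rho>)"

definition C_no :: "'w measure \<Rightarrow> ('w \<Rightarrow> complex mat) \<Rightarrow> nat \<Rightarrow> real \<Rightarrow> real \<Rightarrow> real" where
  "C_no \<Omega> H t \<rho> \<epsilon> = Sup {R. F_no \<Omega> H t \<rho> R \<le> \<epsilon>}"

text \<open>Existence of an (n, M, eps)_no code for the channel Y = X H + W on the probability
  space Omega. The error events are required to be events (measurable), so that their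
  probabilities are meaningful.\<close>
definition is_code_no ::
  "'w measure \<Rightarrow> ('w \<Rightarrow> complex mat) \<Rightarrow> ('w \<Rightarrow> complex mat) \<Rightarrow> nat \<Rightarrow> real \<Rightarrow>
   nat \<Rightarrow> nat \<Rightarrow> real \<Rightarrow> bool" where
  "is_code_no \<Omega> H W t \<rho> n M \<epsilon> \<longleftrightarrow>
     (\<exists>(C :: nat \<Rightarrow> complex mat) (g :: complex mat \<Rightarrow> nat).
        (\<forall>j\<in>{1..M}. C j \<in> carrier_mat n t \<and> frob_sq (C j) \<le> real n * \<rho>) \<and>
        (\<forall>y. g y \<in> {1..M}) \<and>
        (\<forall>j\<in>{1..M}. {\<omega> \<in> space \<Omega>. g (C j * H \<omega> + W \<omega>) \<noteq> j} \<in> sets \<Omega> \<and>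
                     measure \<Omega> {\<omega> \<in> space \<Omega>. g (C j * H \<omega> + W \<omega>) \<noteq> j} \<le> \<epsilon>))"

definition unit_cvec :: "nat \<Rightarrow> complex vec \<Rightarrow> bool" where
  "unit_cvec n x \<longleftrightarrow> x \<in> carrier_vec n \<and> x \<bullet>c x = 1"

text \<open>as, bs are sequences of principal vectors (the recursively chosen maximizers)
  of the subspaces S (dimension a, the lower-dimensional one) and T of C^n.\<close>
definition principal_vectors ::
  "nat \<Rightarrow> nat \<Rightarrow> complex vec set \<Rightarrow> complex vec set \<Rightarrow> (nat \<Rightarrow> complex vec) \<Rightarrow> (nat \<Rightarrow> complex vec) \<Rightarrow> bool" where
  "principal_vectors n a S T as bs \<longleftrightarrow>
     (\<forall>k<a. as k \<in> S \<and> bs k \<in> T \<and> unit_cvec n (as k) \<and> unit_cvec n (bs k) \<and>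
        (\<forall>i<k. as k \<bullet>c as i = 0 \<and> bs k \<bullet>c bs i = 0) \<and>
        (\<forall>x y. x \<in> S \<longrightarrow> y \<in> T \<longrightarrow> unit_cvec n x \<longrightarrow> unit_cvec n y \<longrightarrow>
           (\<forall>i<k. x \<bullet>c as i = 0 \<and> y \<bullet>c bs i = 0) \<longrightarrow>
           cmod (x \<bullet>c y) \<le> cmod (as k \<bullet>c bs k)))"

definition sin_sub :: "nat \<Rightarrow> nat \<Rightarrow> complex vec set \<Rightarrow> complex vec set \<Rightarrow> real" where
  "sin_sub n a S T =
     (let (as, bs) = (SOME (as, bs). principal_vectors n a S T as bs)
      in \<Prod>k<a. sin (arccos (cmod (as k \<bullet>c bs k))))"

definition col_span :: "complex mat \<Rightarrow> complex vec set" where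
  "col_span A = {A *\<^sub>v x | x. x \<in> carrier_vec (dim_col A)}"

definition sin_mat :: "complex mat \<Rightarrow> complex mat \<Rightarrow> real" where
  "sin_mat A B =
     (let n = dim_row A; da = vec_space.rank n A; db = vec_space.rank n B in
      if da \<le> db then sin_sub n da (col_span A) (col_span B)
      else sin_sub n db (col_span B) (col_span A))"

definition beta_density :: "real \<Rightarrow> real \<Rightarrow> real \<Rightarrow> real" where
  "beta_density a b x =
     (if 0 < x \<and> x < 1 then x powr (a - 1) * (1 - x) powr (b - 1) / Beta a b else 0)"

text \<open>Beta(a,b) distribution on the reals; Beta(a,0) is read as the point mass at 1
  (its weak limit as b tends to 0).\<close>
definition beta_measure :: "real \<Rightarrow> real \<Rightarrow> real measure" where
  "beta_measure a b =
     (if b = 0 then return borel 1 else density lborel (\<lambda>x. ennreal (beta_density a b x)))"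

definition prod_beta_prob :: "nat \<Rightarrow> nat \<Rightarrow> nat \<Rightarrow> real \<Rightarrow> real" where
  "prod_beta_prob n ts r \<gamma> =
     (let P = PiM {1..r} (\<lambda>j. beta_measure (real (n - ts - j + 1)) (real ts))
      in measure P {b \<in> space P. (\<Prod>j\<in>{1..r}. b j) \<le> \<gamma>})"

end

(* The code consists of the rotations sqrt n * V * I_{n,t*} * U of a single matrix, V unitary, and Y is
   tested against V through the Gram determinant ratio
     det (Y^H V (I - I_{n,t*} I_{n,t*}^H) V^H Y) / det (Y^H Y),
   which is sin^2 of the principal angles between the two column spans.

   - The noise is invariant under unitary maps, so every codeword passes its own test with
     probability at least 1 - eps + tau.
   - For Gaussian Y the ratio is a product of independent Beta variables: a pair of Householder
     reflections concentrates the last column of Y on one coordinate, and expanding both Gram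
     determinants along it splits off the factor |g_J|^2 / |g|^2 and leaves a smaller Gaussian matrix.
   - Codewords are chosen greedily. If none can be added, the union D of the decoding sets has
     probability at least tau under every rotated output. The column span of a full-rank matrix
     rotated by a Haar unitary is distributed like that of a Gaussian matrix, so averaging over V
     shows that D has Gaussian measure at least tau, whereas k codewords give it at most k beta,
     where beta is the probability that the Beta product is at most gamma. *)

theory Submission
  imports Defs
begin

subsection \<open>Complex Gaussian vectors\<close>

text \<open>Haar measure on the unitary group enters only through a sample of it: the
  orthonormalised rows of a square Gaussian matrix. Right multiplication by a unitary preserves the
  Gaussian law and commutes with Gram-Schmidt on rows, and this is all the invariance that the
  averaging uses. The principal vectors are picked by a choice operator, so nothing is known about
  the particular ones. The way out is an identity with Gram determinants that is valid for every
  choice: in principal bases the matrix of cross inner products is diagonal, and a change of basis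
  multiplies numerator and denominator by the same factor. The price is that the columns must be
  independent, which holds almost surely because a translate of Gaussian noise has the same null
  sets. The code size is the ceiling of tau / beta: a word can be added to k words as long as k beta
  < tau, so the last of m words asks only for (m - 1) beta < tau. The tests are multiplied out
  instead of being written as quotients, which keeps their invariance exact where the denominator
  vanishes.\<close>

definition cnormal :: "complex measure" where
  "cnormal = density lborel (\<lambda>z. ennreal (exp (- (cmod z)\<^sup>2) / pi))"

definition gauss :: "'i set \<Rightarrow> ('i \<Rightarrow> complex) measure" where
  "gauss I = PiM I (\<lambda>_. cnormal)"

lemma sets_cnormal [measurable_cong, simp]: "sets cnormal = sets borel"
  by (simp add: cnormal_def)

lemma space_cnormal [simp]: "space cnormal = UNIV"
  by (simp add: cnormal_def)

lemma sets_gauss [measurable_cong]: "sets (gauss I) = sets (PiM I (\<lambda>_. borel))"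
  unfolding gauss_def by (intro sets_PiM_cong) auto

lemma space_gauss: "space (gauss I) = PiE I (\<lambda>_. UNIV)"
  by (simp add: gauss_def space_PiM)

text \<open>The area of a disc is linear in its squared radius, so comparing half-lines replaces a
  change to polar coordinates.\<close>

lemma distr_cmod_sq_lborel:
  "distr lborel borel (\<lambda>z. (cmod z)\<^sup>2) = density lborel (\<lambda>u. ennreal pi * indicator {0..} u)"
proof (rule measure_eqI_generator_eq[where E="range (\<lambda>a::real. {..a})" and \<Omega>=UNIV and A="\<lambda>i. {..real i}"])
  have *: "emeasure (distr lborel borel (\<lambda>z. (cmod z)\<^sup>2)) {..a} = ennreal (pi * max 0 a)" for a :: real
  proof -
    have "emeasure (distr lborel borel (\<lambda>z. (cmod z)\<^sup>2)) {..a} = emeasure lborel {z. (cmod z)\<^sup>2 \<le> a}"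
      by (subst emeasure_distr) (auto intro!: arg_cong[where f="emeasure lborel"])
    also have "\<dots> = ennreal (pi * max 0 a)"
    proof (cases "0 \<le> a")
      case True
      have "{z. (cmod z)\<^sup>2 \<le> a} = cball 0 (sqrt a)"
        using True by (auto simp: real_le_rsqrt norm_minus_commute)
          (metis abs_norm_cancel real_sqrt_le_iff real_sqrt_abs real_sqrt_pow2_iff power_mono norm_ge_zero real_sqrt_pow2)
      then show ?thesis using True
        by (simp add: emeasure_cball unit_ball_vol_2)
    next
      case False
      then have "{z. (cmod z)\<^sup>2 \<le> a} = {}"
        by (auto simp: not_le intro: less_le_trans)
      then show ?thesis using False by simp
    qed
    finally show ?thesis .
  qed
  have **: "emeasure (density lborel (\<lambda>u. ennreal pi * indicator {0..} u)) {..a} = ennreal (pi * max 0 a)" for a :: real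
  proof -
    have "emeasure (density lborel (\<lambda>u. ennreal pi * indicator {0..} u)) {..a} =
        (\<integral>\<^sup>+u. ennreal pi * indicator {0..a} u \<partial>lborel)"
      by (subst emeasure_density) (auto intro!: nn_integral_cong simp: indicator_def)
    also have "\<dots> = ennreal pi * emeasure lborel {0..a}"
      by (subst nn_integral_cmult) auto
    also have "\<dots> = ennreal (pi * max 0 a)"
      by (auto simp: emeasure_lborel_Icc_eq ennreal_mult max_def)
    finally show ?thesis .
  qed
  show "Int_stable (range (\<lambda>a::real. {..a}))"
    by (auto simp: Int_stable_def)
  show "emeasure (distr lborel borel (\<lambda>z. (cmod z)\<^sup>2)) X =
     emeasure (density lborel (\<lambda>u. ennreal pi * indicator {0..} u)) X" if "X \<in> range atMost" for X
    using that * ** by auto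
  show "sets (distr lborel borel (\<lambda>z. (cmod z)\<^sup>2)) = sigma_sets UNIV (range atMost)"
    by (simp add: borel_eq_atMost)
  show "sets (density lborel (\<lambda>u. ennreal pi * indicator {0..} u)) = sigma_sets UNIV (range (\<lambda>a::real. {..a}))"
    by (simp add: borel_eq_atMost)
  show "(\<Union>i. {..real i}) = (UNIV::real set)"
    using real_arch_simple by auto
  show "emeasure (distr lborel borel (\<lambda>z. (cmod z)\<^sup>2)) {..real i} \<noteq> \<infinity>" for i
    by (simp add: *)
qed auto

text \<open>The Gaussian density depends on the squared modulus alone, so it passes through the
  push-forward of Lebesgue measure. The exponential law is written as an Erlang density to make sums
  of squared moduli Erlang too; its total mass also normalises \<open>cnormal\<close>.\<close>

lemma distr_cnormal_cmod_sq:
  "distr cnormal lborel (\<lambda>z. (cmod z)\<^sup>2) = density lborel (erlang_density 0 1)"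
proof (rule measure_eqI)
  fix A assume "A \<in> sets (distr cnormal lborel (\<lambda>z. (cmod z)\<^sup>2))"
  then have A[measurable]: "A \<in> sets borel" by simp
  have A'[measurable]: "(\<lambda>z::complex. (cmod z)\<^sup>2) -` A \<in> sets borel"
    by (rule measurable_sets_borel[OF _ A]) simp
  have "emeasure (distr cnormal lborel (\<lambda>z. (cmod z)\<^sup>2)) A = emeasure cnormal ((\<lambda>z. (cmod z)\<^sup>2) -` A)"
    by (subst emeasure_distr) auto
  also have "\<dots> = (\<integral>\<^sup>+z. (\<lambda>u. ennreal (exp (- u) / pi) * indicator A u) ((cmod z)\<^sup>2) \<partial>lborel)"
    unfolding cnormal_def
    by (subst emeasure_density) (auto intro!: nn_integral_cong simp: indicator_def)
  also have "\<dots> = (\<integral>\<^sup>+u. ennreal (exp (- u) / pi) * indicator A u \<partial>distr lborel borel (\<lambda>z. (cmod z)\<^sup>2))"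
    by (subst nn_integral_distr) auto
  also have "\<dots> = (\<integral>\<^sup>+u. ennreal pi * indicator {0..} u * (ennreal (exp (- u) / pi) * indicator A u) \<partial>lborel)"
    unfolding distr_cmod_sq_lborel by (subst nn_integral_density) auto
  also have "\<dots> = (\<integral>\<^sup>+u. erlang_density 0 1 u * indicator A u \<partial>lborel)"
    by (intro nn_integral_cong) (auto simp: indicator_def erlang_density_def ennreal_mult[symmetric])
  also have "\<dots> = emeasure (density lborel (erlang_density 0 1)) A"
    by (subst emeasure_density) (auto intro!: nn_integral_cong simp: indicator_def)
  finally show "emeasure (distr cnormal lborel (\<lambda>z. (cmod z)\<^sup>2)) A = emeasure (density lborel (erlang_density 0 1)) A" .
qed simp

lemma prob_space_cnormal: "prob_space cnormal"
proof
  have "emeasure (distr cnormal lborel (\<lambda>z. (cmod z)\<^sup>2)) UNIV = 1"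
    unfolding distr_cnormal_cmod_sq
    using prob_space.emeasure_space_1[OF prob_space_erlang_density[of 1 0]] by simp
  then show "emeasure cnormal (space cnormal) = 1"
    by (subst (asm) emeasure_distr) auto
qed

interpretation cnormal: prob_space cnormal by (rule prob_space_cnormal)
interpretation cnormals: product_sigma_finite "\<lambda>_. cnormal" by unfold_locales
interpretation lborels: product_sigma_finite "\<lambda>_. lborel :: complex measure" by unfold_locales

lemma prob_space_gauss: "prob_space (gauss I)"
  unfolding gauss_def by (rule prob_space_PiM) (rule prob_space_cnormal)

lemma gauss_density:
  assumes I: "finite I"
  shows "gauss I = density (PiM I (\<lambda>_. lborel)) (\<lambda>z. \<Prod>i\<in>I. ennreal (exp (- (cmod (z i))\<^sup>2) / pi))"
    (is "_ = density _ ?f")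
  unfolding gauss_def
proof (rule cnormals.PiM_eqI[symmetric, OF I])
  show "sets (density (PiM I (\<lambda>_. lborel)) ?f) = sets (PiM I (\<lambda>_. cnormal))"
    by (simp, intro sets_PiM_cong) auto
  fix A assume A: "\<And>i. i \<in> I \<Longrightarrow> A i \<in> sets cnormal"
  then have [measurable]: "\<And>i. i \<in> I \<Longrightarrow> A i \<in> sets borel" by simp
  have "emeasure (density (PiM I (\<lambda>_. lborel)) ?f) (Pi\<^sub>E I A) =
     (\<integral>\<^sup>+z. ?f z * indicator (Pi\<^sub>E I A) z \<partial>PiM I (\<lambda>_. lborel))"
    using I by (subst emeasure_density) (auto intro!: sets_PiM_I_finite)
  also have "\<dots> = (\<integral>\<^sup>+z. (\<Prod>i\<in>I. ennreal (exp (- (cmod (z i))\<^sup>2) / pi) * indicator (A i) (z i)) \<partial>PiM I (\<lambda>_. lborel))"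
  proof (intro nn_integral_cong)
    fix z :: "_ \<Rightarrow> complex" assume z: "z \<in> space (PiM I (\<lambda>_. lborel))"
    then have "indicator (Pi\<^sub>E I A) z = (\<Prod>i\<in>I. indicator (A i) (z i) :: ennreal)"
      using I by (auto simp: space_PiM PiE_iff indicator_def prod_zero_iff)
    then show "?f z * indicator (Pi\<^sub>E I A) z = (\<Prod>i\<in>I. ennreal (exp (- (cmod (z i))\<^sup>2) / pi) * indicator (A i) (z i))"
      by (simp add: prod.distrib)
  qed
  also have "\<dots> = (\<Prod>i\<in>I. \<integral>\<^sup>+z. ennreal (exp (- (cmod z)\<^sup>2) / pi) * indicator (A i) z \<partial>lborel)"
    by (rule lborels.product_nn_integral_prod[OF I]) auto
  also have "\<dots> = (\<Prod>i\<in>I. emeasure cnormal (A i))"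
    unfolding cnormal_def by (intro prod.cong) (auto simp: emeasure_density)
  finally show "emeasure (density (PiM I (\<lambda>_. lborel)) ?f) (Pi\<^sub>E I A) = (\<Prod>i\<in>I. emeasure cnormal (A i))" .
qed

lemma distr_translate_PiM_lborel:
  fixes w :: "'i \<Rightarrow> complex"
  assumes I: "finite I"
  shows "distr (PiM I (\<lambda>_. lborel)) (PiM I (\<lambda>_. lborel)) (\<lambda>z. \<lambda>i\<in>I. z i + w i) = PiM I (\<lambda>_. lborel)"
proof (rule lborels.PiM_eqI[OF I])
  fix A assume A: "\<And>i. i \<in> I \<Longrightarrow> A i \<in> sets (lborel :: complex measure)"
  then have Am[measurable]: "\<And>i. i \<in> I \<Longrightarrow> A i \<in> sets borel" by simp
  have *: "(\<lambda>z. \<lambda>i\<in>I. z i + w i) -` Pi\<^sub>E I A \<inter> space (PiM I (\<lambda>_. lborel)) = Pi\<^sub>E I (\<lambda>i. (\<lambda>x. x + w i) -` A i)"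
    by (auto simp: space_PiM PiE_iff)
  have "emeasure (distr (PiM I (\<lambda>_. lborel)) (PiM I (\<lambda>_. lborel)) (\<lambda>z. \<lambda>i\<in>I. z i + w i)) (Pi\<^sub>E I A)
    = emeasure (PiM I (\<lambda>_. lborel)) (Pi\<^sub>E I (\<lambda>i. (\<lambda>x. x + w i) -` A i))"
    unfolding *[symmetric] using I
    by (intro emeasure_distr) (auto intro!: sets_PiM_I_finite)
  also have "\<dots> = (\<Prod>i\<in>I. emeasure lborel ((\<lambda>x. x + w i) -` A i))"
    using I by (intro lborels.emeasure_PiM) (auto intro!: measurable_sets_borel[OF _ Am])
  also have "\<dots> = (\<Prod>i\<in>I. emeasure lborel (A i))"
  proof (intro prod.cong refl)
    fix i assume i: "i \<in> I"
    have "emeasure lborel (A i) = emeasure (distr lborel borel ((+) (w i))) (A i)"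
      by (simp add: lborel_distr_plus)
    also have "\<dots> = emeasure lborel ((\<lambda>x. x + w i) -` A i)"
      using i by (subst emeasure_distr) (auto simp: add.commute[of "w i"] vimage_def)
    finally show "emeasure lborel ((\<lambda>x. x + w i) -` A i) = emeasure lborel (A i)" by simp
  qed
  finally show "emeasure (distr (PiM I (\<lambda>_. lborel)) (PiM I (\<lambda>_. lborel)) (\<lambda>z. \<lambda>i\<in>I. z i + w i)) (Pi\<^sub>E I A) = (\<Prod>i\<in>I. emeasure lborel (A i))" .
qed simp

lemma nn_integral_translate_PiM_lborel:
  fixes w :: "'i \<Rightarrow> complex"
  assumes I: "finite I" and f[measurable]: "f \<in> borel_measurable (PiM I (\<lambda>_. borel))"
  shows "(\<integral>\<^sup>+z. f (\<lambda>i\<in>I. z i + w i) \<partial>PiM I (\<lambda>_. lborel)) = (\<integral>\<^sup>+z. f z \<partial>PiM I (\<lambda>_. lborel))"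
proof -
  have [measurable_cong]: "sets (PiM I (\<lambda>_. lborel)) = sets (PiM I (\<lambda>_. borel :: complex measure))"
    by (intro sets_PiM_cong) auto
  show ?thesis
    by (subst (2) distr_translate_PiM_lborel[OF I, of w, symmetric], subst nn_integral_distr) auto
qed

text \<open>The Tonelli computation that proves uniqueness of Haar measure: translating one variable by
  the image of the other shows that \<open>T\<close> preserves Lebesgue measure up to a factor, and the factor
  is read off on a norm-invariant density.\<close>

lemma distr_gauss_isometry:
  fixes T :: "('i \<Rightarrow> complex) \<Rightarrow> 'i \<Rightarrow> complex"
  assumes I: "finite I"
    and Tm: "T \<in> PiM I (\<lambda>_. borel) \<rightarrow>\<^sub>M PiM I (\<lambda>_. borel)"
    and Tn: "\<And>z. z \<in> extensional I \<Longrightarrow> (\<Sum>i\<in>I. (cmod (T z i))\<^sup>2) = (\<Sum>i\<in>I. (cmod (z i))\<^sup>2)"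
    and Tt: "\<And>w. w \<in> extensional I \<Longrightarrow> \<exists>w'. \<forall>z\<in>extensional I.
               T (\<lambda>i\<in>I. z i + w' i) = (\<lambda>i\<in>I. T z i + w i)"
  shows "distr (gauss I) (gauss I) T = gauss I"
proof -
  let ?L = "PiM I (\<lambda>_. lborel :: complex measure)"
  let ?f = "\<lambda>z::'i \<Rightarrow> complex. \<Prod>i\<in>I. ennreal (exp (- (cmod (z i))\<^sup>2) / pi)"
  interpret L: sigma_finite_measure ?L by (rule lborels.sigma_finite[OF I])
  interpret LL: pair_sigma_finite ?L ?L ..
  have sL[measurable_cong]: "sets ?L = sets (PiM I (\<lambda>_. borel :: complex measure))"
    by (intro sets_PiM_cong) auto
  note Tm[measurable]
  have Te: "T z \<in> extensional I" if "z \<in> extensional I" for z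
    using measurable_space[OF Tm, of z] that by (simp add: space_PiM PiE_def)
  have f_eq: "?f z = ennreal (exp (- (\<Sum>i\<in>I. (cmod (z i))\<^sup>2)) / pi ^ card I)" for z
    using I by (simp add: prod_ennreal prod_dividef exp_sum sum_negf[symmetric])
  have fT: "?f (T z) = ?f z" if "z \<in> extensional I" for z
    unfolding f_eq using Tn[OF that] by simp
  have f1: "(\<integral>\<^sup>+z. ?f z \<partial>?L) = 1"
  proof -
    have "(\<integral>\<^sup>+z. ?f z \<partial>?L) = emeasure (gauss I) (space (gauss I))"
      unfolding gauss_density[OF I] by (subst emeasure_density) (auto intro!: nn_integral_cong)
    then show ?thesis using prob_space.emeasure_space_1[OF prob_space_gauss[of I]] by simp
  qed
  have inv: "(\<integral>\<^sup>+y. g (T y) \<partial>?L) = (\<integral>\<^sup>+x. g x \<partial>?L)"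
    if gm[measurable]: "g \<in> borel_measurable (PiM I (\<lambda>_. borel))" for g :: "('i \<Rightarrow> complex) \<Rightarrow> ennreal"
  proof -
    have ext: "z \<in> extensional I" if "z \<in> space ?L" for z
      using that by (simp add: space_PiM PiE_def)
    have shift: "(\<integral>\<^sup>+y. h (\<lambda>i\<in>I. T y i + w i) \<partial>?L) = (\<integral>\<^sup>+y. h (T y) \<partial>?L)"
      if [measurable]: "h \<in> borel_measurable (PiM I (\<lambda>_. borel))" and "w \<in> extensional I"
      for h :: "('i \<Rightarrow> complex) \<Rightarrow> ennreal" and w
    proof -
      obtain w' where w': "\<And>z. z \<in> extensional I \<Longrightarrow> T (\<lambda>i\<in>I. z i + w' i) = (\<lambda>i\<in>I. T z i + w i)"
        using Tt[OF \<open>w \<in> extensional I\<close>] by blast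
      have "(\<integral>\<^sup>+y. h (\<lambda>i\<in>I. T y i + w i) \<partial>?L) = (\<integral>\<^sup>+y. h (T (\<lambda>i\<in>I. y i + w' i)) \<partial>?L)"
        by (intro nn_integral_cong) (simp add: w' ext)
      also have "\<dots> = (\<integral>\<^sup>+y. h (T y) \<partial>?L)"
        by (rule nn_integral_translate_PiM_lborel[OF I, of "\<lambda>z. h (T z)"]) measurable
      finally show ?thesis .
    qed
    have "(\<integral>\<^sup>+y. g (T y) \<partial>?L) = (\<integral>\<^sup>+x. ?f x * (\<integral>\<^sup>+y. g (T y) \<partial>?L) \<partial>?L)"
      by (subst nn_integral_multc) (auto simp: f1)
    also have "\<dots> = (\<integral>\<^sup>+x. (\<integral>\<^sup>+y. ?f x * g (\<lambda>i\<in>I. T y i + x i) \<partial>?L) \<partial>?L)"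
    proof (intro nn_integral_cong)
      fix x assume x[measurable]: "x \<in> space ?L"
      show "?f x * (\<integral>\<^sup>+y. g (T y) \<partial>?L) = (\<integral>\<^sup>+y. ?f x * g (\<lambda>i\<in>I. T y i + x i) \<partial>?L)"
        by (subst nn_integral_cmult) (auto simp: shift ext[OF x])
    qed
    also have "\<dots> = (\<integral>\<^sup>+y. (\<integral>\<^sup>+x. ?f x * g (\<lambda>i\<in>I. T y i + x i) \<partial>?L) \<partial>?L)"
      by (rule LL.Fubini') measurable
    \<comment> \<open>Shifting \<open>x\<close> by \<open>T y\<close> moves the dependence on
      \<open>y\<close> from \<open>g\<close> to the density, so that the integral over
      \<open>y\<close> can be evaluated for fixed \<open>x\<close>.\<close>
    also have "\<dots> = (\<integral>\<^sup>+y. (\<integral>\<^sup>+x. ?f (\<lambda>i\<in>I. x i - T y i) * g x \<partial>?L) \<partial>?L)"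
    proof (rule nn_integral_cong)
      fix y assume y: "y \<in> space ?L"
      have "(\<integral>\<^sup>+x. ?f (\<lambda>i\<in>I. x i - T y i) * g x \<partial>?L) =
        (\<integral>\<^sup>+x. (\<lambda>x. ?f (\<lambda>i\<in>I. x i - T y i) * g x) (\<lambda>i\<in>I. x i + T y i) \<partial>?L)"
      proof (rule nn_integral_translate_PiM_lborel[OF I, symmetric])
        have "(\<lambda>x. (\<Prod>i\<in>I. ennreal (exp (- (cmod (x i - T y i))\<^sup>2) / pi)) * g x) \<in> borel_measurable (PiM I (\<lambda>_. borel))"
          by measurable
        then show "(\<lambda>x. ?f (\<lambda>i\<in>I. x i - T y i) * g x) \<in> borel_measurable (PiM I (\<lambda>_. borel))"
          by (simp cong: prod.cong)
      qed
      also have "\<dots> = (\<integral>\<^sup>+x. ?f x * g (\<lambda>i\<in>I. T y i + x i) \<partial>?L)"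
        by (intro nn_integral_cong arg_cong2[where f="(*)"] prod.cong arg_cong[where f=g])
           (auto simp: add.commute fun_eq_iff restrict_def)
      finally show "(\<integral>\<^sup>+x. ?f x * g (\<lambda>i\<in>I. T y i + x i) \<partial>?L) = (\<integral>\<^sup>+x. ?f (\<lambda>i\<in>I. x i - T y i) * g x \<partial>?L)" ..
    qed
    also have "\<dots> = (\<integral>\<^sup>+x. (\<integral>\<^sup>+y. ?f (\<lambda>i\<in>I. x i - T y i) * g x \<partial>?L) \<partial>?L)"
      by (rule LL.Fubini', simp cong: prod.cong, measurable)
    also have "\<dots> = (\<integral>\<^sup>+x. g x \<partial>?L)"
    proof (intro nn_integral_cong)
      fix x assume x[measurable]: "x \<in> space ?L"
      have "(\<integral>\<^sup>+y. ?f (\<lambda>i\<in>I. x i - T y i) * g x \<partial>?L) = (\<integral>\<^sup>+y. ?f (\<lambda>i\<in>I. T y i + (\<lambda>i\<in>I. - x i) i) \<partial>?L) * g x"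
        by (subst nn_integral_multc)
          (auto intro!: arg_cong2[where f="(*)"] nn_integral_cong prod.cong arg_cong[where f=ennreal]
            simp: norm_minus_commute)
      also have "(\<integral>\<^sup>+y. ?f (\<lambda>i\<in>I. T y i + (\<lambda>i\<in>I. - x i) i) \<partial>?L) = (\<integral>\<^sup>+y. ?f (T y) \<partial>?L)"
        by (rule shift) (auto simp: extensional_def)
      also have "\<dots> = 1"
        by (subst f1[symmetric]) (intro nn_integral_cong fT ext)
      finally show "(\<integral>\<^sup>+y. ?f (\<lambda>i\<in>I. x i - T y i) * g x \<partial>?L) = g x" by simp
    qed
    finally show ?thesis .
  qed
  have [measurable]: "T \<in> gauss I \<rightarrow>\<^sub>M gauss I"
    using Tm by (simp add: measurable_cong_sets[OF sets_gauss sets_gauss])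
  show ?thesis
  proof (rule measure_eqI)
    fix A assume "A \<in> sets (distr (gauss I) (gauss I) T)"
    then have A[measurable]: "A \<in> sets (PiM I (\<lambda>_. borel))" by (simp add: sets_gauss)
    have A'[measurable]: "T -` A \<inter> space (gauss I) \<in> sets (PiM I (\<lambda>_. borel))"
      using measurable_sets[OF Tm A] by (simp add: space_gauss space_PiM)
    have "emeasure (distr (gauss I) (gauss I) T) A = emeasure (gauss I) (T -` A \<inter> space (gauss I))"
      by (subst emeasure_distr) auto
    also have "\<dots> = (\<integral>\<^sup>+y. ?f y * indicator (T -` A \<inter> space (gauss I)) y \<partial>?L)"
      using A' by (subst gauss_density[OF I], subst emeasure_density) (auto simp: sL)
    also have "\<dots> = (\<integral>\<^sup>+y. (\<lambda>x. ?f x * indicator A x) (T y) \<partial>?L)"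
      by (intro nn_integral_cong) (auto simp: fT space_PiM PiE_def indicator_def space_gauss)
    also have "\<dots> = (\<integral>\<^sup>+x. ?f x * indicator A x \<partial>?L)"
      by (rule inv) measurable
    also have "\<dots> = emeasure (gauss I) A"
      by (subst gauss_density[OF I], subst emeasure_density) auto
    finally show "emeasure (distr (gauss I) (gauss I) T) A = emeasure (gauss I) A" .
  qed simp
qed

section \<open>From sums of squared moduli to Beta laws\<close>

lemma distr_gauss_sum_cmod_sq:
  fixes J :: "'i set"
  assumes J: "finite J" "J \<noteq> {}"
  shows "distr (gauss J) borel (\<lambda>z. \<Sum>i\<in>J. (cmod (z i))\<^sup>2) = density lborel (erlang_density (card J - 1) 1)"
proof -
  interpret G: prob_space "gauss J" by (rule prob_space_gauss)
  have comp: "distr (gauss J) borel (\<lambda>z. z i) = cnormal" if "i \<in> J" for i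
  proof -
    interpret P: product_prob_space "\<lambda>_. cnormal" J by unfold_locales
    have "distr (gauss J) cnormal (\<lambda>z. z i) = cnormal"
      unfolding gauss_def using P.PiM_component[OF that] by simp
    moreover have "distr (gauss J) borel (\<lambda>z. z i) = distr (gauss J) cnormal (\<lambda>z. z i)"
      by (intro distr_cong) auto
    ultimately show ?thesis by simp
  qed
  have rv: "(\<lambda>z. z i) \<in> gauss J \<rightarrow>\<^sub>M borel" if "i \<in> J" for i
    using that by measurable
  have ind: "G.indep_vars (\<lambda>_. borel) (\<lambda>i z. z i) J"
  proof (subst G.indep_vars_iff_distr_eq_PiM'[OF J(2) rv])
    have "distr (gauss J) (PiM J (\<lambda>_. borel)) (\<lambda>z. \<lambda>i\<in>J. z i) = distr (gauss J) (gauss J) (\<lambda>z. z)"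
      by (intro distr_cong) (auto simp: sets_gauss space_gauss PiE_def extensional_restrict)
    also have "\<dots> = PiM J (\<lambda>i. distr (gauss J) borel (\<lambda>z. z i))"
      by (simp add: distr_id2 sets_gauss[symmetric], subst gauss_def, intro PiM_cong) (auto simp: comp)
    finally show "distr (gauss J) (PiM J (\<lambda>_. borel)) (\<lambda>z. \<lambda>i\<in>J. z i) = PiM J (\<lambda>i. distr (gauss J) borel (\<lambda>z. z i))" .
  qed simp
  \<comment> \<open>\<open>erlang_density k\<close> is the Gamma density of shape
    \<open>k + 1\<close>, hence the \<open>- 1\<close>.\<close>
  have "distributed (gauss J) lborel (\<lambda>z. \<Sum>i\<in>J. (cmod (z i))\<^sup>2) (erlang_density ((\<Sum>i\<in>J. Suc 0) - 1) 1)"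
  proof (rule G.erlang_distributed_sum[OF J])
    show "G.indep_vars (\<lambda>i. borel) (\<lambda>i z. (cmod (z i))\<^sup>2) J"
      by (rule G.indep_vars_compose2[OF ind, of "\<lambda>_ x. (cmod x)\<^sup>2"]) simp
    show "distributed (gauss J) lborel (\<lambda>z. (cmod (z i))\<^sup>2) (erlang_density 0 1)" if i: "i \<in> J" for i
    proof -
      note rv[OF i, measurable]
      have "distr (gauss J) lborel (\<lambda>z. (cmod (z i))\<^sup>2) = distr (distr (gauss J) borel (\<lambda>z. z i)) lborel (\<lambda>z. (cmod z)\<^sup>2)"
        by (subst distr_distr) (auto simp: comp_def)
      then show ?thesis
        unfolding distributed_def by (simp add: comp[OF i] distr_cnormal_cmod_sq)
    qed
  qed simp
  then have "distr (gauss J) lborel (\<lambda>z. \<Sum>i\<in>J. (cmod (z i))\<^sup>2) = density lborel (erlang_density (card J - 1) 1)"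
    unfolding distributed_def by simp
  moreover have "distr (gauss J) borel (\<lambda>z. \<Sum>i\<in>J. (cmod (z i))\<^sup>2) = distr (gauss J) lborel (\<lambda>z. \<Sum>i\<in>J. (cmod (z i))\<^sup>2)"
    by (intro distr_cong) auto
  ultimately show ?thesis by simp
qed

text \<open>Substituting \<open>w = x + y\<close> and then \<open>x = w * s\<close> turns the
  product of the two Gamma densities, Jacobian \<open>w\<close> included, into a Gamma density in
  \<open>w\<close> times the Beta density in \<open>s\<close>; the integral over \<open>w\<close> is
  then 1.\<close>

lemma nn_integral_erlang_ratio:
  assumes h[measurable]: "h \<in> borel_measurable borel"
  shows "(\<integral>\<^sup>+x. (\<integral>\<^sup>+y. h (x / (x + y)) \<partial>density lborel (erlang_density m 1)) \<partial>density lborel (erlang_density k 1))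
    = (\<integral>\<^sup>+s. h s \<partial>density lborel (\<lambda>x. ennreal (beta_density (real (Suc k)) (real (Suc m)) x)))"
proof -
  let ?e = "\<lambda>k x. ennreal (erlang_density k 1 x)"
  \<comment> \<open>The reciprocal of the Beta function at \<open>k + 1\<close> and
    \<open>m + 1\<close>, in factorials.\<close>
  define c :: real where "c = fact (k + m + 1) / (fact k * fact m)"
  define b where "b s = (if 0 < s \<and> s < 1 then c * s ^ k * (1 - s) ^ m else 0)" for s :: real
  have [measurable]: "b \<in> borel_measurable borel"
    unfolding b_def by measurable
  have b_eq: "beta_density (real (Suc k)) (real (Suc m)) = b"
  proof
    fix s
    have "Beta (real (Suc k)) (real (Suc m)) = 1 / c"
      unfolding Beta_def c_def using Gamma_fact[of k, where 'a=real] Gamma_fact[of m, where 'a=real] Gamma_fact[of "k+m+1", where 'a=real]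
      by (simp add: add_ac)
    then show "beta_density (real (Suc k)) (real (Suc m)) s = b s"
      by (auto simp: beta_density_def b_def powr_realpow)
  qed
  have "(\<integral>\<^sup>+x. (\<integral>\<^sup>+y. h (x / (x + y)) \<partial>density lborel (erlang_density m 1)) \<partial>density lborel (erlang_density k 1))
    = (\<integral>\<^sup>+x. ?e k x * (\<integral>\<^sup>+y. ?e m y * h (x / (x + y)) \<partial>lborel) \<partial>lborel)"
    by (subst nn_integral_density) (auto simp: nn_integral_density)
  also have "\<dots> = (\<integral>\<^sup>+x. (\<integral>\<^sup>+w. ?e k x * ?e m (w - x) * h (x / w) \<partial>lborel) \<partial>lborel)"
  proof (rule nn_integral_cong)
    fix x :: real
    have "(\<integral>\<^sup>+y. ?e m y * h (x / (x + y)) \<partial>lborel) = (\<integral>\<^sup>+w. ?e m (w - x) * h (x / w) \<partial>lborel)"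
      by (subst nn_integral_real_affine[where c=1 and t="-x"]) auto
    then show "?e k x * (\<integral>\<^sup>+y. ?e m y * h (x / (x + y)) \<partial>lborel) =
        (\<integral>\<^sup>+w. ?e k x * ?e m (w - x) * h (x / w) \<partial>lborel)"
      by (simp add: nn_integral_cmult[symmetric] mult.assoc)
  qed
  also have "\<dots> = (\<integral>\<^sup>+w. (\<integral>\<^sup>+x. ?e k x * ?e m (w - x) * h (x / w) \<partial>lborel) \<partial>lborel)"
    by (rule lborel_pair.Fubini') measurable
  also have "\<dots> = (\<integral>\<^sup>+w. (\<integral>\<^sup>+s. ?e (k + m + 1) w * (ennreal (b s) * h s) \<partial>lborel) \<partial>lborel)"
  proof (rule nn_integral_cong_AE)
    show "AE w in lborel. (\<integral>\<^sup>+x. ?e k x * ?e m (w - x) * h (x / w) \<partial>lborel) =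
       (\<integral>\<^sup>+s. ?e (k + m + 1) w * (ennreal (b s) * h s) \<partial>lborel)"
      using AE_lborel_singleton[of 0]
    proof eventually_elim
      fix w :: real assume "w \<noteq> 0"
      then consider "w < 0" | "0 < w" by linarith
      then show "(\<integral>\<^sup>+x. ?e k x * ?e m (w - x) * h (x / w) \<partial>lborel) =
       (\<integral>\<^sup>+s. ?e (k + m + 1) w * (ennreal (b s) * h s) \<partial>lborel)"
      proof cases
        case 1
        then have z1: "?e k x * ?e m (w - x) = 0" for x
          by (auto simp: erlang_density_def)
        have z2: "?e (k + m + 1) w = 0"
          using 1 by (simp add: erlang_density_def)
        show ?thesis unfolding z1 z2 by simp
      next
        case 2
        have "(\<integral>\<^sup>+x. ?e k x * ?e m (w - x) * h (x / w) \<partial>lborel) =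
            ennreal w * (\<integral>\<^sup>+s. ?e k (w * s) * ?e m (w - w * s) * h s \<partial>lborel)"
          using 2 by (subst nn_integral_real_affine[where c=w and t=0]) auto
        also have "\<dots> = (\<integral>\<^sup>+s. ennreal w * (?e k (w * s) * ?e m (w - w * s) * h s) \<partial>lborel)"
          by (subst nn_integral_cmult) auto
        also have "\<dots> = (\<integral>\<^sup>+s. ?e (k + m + 1) w * (ennreal (b s) * h s) \<partial>lborel)"
        proof (rule nn_integral_cong_AE)
          show "AE s in lborel. ennreal w * (?e k (w * s) * ?e m (w - w * s) * h s) =
              ?e (k + m + 1) w * (ennreal (b s) * h s)"
            \<comment> \<open>The endpoints are set aside because an Erlang density of index 0 is
              positive at 0, where \<open>b\<close> is 0.\<close>
            using AE_lborel_singleton[of 0] AE_lborel_singleton[of 1]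
          proof eventually_elim
            fix s :: real assume s: "s \<noteq> 0" "s \<noteq> 1"
            have "w * (erlang_density k 1 (w * s) * erlang_density m 1 (w - w * s)) = erlang_density (k + m + 1) 1 w * b s"
            proof (cases "0 < s \<and> s < 1")
              case True
              then have "0 < w * s" "0 < w * (1 - s)" using 2 by auto
              moreover have ws: "w - w * s = w * (1 - s)" by (simp add: algebra_simps)
              moreover have "exp (- (w * s)) * exp (- (w * (1 - s))) = exp (- w)"
                by (simp add: exp_add[symmetric] algebra_simps)
              ultimately have "w * (erlang_density k 1 (w * s) * erlang_density m 1 (w - w * s))
                  = w * (w ^ k * w ^ m) * exp (- w) * (s ^ k * (1 - s) ^ m) / (fact k * fact m)"
                unfolding ws by (simp add: erlang_density_def power_mult_distrib)
              also have "\<dots> = (w ^ (k + m + 1) * exp (- w) / fact (k + m + 1)) * (c * s ^ k * (1 - s) ^ m)"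
                unfolding c_def by (simp add: power_add del: fact_Suc)
              also have "\<dots> = erlang_density (k + m + 1) 1 w * b s"
                using True 2 by (simp add: erlang_density_def b_def)
              finally show ?thesis .
            next
              case False
              then have "s < 0 \<or> 1 < s" using s by linarith
              then have "w * s < 0 \<or> w - w * s < 0" using 2 
                by (auto simp: mult_less_0_iff)
              then have "erlang_density k 1 (w * s) * erlang_density m 1 (w - w * s) = 0"
                by (auto simp: erlang_density_def)
              then show ?thesis using False by (auto simp: b_def)
            qed
            then have "ennreal w * (?e k (w * s) * ?e m (w - w * s)) = ?e (k + m + 1) w * ennreal (b s)"
              using 2 by (simp add: ennreal_mult'[symmetric] ennreal_mult''[symmetric])
            then show "ennreal w * (?e k (w * s) * ?e m (w - w * s) * h s) = ?e (k + m + 1) w * (ennreal (b s) * h s)"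
              by (simp add: mult.assoc[symmetric])
          qed
        qed
        finally show ?thesis .
      qed
    qed
  qed
  also have "\<dots> = (\<integral>\<^sup>+w. ?e (k + m + 1) w * (\<integral>\<^sup>+s. ennreal (b s) * h s \<partial>lborel) \<partial>lborel)"
    by (intro nn_integral_cong nn_integral_cmult) measurable
  also have "\<dots> = (\<integral>\<^sup>+w. ?e (k + m + 1) w \<partial>lborel) * (\<integral>\<^sup>+s. ennreal (b s) * h s \<partial>lborel)"
    by (rule nn_integral_multc) measurable
  also have "(\<integral>\<^sup>+w. ?e (k + m + 1) w \<partial>lborel) = 1"
    using nn_integral_erlang_ith_moment[of 1 "k + m + 1" 0] by simp
  also have "1 * (\<integral>\<^sup>+s. ennreal (b s) * h s \<partial>lborel) = (\<integral>\<^sup>+s. h s \<partial>density lborel (\<lambda>x. ennreal (b x)))"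
    by (subst nn_integral_density) auto
  finally show ?thesis unfolding b_eq .
qed

lemma AE_gauss_sum_cmod_sq_pos:
  assumes J: "finite J" "J \<noteq> {}" "J \<subseteq> I" "finite I"
  shows "AE z in gauss I. 0 < (\<Sum>i\<in>J. (cmod (z i))\<^sup>2)"
proof -
  interpret P: product_prob_space "\<lambda>_. cnormal" I by unfold_locales
  obtain j where j: "j \<in> J" using J by auto
  have "AE z in cnormal. z \<noteq> 0"
    unfolding cnormal_def using AE_lborel_singleton[of "0::complex"] by (subst AE_density) auto
  then have "AE z in gauss I. z j \<noteq> 0"
    unfolding gauss_def using j J(3) by (intro P.AE_component) auto
  then show ?thesis
  proof eventually_elim
    fix z :: "_ \<Rightarrow> complex" assume "z j \<noteq> 0"
    then show "0 < (\<Sum>i\<in>J. (cmod (z i))\<^sup>2)"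
      using J(1) j by (intro sum_pos2[of J j]) auto
  qed
qed

text \<open>The coordinates in \<open>J\<close> and those outside it are independent, so the ratio
  has the form \<open>x / (x + y)\<close> with Erlang variables. Complex coordinates make the Beta
  parameters plain cardinalities, without halves. For \<open>J = I\<close> the ratio is almost
  surely 1, which matches the point mass that \<open>beta_measure\<close> assigns to a zero second
  parameter.\<close>

lemma nn_integral_gauss_beta:
  assumes I: "finite I" "J \<subseteq> I" "J \<noteq> {}" and h[measurable]: "h \<in> borel_measurable borel"
  shows "(\<integral>\<^sup>+z. h ((\<Sum>i\<in>J. (cmod (z i))\<^sup>2) / (\<Sum>i\<in>I. (cmod (z i))\<^sup>2)) \<partial>gauss I)
     = (\<integral>\<^sup>+s. h s \<partial>beta_measure (real (card J)) (real (card I - card J)))"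
proof (cases "J = I")
  case True
  interpret G: prob_space "gauss I" by (rule prob_space_gauss)
  have "AE z in gauss I. 0 < (\<Sum>i\<in>I. (cmod (z i))\<^sup>2)"
    using I True by (intro AE_gauss_sum_cmod_sq_pos) auto
  then have "AE z in gauss I. h ((\<Sum>i\<in>J. (cmod (z i))\<^sup>2) / (\<Sum>i\<in>I. (cmod (z i))\<^sup>2)) = h 1"
    by eventually_elim (simp add: True)
  then have "(\<integral>\<^sup>+z. h ((\<Sum>i\<in>J. (cmod (z i))\<^sup>2) / (\<Sum>i\<in>I. (cmod (z i))\<^sup>2)) \<partial>gauss I) = (\<integral>\<^sup>+z. h 1 \<partial>gauss I)"
    by (rule nn_integral_cong_AE)
  also have "\<dots> = h 1" by (simp add: G.emeasure_space_1)
  finally show ?thesis using True by (simp add: beta_measure_def nn_integral_return)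
next
  case False
  have fin: "finite J" "finite (I - J)" "I - J \<noteq> {}" using I False finite_subset by auto
  have un: "J \<union> (I - J) = I" "J \<inter> (I - J) = {}" using I by auto
  have split: "(\<Sum>i\<in>I. f i) = (\<Sum>i\<in>J. f i) + (\<Sum>i\<in>I - J. f i)" for f :: "_ \<Rightarrow> real"
    using sum.union_disjoint[OF fin(1,2) un(2), of f] un(1) by simp
  have cJ: "card J > 0" "card I = card J + card (I - J)" "card (I - J) > 0"
    using fin I card_Un_disjoint[OF fin(1,2) un(2)] unfolding un by (auto simp: card_gt_0_iff)
  let ?S = "\<lambda>J z. \<Sum>i\<in>J. (cmod (z i))\<^sup>2"
  interpret E: prob_space "density lborel (\<lambda>x. ennreal (erlang_density (card (I - J) - 1) 1 x))"
    by (rule prob_space_erlang_density) simp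
  have m: "(\<lambda>x. \<integral>\<^sup>+y. h (x / (x + y)) \<partial>density lborel (erlang_density (card (I - J) - 1) 1)) \<in> borel_measurable borel"
    by measurable
  have hm: "(\<lambda>z. h (?S J z / ?S I z)) \<in> borel_measurable (PiM I (\<lambda>_. cnormal))"
    by measurable (use I(2) in auto)
  have "(\<integral>\<^sup>+z. h (?S J z / ?S I z) \<partial>gauss I) =
      (\<integral>\<^sup>+x. (\<integral>\<^sup>+y. h (?S J (merge J (I - J) (x, y)) / ?S I (merge J (I - J) (x, y))) \<partial>gauss (I - J)) \<partial>gauss J)"
    unfolding gauss_def
    by (rule cnormals.product_nn_integral_fold[OF un(2) fin(1,2), of "\<lambda>z. h (?S J z / ?S I z)", unfolded un(1), OF hm])
  also have "\<dots> = (\<integral>\<^sup>+x. (\<integral>\<^sup>+y. h (?S J x / (?S J x + ?S (I - J) y)) \<partial>gauss (I - J)) \<partial>gauss J)"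
    by (intro nn_integral_cong, subst split) (simp add: merge_def)
  also have "\<dots> = (\<integral>\<^sup>+x. (\<lambda>x. (\<integral>\<^sup>+y. h (x / (x + y)) \<partial>density lborel (erlang_density (card (I - J) - 1) 1))) (?S J x) \<partial>gauss J)"
    unfolding distr_gauss_sum_cmod_sq[OF fin(2,3), symmetric]
    by (intro nn_integral_cong, subst nn_integral_distr) auto
  also have "\<dots> = (\<integral>\<^sup>+x. (\<integral>\<^sup>+y. h (x / (x + y)) \<partial>density lborel (erlang_density (card (I - J) - 1) 1))
      \<partial>density lborel (erlang_density (card J - 1) 1))"
    unfolding distr_gauss_sum_cmod_sq[OF fin(1) I(3), symmetric]
  proof (rule nn_integral_distr[symmetric])
    show "?S J \<in> borel_measurable (gauss J)" by measurable
  qed (simp only: measurable_distr_eq1 m)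
  also have "\<dots> = (\<integral>\<^sup>+s. h s \<partial>beta_measure (real (card J)) (real (card I - card J)))"
    unfolding nn_integral_erlang_ratio[OF h] beta_measure_def using cJ by simp
  finally show ?thesis .
qed

subsection \<open>Gram determinants of Gaussian matrices\<close>

text \<open>This is det (Z_J^H Z_J) for the submatrix of \<open>z\<close> with rows \<open>J\<close>
  and the first \<open>r\<close> columns. Rows form an arbitrary index set, so that deleting one is
  a set difference; columns are numbered because inductions strip the last one.\<close>

definition gramdet :: "'i set \<Rightarrow> nat \<Rightarrow> ('i \<times> nat \<Rightarrow> complex) \<Rightarrow> complex" where
  "gramdet J r z = det (mat r r (\<lambda>(k, l). \<Sum>i\<in>J. cnj (z (i, k)) * z (i, l)))"

lemma cnj_mult_self: "cnj z * z = complex_of_real ((cmod z)\<^sup>2)"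
  by (simp only: complex_norm_square mult.commute)

lemma sum_cmod_sq_eqI:
  "(\<Sum>i\<in>A. cnj (x i) * x i) = (\<Sum>i\<in>B. cnj (y i) * y i) \<Longrightarrow> (\<Sum>i\<in>A. (cmod (x i))\<^sup>2) = (\<Sum>i\<in>B. (cmod (y i))\<^sup>2)"
  by (simp only: cnj_mult_self of_real_sum[symmetric] of_real_eq_iff)

lemma gramdet_cong:
  "(\<And>i k. i \<in> J \<Longrightarrow> k < r \<Longrightarrow> z (i, k) = z' (i, k)) \<Longrightarrow> gramdet J r z = gramdet J r z'"
  unfolding gramdet_def by (intro arg_cong[where f=det] eq_matI) (auto intro!: sum.cong)

lemma gramdet_0 [simp]: "gramdet J 0 z = 1"
  unfolding gramdet_def by (rule det_dim_zero) simp

lemma borel_measurable_det: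
  assumes "\<And>k l. k < r \<Longrightarrow> l < r \<Longrightarrow> (\<lambda>x. f x (k, l)) \<in> borel_measurable M"
  shows "(\<lambda>x. det (mat r r (f x)) :: complex) \<in> borel_measurable M"
proof -
  have permutes_less: "p i < r" if "p permutes {0..<r}" "i < r" for p i
    using permutes_in_image[OF that(1), of i] that(2) by simp
  have "(\<lambda>x. det (mat r r (f x))) = (\<lambda>x. \<Sum>p\<in>{p. p permutes {0..<r}}. signof p * (\<Prod>i=0..<r. f x (i, p i)))"
    by (auto simp: det_def fun_eq_iff permutes_less intro!: sum.cong prod.cong)
  also have "\<dots> \<in> borel_measurable M"
    by (intro borel_measurable_sum borel_measurable_times borel_measurable_prod borel_measurable_const assms)
       (auto simp: permutes_less)
  finally show ?thesis .
qed

lemma borel_measurable_cnj [measurable (raw)]: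
  "f \<in> borel_measurable M \<Longrightarrow> (\<lambda>x. cnj (f x)) \<in> borel_measurable M"
  using borel_measurable_continuous_onI[OF continuous_on_cnj[OF continuous_on_id]]
  by (rule measurable_compose[rotated])

lemma borel_measurable_gramdet:
  assumes "\<And>i k. i \<in> J \<Longrightarrow> k < r \<Longrightarrow> (\<lambda>x. f x (i, k)) \<in> borel_measurable M"
  shows "(\<lambda>x. gramdet J r (f x)) \<in> borel_measurable M"
  unfolding gramdet_def
proof (rule borel_measurable_det)
  fix k l assume "k < r" "l < r"
  note [measurable] = assms[OF _ \<open>k < r\<close>] assms[OF _ \<open>l < r\<close>]
  show "(\<lambda>x. case (k, l) of (k, l) \<Rightarrow> \<Sum>i\<in>J. cnj (f x (i, k)) * f x (i, l)) \<in> borel_measurable M"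
    by simp
qed

lemma measurable_gramdet_gauss:
  "J \<subseteq> I \<Longrightarrow> {..<r} \<subseteq> C \<Longrightarrow> gramdet J r \<in> borel_measurable (gauss (I \<times> C))"
  using borel_measurable_gramdet[of J r "\<lambda>z. z" "gauss (I \<times> C)"]
  unfolding measurable_cong_sets[OF sets_gauss refl]
  by (auto intro!: measurable_component_singleton simp: subset_eq)

lemma det_zero_col:
  fixes A :: "'a::comm_ring_1 mat"
  assumes "A \<in> carrier_mat n n" "c < n" "\<And>i. i < n \<Longrightarrow> A $$ (i, c) = 0"
  shows "det A = 0"
  using assms by (subst laplace_expansion_column[of A n c]) auto

lemma gramdet_empty_Suc [simp]: "gramdet {} (Suc r) z = 0"
  unfolding gramdet_def by (rule det_zero_col[of _ "Suc r" 0]) auto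

text \<open>Within \<open>J\<close> the last column lives on row \<open>j\<close> only, so
  subtracting multiples of the last row of the Gram matrix removes the contribution of row
  \<open>j\<close> from all other rows and clears the last column above the diagonal.\<close>

lemma gramdet_Suc_axis:
  assumes J: "finite J" "j \<in> J" and z: "\<And>i. i \<in> J - {j} \<Longrightarrow> z (i, r) = 0"
  shows "gramdet J (Suc r) z = of_real ((cmod (z (j, r)))\<^sup>2) * gramdet (J - {j}) r z"
proof -
  define c where "c = z (j, r)"
  let ?K = "\<lambda>k l. \<Sum>i\<in>J - {j}. cnj (z (i, k)) * z (i, l)"
  have split: "(\<Sum>i\<in>J. cnj (z (i, k)) * z (i, l)) = cnj (z (j, k)) * z (j, l) + ?K k l" for k l
    using J by (simp add: sum.remove)
  have K0: "?K k r = 0" "?K r k = 0" for k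
    using z by (auto intro!: sum.neutral)
  let ?M = "mat (Suc r) (Suc r) (\<lambda>(k, l). \<Sum>i\<in>J. cnj (z (i, k)) * z (i, l))"
  show ?thesis
  proof (cases "c = 0")
    case True
    have "det ?M = 0"
      by (rule det_zero_col[of _ "Suc r" r]) (use True in \<open>auto simp: split K0 c_def\<close>)
    then show ?thesis using True by (simp add: gramdet_def c_def)
  next
    case False
    \<comment> \<open>\<open>?A\<close> undoes the elimination. It divides by \<open>cnj c\<close>,
      which is why \<open>c = 0\<close> is a case of its own.\<close>
    let ?A = "mat (Suc r) (Suc r) (\<lambda>(k, l). if k = l then 1 else if l = r then cnj (z (j, k)) / cnj c else 0)"
    let ?B = "mat (Suc r) (Suc r) (\<lambda>(k, l). if k < r then (if l < r then ?K k l else 0) else cnj c * z (j, l))"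
    have "?M = ?A * ?B"
    proof (rule eq_matI)
      fix k l assume kl: "k < dim_row (?A * ?B)" "l < dim_col (?A * ?B)"
      then have kl': "k < Suc r" "l < Suc r" by auto
      have "(?A * ?B) $$ (k, l) = (\<Sum>m<Suc r. ?A $$ (k, m) * ?B $$ (m, l))"
        using kl' by (simp add: scalar_prod_def atLeast0LessThan)
      also have "\<dots> = ?M $$ (k, l)"
      proof (cases "k = r")
        case True
        then show ?thesis using kl' by (auto simp: split K0 c_def sum.remove if_distrib[where f="\<lambda>x. x * _"] cong: if_cong)
      next
        case False
        then have k: "k < r" using kl' by simp
        have "(\<Sum>m<r. ?A $$ (k, m) * ?B $$ (m, l)) = (\<Sum>m<r. if m = k then ?B $$ (k, l) else 0)"
          using kl' k by (intro sum.cong) auto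
        then show ?thesis
          using kl' k \<open>c \<noteq> 0\<close> by (auto simp: split K0 c_def less_Suc_eq)
      qed
      finally show "?M $$ (k, l) = (?A * ?B) $$ (k, l)" ..
    qed auto
    then have "det ?M = det ?A * det ?B"
      by (simp add: det_mult[of _ "Suc r"])
    also have "det ?A = 1"
      by (subst det_upper_triangular[of _ "Suc r"]) (auto simp: prod_list_diag_prod)
    also have "det ?B = (\<Sum>i<Suc r. ?B $$ (i, r) * cofactor ?B i r)"
      by (rule laplace_expansion_column) auto
    also have "\<dots> = cnj c * c * cofactor ?B r r"
      by (simp add: c_def)
    also have "cofactor ?B r r = gramdet (J - {j}) r z"
      unfolding cofactor_def gramdet_def mat_delete_def
      by (simp, intro arg_cong[where f=det] eq_matI) auto
    finally show ?thesis
      unfolding gramdet_def c_def cnj_mult_self by simp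
  qed
qed

section \<open>Householder reflections\<close>

definition householder :: "'i set \<Rightarrow> ('i \<Rightarrow> complex) \<Rightarrow> ('i \<Rightarrow> complex) \<Rightarrow> 'i \<Rightarrow> complex" where
  "householder K v y i = y i - (if i \<in> K then
     2 * v i * (\<Sum>k\<in>K. cnj (v k) * y k) / of_real (\<Sum>k\<in>K. (cmod (v k))\<^sup>2) else 0)"

lemma householder_outside: "i \<notin> K \<Longrightarrow> householder K v y i = y i"
  by (simp add: householder_def)

lemma householder_cong:
  "(\<And>i. i \<in> K \<Longrightarrow> y i = y' i) \<Longrightarrow> y i = y' i \<Longrightarrow> householder K v y i = householder K v y' i"
  unfolding householder_def by (auto intro!: arg_cong2[where f="(*)"] arg_cong2[where f="(/)"] sum.cong)

lemma householder_add:
  "householder K v (\<lambda>i. x i + y i) i = householder K v x i + householder K v y i"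
  by (simp add: householder_def ring_distribs sum.distrib add_divide_distrib)

text \<open>A reflection negates the component along \<open>v\<close>; isometry and involution both
  follow from this.\<close>

lemma householder_coeff:
  assumes "finite K"
  shows "(\<Sum>k\<in>K. cnj (v k) * householder K v y k) = - (\<Sum>k\<in>K. cnj (v k) * y k)"
proof -
  let ?N = "complex_of_real (\<Sum>k\<in>K. (cmod (v k))\<^sup>2)" and ?c = "\<Sum>k\<in>K. cnj (v k) * y k"
  have N: "(\<Sum>k\<in>K. cnj (v k) * v k) = ?N"
    by (simp only: cnj_mult_self of_real_sum)
  have "(\<Sum>k\<in>K. cnj (v k) * householder K v y k) = (\<Sum>k\<in>K. cnj (v k) * y k - (cnj (v k) * v k) * (2 * ?c / ?N))"
    by (intro sum.cong) (auto simp: householder_def algebra_simps)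
  also have "\<dots> = ?c - ?N * (2 * ?c / ?N)"
    by (simp only: sum_subtractf sum_distrib_right[symmetric] N)
  also have "\<dots> = - ?c"
  proof (cases "?N = 0")
    \<comment> \<open>Here \<open>v\<close> vanishes on \<open>K\<close>, and division by zero makes
      the reflection the identity; thus \<open>v\<close> can stay arbitrary in all later
      facts.\<close>
    case True
    then have "(\<Sum>k\<in>K. (cmod (v k))\<^sup>2) = 0" by (simp only: of_real_eq_0_iff)
    then have "\<forall>k\<in>K. v k = 0" using assms by (simp add: sum_nonneg_eq_0_iff)
    then show ?thesis by simp
  next
    case False then show ?thesis by simp
  qed
  finally show ?thesis .
qed

lemma householder_involution:
  assumes "finite K"
  shows "householder K v (householder K v y) i = y i"
  using householder_coeff[OF assms, of v y]
  by (cases "i \<in> K") (simp_all add: householder_def[of K v "householder K v y"], simp_all add: householder_def)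

lemma householder_isometry:
  assumes K: "finite K" and L: "finite L" "K \<subseteq> L"
  shows "(\<Sum>i\<in>L. cnj (householder K v x i) * householder K v y i) = (\<Sum>i\<in>L. cnj (x i) * y i)"
proof -
  let ?h = "householder K v"
  let ?N = "complex_of_real (\<Sum>k\<in>K. (cmod (v k))\<^sup>2)"
  let ?c = "\<lambda>y. \<Sum>k\<in>K. cnj (v k) * y k"
  have hy: "?h y i = y i - v i * (2 * ?c y / ?N)" if "i \<in> K" for i y
    using that by (simp add: householder_def)
  have cc: "(\<Sum>i\<in>K. cnj (x i) * v i) = cnj (?c x)" for x
    by (simp add: mult.commute)
  have "(\<Sum>i\<in>K. cnj (?h x i) * ?h y i) = (\<Sum>i\<in>K. cnj (x i) * ?h y i - cnj (v i) * ?h y i * cnj (2 * ?c x / ?N))"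
    by (intro sum.cong refl) (simp add: hy[where y=x] algebra_simps)
  also have "\<dots> = (\<Sum>i\<in>K. cnj (x i) * ?h y i) - ?c (?h y) * cnj (2 * ?c x / ?N)"
    by (simp only: sum_subtractf sum_distrib_right[symmetric])
  also have "(\<Sum>i\<in>K. cnj (x i) * ?h y i) = (\<Sum>i\<in>K. cnj (x i) * y i - cnj (x i) * v i * (2 * ?c y / ?N))"
    by (intro sum.cong refl) (simp add: hy algebra_simps)
  also have "\<dots> = (\<Sum>i\<in>K. cnj (x i) * y i) - cnj (?c x) * (2 * ?c y / ?N)"
    by (simp only: sum_subtractf sum_distrib_right[symmetric] cc)
  also have "?c (?h y) = - ?c y"
    by (rule householder_coeff[OF K])
  finally have KK: "(\<Sum>i\<in>K. cnj (?h x i) * ?h y i) = (\<Sum>i\<in>K. cnj (x i) * y i)"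
    by simp
  have "(\<Sum>i\<in>L. cnj (?h x i) * ?h y i) = (\<Sum>i\<in>L - K. cnj (?h x i) * ?h y i) + (\<Sum>i\<in>K. cnj (?h x i) * ?h y i)"
    using L by (rule sum.subset_diff[rotated])
  also have "\<dots> = (\<Sum>i\<in>L - K. cnj (x i) * y i) + (\<Sum>i\<in>K. cnj (x i) * y i)"
    unfolding KK by (simp add: householder_outside)
  also have "\<dots> = (\<Sum>i\<in>L. cnj (x i) * y i)"
    using L by (rule sum.subset_diff[symmetric, rotated])
  finally show ?thesis .
qed

lemma householder_norm:
  assumes "finite K" "finite L" "K \<subseteq> L"
  shows "(\<Sum>i\<in>L. (cmod (householder K v y i))\<^sup>2) = (\<Sum>i\<in>L. (cmod (y i))\<^sup>2)"
  by (intro sum_cmod_sq_eqI householder_isometry assms)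

lemma householder_eliminate:
  assumes K: "finite K" "j \<in> K"
  shows "\<exists>v. \<forall>i\<in>K - {j}. householder K v x i = 0"
proof -
  define s where "s = sqrt (\<Sum>k\<in>K. (cmod (x k))\<^sup>2)"
  \<comment> \<open>The vector \<open>v\<close> is \<open>x\<close> plus its norm times axis
    \<open>j\<close>, with the phase of \<open>x j\<close>. Equal phases rule out cancellation, so
    the squared norm of \<open>v\<close> is exactly twice its inner product with \<open>x\<close>,
    and the reflection subtracts \<open>v\<close> itself from \<open>x\<close>.\<close>
  define e where "e = (if x j = 0 then 1 else sgn (x j))"
  define v where "v i = x i + (if i = j then e * of_real s else 0)" for i
  have s: "s\<^sup>2 = (\<Sum>k\<in>K. (cmod (x k))\<^sup>2)" "0 \<le> s"
    by (auto simp: s_def sum_nonneg)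
  have e1: "cnj e * x j = of_real (cmod (x j))"
    using cnj_mult_self[of "x j"] by (auto simp: e_def sgn_eq power2_eq_square)
  have xj: "x j = e * of_real (cmod (x j))" and e2: "cmod e = 1"
    by (auto simp: e_def sgn_eq norm_divide)
  have c: "(\<Sum>k\<in>K. cnj (v k) * x k) = of_real (s\<^sup>2 + s * cmod (x j))"
  proof -
    have "(\<Sum>k\<in>K. cnj (v k) * x k) = (\<Sum>k\<in>K. cnj (x k) * x k + (if k = j then cnj e * x j * of_real s else 0))"
      by (intro sum.cong) (auto simp: v_def algebra_simps)
    also have "\<dots> = of_real (s\<^sup>2) + cnj e * x j * of_real s"
      unfolding s cnj_mult_self using K by (simp add: sum.distrib)
    finally show ?thesis by (simp add: e1 mult.commute)
  qed
  have N: "(\<Sum>k\<in>K. (cmod (v k))\<^sup>2) = 2 * (s\<^sup>2 + s * cmod (x j))"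
  proof -
    have vj: "cmod (v j) = cmod (x j) + s"
    proof -
      have "v j = e * of_real (cmod (x j) + s)"
        unfolding v_def by (subst xj) (simp add: algebra_simps)
      then show ?thesis using e2 s(2) by (simp add: norm_mult del: of_real_add)
    qed
    have "(\<Sum>k\<in>K. (cmod (v k))\<^sup>2) = (\<Sum>k\<in>K. (cmod (x k))\<^sup>2 + (if k = j then (cmod (v j))\<^sup>2 - (cmod (x j))\<^sup>2 else 0))"
      by (intro sum.cong) (auto simp: v_def)
    also have "\<dots> = s\<^sup>2 + ((cmod (v j))\<^sup>2 - (cmod (x j))\<^sup>2)"
      unfolding s using K by (simp add: sum.distrib)
    finally show ?thesis by (simp add: vj power2_eq_square algebra_simps)
  qed
  have "householder K v x i = 0" if i: "i \<in> K - {j}" for i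
  proof (cases "s = 0")
    case True
    then have "x i = 0" using s(1) K i by (simp add: sum_nonneg_eq_0_iff)
    then show ?thesis using i True by (simp add: householder_def c)
  next
    case False
    then have "s\<^sup>2 + s * cmod (x j) \<noteq> 0"
      using s(2) by (smt (verit) mult_nonneg_nonneg norm_ge_zero zero_less_power2)
    moreover define D where "D = s\<^sup>2 + s * cmod (x j)"
    ultimately have "D \<noteq> 0" by simp
    have "householder K v x i = x i - 2 * x i * of_real D / of_real (2 * D)"
      using i unfolding householder_def c N D_def by (simp add: v_def)
    also have "\<dots> = 0"
      using \<open>D \<noteq> 0\<close> by simp
    finally show ?thesis .
  qed
  then show ?thesis by blast
qed

definition columnwise ::
    "'i set \<Rightarrow> nat set \<Rightarrow> (('i \<Rightarrow> complex) \<Rightarrow> 'i \<Rightarrow> complex) \<Rightarrow> ('i \<times> nat \<Rightarrow> complex) \<Rightarrow> 'i \<times> nat \<Rightarrow> complex" where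
  "columnwise I C T z = (\<lambda>(i, k)\<in>I \<times> C. T (\<lambda>i. z (i, k)) i)"

lemma columnwise_apply [simp]:
  "i \<in> I \<Longrightarrow> k \<in> C \<Longrightarrow> columnwise I C T z (i, k) = T (\<lambda>i. z (i, k)) i"
  by (simp add: columnwise_def)

lemma measurable_columnwise_householder:
  assumes "K \<subseteq> I"
  shows "columnwise I C (householder K v) \<in> PiM (I \<times> C) (\<lambda>_. borel) \<rightarrow>\<^sub>M PiM (I \<times> C) (\<lambda>_. borel)"
proof -
  have "(\<lambda>z. \<lambda>p\<in>I \<times> C. householder K v (\<lambda>i. z (i, snd p)) (fst p))
      \<in> PiM (I \<times> C) (\<lambda>_. borel) \<rightarrow>\<^sub>M PiM (I \<times> C) (\<lambda>_. borel)"
    unfolding householder_def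
    using assms by (intro measurable_restrict) (auto intro!: borel_measurable_diff borel_measurable_times
        borel_measurable_divide borel_measurable_sum measurable_component_singleton simp: subset_eq)
  then show ?thesis
    unfolding columnwise_def[abs_def] case_prod_unfold .
qed

lemma distr_gauss_columnwise_householder:
  fixes I :: "'i set"
  assumes I: "finite I" "K \<subseteq> I" and C: "finite C"
  shows "distr (gauss (I \<times> C)) (gauss (I \<times> C)) (columnwise I C (householder K v)) = gauss (I \<times> C)"
proof (rule distr_gauss_isometry)
  have K: "finite K" using I finite_subset by auto
  let ?T = "columnwise I C (householder K v)"
  show "finite (I \<times> C)" using I C by simp
  show "?T \<in> PiM (I \<times> C) (\<lambda>_. borel) \<rightarrow>\<^sub>M PiM (I \<times> C) (\<lambda>_. borel)"
    by (rule measurable_columnwise_householder) fact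
  show "(\<Sum>p\<in>I \<times> C. (cmod (?T z p))\<^sup>2) = (\<Sum>p\<in>I \<times> C. (cmod (z p))\<^sup>2)" for z
  proof -
    have "(\<Sum>k\<in>C. \<Sum>i\<in>I. (cmod (?T z (i, k)))\<^sup>2) = (\<Sum>k\<in>C. \<Sum>i\<in>I. (cmod (z (i, k)))\<^sup>2)"
      by (simp add: householder_norm[OF K I])
    then show ?thesis
      by (simp add: sum.cartesian_product' sum.swap[of _ C])
  qed
  \<comment> \<open>The reflection is additive and its own inverse, so the shift that produces
    \<open>w\<close> is the reflected \<open>w\<close>.\<close>
  show "\<exists>w'. \<forall>z\<in>extensional (I \<times> C). ?T (\<lambda>p\<in>I \<times> C. z p + w' p) = (\<lambda>p\<in>I \<times> C. ?T z p + w p)" for w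
  proof (intro exI ballI ext)
    fix z and p :: "'i \<times> nat"
    obtain i k where p: "p = (i, k)" by (cases p)
    show "?T (\<lambda>p\<in>I \<times> C. z p + ?T w p) p = (\<lambda>p\<in>I \<times> C. ?T z p + w p) p"
    proof (cases "p \<in> I \<times> C")
      case True
      then have ik: "i \<in> I" "k \<in> C" by (auto simp: p)
      have "?T (\<lambda>p\<in>I \<times> C. z p + ?T w p) p =
          householder K v (\<lambda>i. z (i, k) + householder K v (\<lambda>i. w (i, k)) i) i"
        unfolding p columnwise_apply[OF ik] using I(2) ik by (intro householder_cong) auto
      then show ?thesis
        using True ik unfolding householder_add householder_involution[OF K] by (simp add: p)
    qed (auto simp: columnwise_def p)
  qed
qed

text \<open>The first reflection, on \<open>J\<close>, concentrates \<open>g\<close> within \<open>J\<close> on the coordinate \<open>j\<close>; the second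
  one, on the complement of \<open>J\<close> together with \<open>j\<close>, moves the rest of \<open>g\<close> to \<open>j\<close> and leaves the
  remaining coordinates of \<open>J\<close> alone, so that it does not disturb the Gram determinant over \<open>J - {j}\<close>.\<close>

lemma gramdet_Suc_reflect:
  fixes g :: "'i \<Rightarrow> complex"
  assumes I: "finite I" "J \<subseteq> I" "j \<in> J"
  shows "\<exists>v w. \<forall>z. (\<forall>i\<in>I. z (i, r) = g i) \<longrightarrow>
    (let z' = columnwise I {..<r} (householder (insert j (I - J)) w) (columnwise I {..<r} (householder J v) z) in
      gramdet I (Suc r) z = of_real (\<Sum>i\<in>I. (cmod (g i))\<^sup>2) * gramdet (I - {j}) r z' \<and>
      gramdet J (Suc r) z = of_real (\<Sum>i\<in>J. (cmod (g i))\<^sup>2) * gramdet (J - {j}) r z')"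
proof -
  let ?K = "insert j (I - J)"
  have fin: "finite J" "finite ?K" using I finite_subset by auto
  have sub: "?K \<subseteq> I" "j \<in> I" using I by auto
  obtain v where v: "\<And>i. i \<in> J - {j} \<Longrightarrow> householder J v g i = 0"
    using householder_eliminate[OF fin(1) I(3), of g] by blast
  define g1 where "g1 = householder J v g"
  obtain w where w: "\<And>i. i \<in> ?K - {j} \<Longrightarrow> householder ?K w g1 i = 0"
    using householder_eliminate[OF fin(2), of j g1] by blast
  define g2 where "g2 = householder ?K w g1"
  have g1J: "g1 i = 0" if "i \<in> J - {j}" for i
    using v that by (simp add: g1_def)
  have g2I: "g2 i = 0" if "i \<in> I - {j}" for i
  proof (cases "i \<in> J")
    case True
    then have "g2 i = g1 i" using that unfolding g2_def by (intro householder_outside) auto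
    then show ?thesis using g1J True that by simp
  next
    case False then show ?thesis using that w by (simp add: g2_def)
  qed
  have n1: "(cmod (g1 j))\<^sup>2 = (\<Sum>i\<in>J. (cmod (g i))\<^sup>2)"
    using householder_norm[OF fin(1) fin(1) subset_refl, of v g] g1J I fin
    by (simp add: g1_def[symmetric] sum.remove[of J j])
  have n2: "(cmod (g2 j))\<^sup>2 = (\<Sum>i\<in>I. (cmod (g i))\<^sup>2)"
    using householder_norm[OF fin(2) I(1) sub(1), of w g1] householder_norm[OF fin(1) I(1,2), of v g] g2I I sub
    by (simp add: g1_def[symmetric] g2_def[symmetric] sum.remove[of I j])
  have gram_hh: "gramdet L m (\<lambda>(i, k). householder K u (\<lambda>i. y (i, k)) i) = gramdet L m y"
    if "finite K" "finite L" "K \<subseteq> L" for K L u m and y :: "'i \<times> nat \<Rightarrow> complex"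
    unfolding gramdet_def using that by (simp add: householder_isometry)
  show ?thesis
  proof (intro exI allI impI)
    fix z :: "'i \<times> nat \<Rightarrow> complex" assume z: "\<forall>i\<in>I. z (i, r) = g i"
    define z1 where "z1 = (\<lambda>(i, k). householder J v (\<lambda>i. z (i, k)) i)"
    define z2 where "z2 = (\<lambda>(i, k). householder ?K w (\<lambda>i. z1 (i, k)) i)"
    let ?z = "columnwise I {..<r} (householder ?K w) (columnwise I {..<r} (householder J v) z)"
    have z1r: "z1 (i, r) = g1 i" if "i \<in> I" for i
      unfolding z1_def g1_def using z I(2) that by (auto intro!: householder_cong)
    have z2r: "z2 (i, r) = g2 i" if "i \<in> I" for i
      unfolding z2_def g2_def using z1r sub that by (auto intro!: householder_cong)
    have zz: "?z (i, k) = z2 (i, k)" if "i \<in> I" "k < r" for i k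
      unfolding z2_def using that sub by (auto simp: z1_def intro!: householder_cong)
    have z21: "z2 (i, k) = z1 (i, k)" if "i \<in> J - {j}" for i k
      unfolding z2_def using that by (simp add: householder_outside)
    have "gramdet I (Suc r) z = gramdet I (Suc r) z1"
      unfolding z1_def using gram_hh fin I by simp
    also have "\<dots> = gramdet I (Suc r) z2"
      unfolding z2_def using gram_hh fin I sub by simp
    also have "\<dots> = of_real ((cmod (z2 (j, r)))\<^sup>2) * gramdet (I - {j}) r z2"
      using I sub g2I z2r by (intro gramdet_Suc_axis) auto
    also have "gramdet (I - {j}) r z2 = gramdet (I - {j}) r ?z"
      using zz by (intro gramdet_cong) auto
    finally have 1: "gramdet I (Suc r) z = of_real (\<Sum>i\<in>I. (cmod (g i))\<^sup>2) * gramdet (I - {j}) r ?z"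
      by (simp only: z2r[OF sub(2)] n2)
    have "gramdet J (Suc r) z = gramdet J (Suc r) z1"
      unfolding z1_def using gram_hh fin I by simp
    also have "\<dots> = of_real ((cmod (z1 (j, r)))\<^sup>2) * gramdet (J - {j}) r z1"
      using I g1J z1r fin by (intro gramdet_Suc_axis) auto
    also have "gramdet (J - {j}) r z1 = gramdet (J - {j}) r ?z"
      using z21 zz I(2) by (intro gramdet_cong) auto
    finally have 2: "gramdet J (Suc r) z = of_real (\<Sum>i\<in>J. (cmod (g i))\<^sup>2) * gramdet (J - {j}) r ?z"
      by (simp only: z1r[OF sub(2)] n1)
    show "let z' = ?z in
      gramdet I (Suc r) z = of_real (\<Sum>i\<in>I. (cmod (g i))\<^sup>2) * gramdet (I - {j}) r z' \<and>
      gramdet J (Suc r) z = of_real (\<Sum>i\<in>J. (cmod (g i))\<^sup>2) * gramdet (J - {j}) r z'"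
      using 1 2 by (simp add: Let_def)
  qed
qed

text \<open>With \<open>I = J\<close> the reflections write a Gram determinant as a squared column
  norm times a smaller Gram determinant.\<close>

lemma gramdet_nonneg:
  assumes "finite J"
  shows "\<exists>x\<ge>0. gramdet J r z = complex_of_real x"
  using assms
proof (induction r arbitrary: J z)
  case 0
  show ?case by (intro exI[of _ 1]) simp
next
  case (Suc r)
  show ?case
  proof (cases "J = {}")
    case True
    then show ?thesis by (intro exI[of _ 0]) simp
  next
    case False
    then obtain j where j: "j \<in> J" by auto
    obtain v w where vw: "\<And>y. (\<forall>i\<in>J. y (i, r) = z (i, r)) \<longrightarrow>
      (let z' = columnwise J {..<r} (householder (insert j (J - J)) w) (columnwise J {..<r} (householder J v) y) in
      gramdet J (Suc r) y = of_real (\<Sum>i\<in>J. (cmod (z (i, r)))\<^sup>2) * gramdet (J - {j}) r z' \<and>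
      gramdet J (Suc r) y = of_real (\<Sum>i\<in>J. (cmod (z (i, r)))\<^sup>2) * gramdet (J - {j}) r z')"
      using gramdet_Suc_reflect[OF Suc.prems subset_refl j, of r "\<lambda>i. z (i, r)"] by blast
    obtain z' where "gramdet J (Suc r) z = of_real (\<Sum>i\<in>J. (cmod (z (i, r)))\<^sup>2) * gramdet (J - {j}) r z'"
      using vw[of z] by (auto simp: Let_def)
    moreover obtain x where "x \<ge> 0" "gramdet (J - {j}) r z' = complex_of_real x"
      using Suc.IH[of "J - {j}" z'] Suc.prems by auto
    ultimately show ?thesis
      by (intro exI[of _ "(\<Sum>i\<in>J. (cmod (z (i, r)))\<^sup>2) * x"]) (auto intro!: mult_nonneg_nonneg sum_nonneg)
  qed
qed

section \<open>Recursion on the columns of a Gaussian matrix\<close>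

lemma nn_integral_gauss_restrict:
  assumes I: "finite I" "J \<subseteq> I" and F[measurable]: "F \<in> borel_measurable (gauss J)"
  shows "(\<integral>\<^sup>+z. F (restrict z J) \<partial>gauss I) = (\<integral>\<^sup>+z. F z \<partial>gauss J)"
proof -
  interpret P: product_prob_space "\<lambda>_. cnormal" I by unfold_locales
  have m: "(\<lambda>z. restrict z J) \<in> gauss I \<rightarrow>\<^sub>M gauss J"
    unfolding gauss_def using I(2) by (rule measurable_restrict_subset)
  have "(\<integral>\<^sup>+z. F z \<partial>gauss J) = (\<integral>\<^sup>+z. F z \<partial>distr (gauss I) (gauss J) (\<lambda>z. restrict z J))"
    using P.distr_restrict[OF I(2,1)] by (simp add: gauss_def)
  also have "\<dots> = (\<integral>\<^sup>+z. F (restrict z J) \<partial>gauss I)"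
    by (rule nn_integral_distr[OF m]) simp
  finally show ?thesis ..
qed

text \<open>Condition on the last column \<open>g\<close>. The reflections depend on
  \<open>g\<close> only and act on the independent remaining columns, whose Gaussian law they
  preserve. A function \<open>F\<close> of both determinants is used because both are expressed by
  the same reflected matrix.\<close>

lemma nn_integral_gramdet_Suc:
  fixes I :: "'i set"
  assumes I: "finite I" "J \<subseteq> I" "j \<in> J" and F[measurable]: "F \<in> borel_measurable (borel \<Otimes>\<^sub>M borel)"
  shows "(\<integral>\<^sup>+z. F (gramdet J (Suc r) z, gramdet I (Suc r) z) \<partial>gauss (I \<times> {..<Suc r})) =
    (\<integral>\<^sup>+g. (\<integral>\<^sup>+z. F (of_real (\<Sum>i\<in>J. (cmod (g (i, r)))\<^sup>2) * gramdet (J - {j}) r z,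
                    of_real (\<Sum>i\<in>I. (cmod (g (i, r)))\<^sup>2) * gramdet (I - {j}) r z)
        \<partial>gauss ((I - {j}) \<times> {..<r})) \<partial>gauss (I \<times> {r}))"
proof -
  let ?K = "insert j (I - J)"
  have sub: "?K \<subseteq> I" using I by auto
  have un: "I \<times> {r} \<union> I \<times> {..<r} = I \<times> {..<Suc r}" by (auto simp: less_Suc_eq)
  have F': "(\<lambda>z. F (gramdet J (Suc r) z, gramdet I (Suc r) z)) \<in> borel_measurable (PiM (I \<times> {..<Suc r}) (\<lambda>_. cnormal))"
    using measurable_gramdet_gauss[of J I "Suc r" "{..<Suc r}"] measurable_gramdet_gauss[of I I "Suc r" "{..<Suc r}"] I
    unfolding gauss_def by auto
  have "(\<integral>\<^sup>+z. F (gramdet J (Suc r) z, gramdet I (Suc r) z) \<partial>gauss (I \<times> {..<Suc r})) =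
     (\<integral>\<^sup>+g. (\<integral>\<^sup>+z. F (gramdet J (Suc r) (merge (I \<times> {r}) (I \<times> {..<r}) (g, z)),
                     gramdet I (Suc r) (merge (I \<times> {r}) (I \<times> {..<r}) (g, z)))
        \<partial>gauss (I \<times> {..<r})) \<partial>gauss (I \<times> {r}))"
    unfolding gauss_def
    by (rule cnormals.product_nn_integral_fold[OF _ _ _, of "I \<times> {r}" "I \<times> {..<r}", unfolded un, OF _ _ _ F'])
       (use I in auto)
  also have "\<dots> = (\<integral>\<^sup>+g. (\<integral>\<^sup>+z. F (of_real (\<Sum>i\<in>J. (cmod (g (i, r)))\<^sup>2) * gramdet (J - {j}) r z,
                    of_real (\<Sum>i\<in>I. (cmod (g (i, r)))\<^sup>2) * gramdet (I - {j}) r z)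
        \<partial>gauss ((I - {j}) \<times> {..<r})) \<partial>gauss (I \<times> {r}))"
  proof (rule nn_integral_cong)
    fix g :: "'i \<times> nat \<Rightarrow> complex"
    define a b where "a = complex_of_real (\<Sum>i\<in>J. (cmod (g (i, r)))\<^sup>2)" "b = complex_of_real (\<Sum>i\<in>I. (cmod (g (i, r)))\<^sup>2)"
    define H where "H z = F (a * gramdet (J - {j}) r z, b * gramdet (I - {j}) r z)" for z
    obtain v w where vw: "\<And>y. (\<forall>i\<in>I. y (i, r) = g (i, r)) \<longrightarrow>
      (let z' = columnwise I {..<r} (householder ?K w) (columnwise I {..<r} (householder J v) y) in
        gramdet I (Suc r) y = b * gramdet (I - {j}) r z' \<and>
        gramdet J (Suc r) y = a * gramdet (J - {j}) r z')"
      using gramdet_Suc_reflect[OF I, of r "\<lambda>i. g (i, r)"] unfolding a_b_def by blast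
    define T1 where "T1 = columnwise I {..<r} (householder J v)"
    define T2 where "T2 = columnwise I {..<r} (householder ?K w)"
    have T1m[measurable]: "T1 \<in> gauss (I \<times> {..<r}) \<rightarrow>\<^sub>M gauss (I \<times> {..<r})"
      and T2m[measurable]: "T2 \<in> gauss (I \<times> {..<r}) \<rightarrow>\<^sub>M gauss (I \<times> {..<r})"
      unfolding T1_def T2_def measurable_cong_sets[OF sets_gauss sets_gauss]
      using sub I(2) by (auto intro!: measurable_columnwise_householder)
    have Hm[measurable]: "H \<in> borel_measurable (gauss (L \<times> {..<r}))" if "I - {j} \<subseteq> L" for L
    proof -
      have "J - {j} \<subseteq> L" using that I(2) by auto
      then have [measurable]: "gramdet (J - {j}) r \<in> borel_measurable (gauss (L \<times> {..<r}))"
        "gramdet (I - {j}) r \<in> borel_measurable (gauss (L \<times> {..<r}))"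
        using that by (auto intro!: measurable_gramdet_gauss)
      show ?thesis unfolding H_def by measurable
    qed
    have "(\<integral>\<^sup>+z. F (gramdet J (Suc r) (merge (I \<times> {r}) (I \<times> {..<r}) (g, z)),
                     gramdet I (Suc r) (merge (I \<times> {r}) (I \<times> {..<r}) (g, z)))
        \<partial>gauss (I \<times> {..<r})) = (\<integral>\<^sup>+z. H (T2 (T1 z)) \<partial>gauss (I \<times> {..<r}))"
    proof (rule nn_integral_cong)
      fix z :: "'i \<times> nat \<Rightarrow> complex"
      let ?y = "merge (I \<times> {r}) (I \<times> {..<r}) (g, z)"
      \<comment> \<open>Only the columns below \<open>r\<close> are read, so joining the column
        \<open>g\<close> has no effect.\<close>
      have "T1 ?y = T1 z"
      proof
        fix p :: "'i \<times> nat"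
        show "T1 ?y p = T1 z p"
          unfolding T1_def columnwise_def using I(2)
          by (cases p) (auto intro!: householder_cong simp: merge_def)
      qed
      then show "F (gramdet J (Suc r) ?y, gramdet I (Suc r) ?y) = H (T2 (T1 z))"
        using vw[of ?y] by (simp add: H_def Let_def T1_def[symmetric] T2_def[symmetric] merge_def)
    qed
    also have "\<dots> = (\<integral>\<^sup>+z. H (T2 z) \<partial>gauss (I \<times> {..<r}))"
      using nn_integral_distr[OF T1m, of "\<lambda>z. H (T2 z)"] distr_gauss_columnwise_householder[OF I(1,2), of "{..<r}" v]
        measurable_compose[OF T2m Hm[of I]]
      by (simp add: T1_def)
    also have "\<dots> = (\<integral>\<^sup>+z. H z \<partial>gauss (I \<times> {..<r}))"
      using nn_integral_distr[OF T2m, of H] distr_gauss_columnwise_householder[OF I(1) sub, of "{..<r}" w] Hm[of I]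
      by (simp add: T2_def)
    \<comment> \<open>Neither determinant in \<open>H\<close> reads row \<open>j\<close>, which can
      therefore be integrated out.\<close>
    also have "\<dots> = (\<integral>\<^sup>+z. H (restrict z ((I - {j}) \<times> {..<r})) \<partial>gauss (I \<times> {..<r}))"
      unfolding H_def using I(2)
      by (intro nn_integral_cong arg_cong[where f=F] arg_cong2[where f=Pair] arg_cong2[where f="(*)"] gramdet_cong refl) auto
    also have "\<dots> = (\<integral>\<^sup>+z. H z \<partial>gauss ((I - {j}) \<times> {..<r}))"
      using I by (intro nn_integral_gauss_restrict Hm) auto
    finally show "(\<integral>\<^sup>+z. F (gramdet J (Suc r) (merge (I \<times> {r}) (I \<times> {..<r}) (g, z)),
                     gramdet I (Suc r) (merge (I \<times> {r}) (I \<times> {..<r}) (g, z)))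
        \<partial>gauss (I \<times> {..<r})) = (\<integral>\<^sup>+z. F (of_real (\<Sum>i\<in>J. (cmod (g (i, r)))\<^sup>2) * gramdet (J - {j}) r z,
                    of_real (\<Sum>i\<in>I. (cmod (g (i, r)))\<^sup>2) * gramdet (I - {j}) r z)
        \<partial>gauss ((I - {j}) \<times> {..<r}))"
      unfolding H_def a_b_def .
  qed
  finally show ?thesis .
qed

lemma sum_times_singleton: "(\<Sum>p\<in>I \<times> {r}. f p) = (\<Sum>i\<in>I. f (i, r))"
  by (simp add: sum.cartesian_product')

text \<open>The recursion, applied to the indicator of 0, leaves an almost surely positive squared
  norm and a determinant with one row and one column less; \<open>r \<le> card I\<close> makes the
  rows last as long as the columns.\<close>

lemma AE_gramdet_nonzero:
  assumes "finite I" "r \<le> card I"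
  shows "AE z in gauss (I \<times> {..<r}). gramdet I r z \<noteq> 0"
  using assms
proof (induction r arbitrary: I)
  case 0
  then show ?case by simp
next
  case (Suc r)
  then obtain j where j: "j \<in> I" by (metis card.empty ex_in_conv not_less_eq_eq zero_le)
  let ?S = "\<lambda>g. \<Sum>i\<in>I. (cmod (g (i, r)))\<^sup>2"
  have IH: "AE z in gauss ((I - {j}) \<times> {..<r}). gramdet (I - {j}) r z \<noteq> 0"
    using Suc.prems j by (intro Suc.IH) auto
  have "AE g in gauss (I \<times> {r}). 0 < (\<Sum>p\<in>I \<times> {r}. (cmod (g p))\<^sup>2)"
    using Suc.prems j by (intro AE_gauss_sum_cmod_sq_pos) auto
  then have pos: "AE g in gauss (I \<times> {r}). ?S g \<noteq> 0"
    by eventually_elim (simp add: sum_times_singleton)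
  have m[measurable]: "gramdet I (Suc r) \<in> borel_measurable (gauss (I \<times> {..<Suc r}))"
    by (rule measurable_gramdet_gauss) auto
  have "(\<integral>\<^sup>+z. indicator {0} (gramdet I (Suc r) z) \<partial>gauss (I \<times> {..<Suc r})) =
    (\<integral>\<^sup>+g. (\<integral>\<^sup>+z. indicator {0} (of_real (?S g) * gramdet (I - {j}) r z)
        \<partial>gauss ((I - {j}) \<times> {..<r})) \<partial>gauss (I \<times> {r}))"
    using nn_integral_gramdet_Suc[OF Suc.prems(1) subset_refl j, of "\<lambda>(x, y). indicator {0} y" r] by simp
  also have "\<dots> = (\<integral>\<^sup>+g. 0 \<partial>gauss (I \<times> {r}))"
  proof (rule nn_integral_cong_AE, use pos in eventually_elim)
    fix g :: "_ \<Rightarrow> complex" assume g: "?S g \<noteq> 0"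
    have "(\<integral>\<^sup>+z. indicator {0} (of_real (?S g) * gramdet (I - {j}) r z) \<partial>gauss ((I - {j}) \<times> {..<r})) =
        (\<integral>\<^sup>+z. 0 \<partial>gauss ((I - {j}) \<times> {..<r}))"
      by (rule nn_integral_cong_AE, use IH in eventually_elim) (use g in \<open>simp add: indicator_def del: of_real_sum\<close>)
    then show "(\<integral>\<^sup>+z. indicator {0} (of_real (?S g) * gramdet (I - {j}) r z) \<partial>gauss ((I - {j}) \<times> {..<r})) = 0"
      by simp
  qed
  finally have "(\<integral>\<^sup>+z. indicator {0} (gramdet I (Suc r) z) \<partial>gauss (I \<times> {..<Suc r})) = 0" by simp
  then have "AE z in gauss (I \<times> {..<Suc r}). (indicator {0} (gramdet I (Suc r) z) :: ennreal) = 0"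
    by (subst (asm) nn_integral_0_iff_AE) measurable
  then show ?case by eventually_elim (auto simp: indicator_def)
qed

text \<open>The total mass is read off from the Gaussian ratio with the constant function 1; this
  includes \<open>b = 0\<close>.\<close>

lemma prob_space_beta_measure:
  assumes "0 < a"
  shows "prob_space (beta_measure (real a) (real b))"
proof
  interpret G: prob_space "gauss {..<a + b}" by (rule prob_space_gauss)
  have "(\<integral>\<^sup>+s. 1 \<partial>beta_measure (real a) (real b)) = 1"
    using nn_integral_gauss_beta[of "{..<a + b}" "{..<a}" "\<lambda>_. 1"] assms
    by (auto simp: G.emeasure_space_1)
  then show "emeasure (beta_measure (real a) (real b)) (space (beta_measure (real a) (real b))) = 1"
    by simp
qed

lemma sets_beta_measure [measurable_cong, simp]: "sets (beta_measure a b) = sets borel"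
  by (simp add: beta_measure_def)

text \<open>Each step removes one row and one column and splits off one Beta factor. The offset
  \<open>s\<close> absorbs the renumbering: when \<open>card J\<close> drops by one and
  \<open>s\<close> grows by one, the parameters belonging to every remaining \<open>j\<close> stay
  fixed, and for \<open>j = s + 1\<close> the first parameter is \<open>card J\<close>.\<close>

lemma nn_integral_gramdet_ratio:
  assumes "finite I" "J \<subseteq> I" "r \<le> card J" and h: "h \<in> borel_measurable borel"
  shows "(\<integral>\<^sup>+z. h (Re (gramdet J r z) / Re (gramdet I r z)) \<partial>gauss (I \<times> {..<r})) =
    (\<integral>\<^sup>+b. h (\<Prod>j\<in>{s+1..s+r}. b j)
       \<partial>PiM {s+1..s+r} (\<lambda>j. beta_measure (real (card J + s - j + 1)) (real (card I - card J))))"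
  using assms
proof (induction r arbitrary: I J s h)
  case 0
  interpret G: prob_space "gauss {} :: ('a \<times> nat \<Rightarrow> complex) measure" by (rule prob_space_gauss)
  show ?case by (simp add: PiM_empty nn_integral_count_space_finite G.emeasure_space_1)
next
  case (Suc r)
  note h[measurable] = Suc.prems(4)
  have finJ: "finite J" using Suc.prems finite_subset by auto
  obtain j where j: "j \<in> J" using Suc.prems by (metis card.empty ex_in_conv not_less_eq_eq zero_le)
  have jI: "j \<in> I" using j Suc.prems by auto
  have cIJ: "card (I - {j}) - card (J - {j}) = card I - card J" "card (J - {j}) + Suc s = card J + s"
    using j jI finJ Suc.prems card_gt_0_iff[of J] by (auto simp: card_Diff_singleton)
  let ?b = "\<lambda>j. beta_measure (real (card J + s - j + 1)) (real (card I - card J))"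
  let ?A = "{Suc s + 1..Suc s + r}"
  let ?S = "\<lambda>J g. \<Sum>i\<in>J. (cmod (g (i, r)))\<^sup>2"
  interpret B: product_sigma_finite ?b
    by (intro product_sigma_finite.intro prob_space_imp_sigma_finite prob_space_beta_measure) simp
  interpret P: prob_space "PiM ?A ?b"
    by (intro prob_space_PiM prob_space_beta_measure) simp
  have ins: "{s+1..s+Suc r} = insert (s+1) ?A" by auto
  define k where "k x = (\<integral>\<^sup>+b. h (x * (\<Prod>j\<in>?A. b j)) \<partial>PiM ?A ?b)" for x
  have km[measurable]: "k \<in> borel_measurable borel"
    unfolding k_def by measurable
  have "(\<integral>\<^sup>+z. h (Re (gramdet J (Suc r) z) / Re (gramdet I (Suc r) z)) \<partial>gauss (I \<times> {..<Suc r})) =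
    (\<integral>\<^sup>+g. (\<integral>\<^sup>+z. h (Re (of_real (?S J g) * gramdet (J - {j}) r z) / Re (of_real (?S I g) * gramdet (I - {j}) r z))
        \<partial>gauss ((I - {j}) \<times> {..<r})) \<partial>gauss (I \<times> {r}))"
    using nn_integral_gramdet_Suc[OF Suc.prems(1,2) j, of "\<lambda>(x, y). h (Re x / Re y)" r] by simp
  also have "\<dots> = (\<integral>\<^sup>+g. k (?S J g / ?S I g) \<partial>gauss (I \<times> {r}))"
  proof (rule nn_integral_cong)
    fix g :: "_ \<Rightarrow> complex"
    let ?x = "?S J g / ?S I g"
    have "(\<integral>\<^sup>+z. h (Re (of_real (?S J g) * gramdet (J - {j}) r z) / Re (of_real (?S I g) * gramdet (I - {j}) r z))
        \<partial>gauss ((I - {j}) \<times> {..<r})) =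
      (\<integral>\<^sup>+z. h (?x * (Re (gramdet (J - {j}) r z) / Re (gramdet (I - {j}) r z))) \<partial>gauss ((I - {j}) \<times> {..<r}))"
      by (simp del: of_real_sum)
    also have "\<dots> = (\<integral>\<^sup>+b. h (?x * (\<Prod>j\<in>?A. b j)) \<partial>PiM ?A
          (\<lambda>j'. beta_measure (real (card (J - {j}) + Suc s - j' + 1)) (real (card (I - {j}) - card (J - {j})))))"
      using Suc.prems j finJ by (intro Suc.IH[of "I - {j}" "J - {j}" "\<lambda>y. h (?x * y)" "Suc s"]) auto
    also have "\<dots> = k ?x"
      unfolding k_def cIJ ..
    finally show "(\<integral>\<^sup>+z. h (Re (of_real (?S J g) * gramdet (J - {j}) r z) / Re (of_real (?S I g) * gramdet (I - {j}) r z))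
        \<partial>gauss ((I - {j}) \<times> {..<r})) = k ?x" .
  qed
  also have "\<dots> = (\<integral>\<^sup>+g. k ((\<Sum>p\<in>J \<times> {r}. (cmod (g p))\<^sup>2) / (\<Sum>p\<in>I \<times> {r}. (cmod (g p))\<^sup>2)) \<partial>gauss (I \<times> {r}))"
    by (simp add: sum_times_singleton)
  also have "\<dots> = (\<integral>\<^sup>+x. k x \<partial>beta_measure (real (card (J \<times> {r}))) (real (card (I \<times> {r}) - card (J \<times> {r}))))"
    using Suc.prems j by (intro nn_integral_gauss_beta) auto
  also have "\<dots> = (\<integral>\<^sup>+x. k x \<partial>?b (s + 1))"
    using Suc.prems by (simp add: card_cartesian_product Suc_le_eq)
  also have "\<dots> = (\<integral>\<^sup>+x. (\<integral>\<^sup>+b. h (\<Prod>j\<in>insert (s+1) ?A. (b(s+1 := x)) j) \<partial>PiM ?A ?b) \<partial>?b (s + 1))"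
    unfolding k_def by (intro nn_integral_cong) (auto intro!: arg_cong[where f=h] prod.cong)
  also have "\<dots> = (\<integral>\<^sup>+b. h (\<Prod>j\<in>insert (s+1) ?A. b j) \<partial>PiM (insert (s+1) ?A) ?b)"
  proof (rule B.product_nn_integral_insert_rev[symmetric])
    show "(\<lambda>b. h (\<Prod>j\<in>insert (s+1) ?A. b j)) \<in> borel_measurable (PiM (insert (s+1) ?A) ?b)"
      by measurable
  qed auto
  finally show ?case unfolding ins .
qed

subsection \<open>Principal angles\<close>

lemma sum_lessThan_add:
  fixes f :: "nat \<Rightarrow> 'a::comm_monoid_add"
  shows "(\<Sum>m<a + b. f m) = (\<Sum>m<a. f m) + (\<Sum>m<b. f (a + m))"
  by (induction b) (auto simp: add.assoc)

definition lincomb_cols :: "(nat \<times> nat \<Rightarrow> complex) \<Rightarrow> nat \<Rightarrow> (nat \<Rightarrow> complex) \<Rightarrow> nat \<Rightarrow> complex" where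
  "lincomb_cols z a w i = (\<Sum>m<a. z (i, m) * w m)"

definition inner_upto :: "nat \<Rightarrow> (nat \<Rightarrow> complex) \<Rightarrow> (nat \<Rightarrow> complex) \<Rightarrow> complex" where
  "inner_upto n x y = (\<Sum>i<n. x i * cnj (y i))"

lemma inner_upto_commute: "inner_upto n x y = cnj (inner_upto n y x)"
  by (simp add: inner_upto_def mult.commute)

lemma inner_upto_self: "inner_upto n x x = of_real (\<Sum>i<n. (cmod (x i))\<^sup>2)"
  unfolding inner_upto_def by (simp only: complex_norm_square of_real_sum)

text \<open>The new Gram matrix is X^H G X, where the columns of X are the coefficient
  vectors.\<close>

lemma gramdet_lincomb_cols:
  "gramdet J r (\<lambda>(i, l). lincomb_cols z r (X l) i) =
     of_real ((cmod (det (mat r r (\<lambda>(m, l). X l m))))\<^sup>2) * gramdet J r z"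
proof -
  let ?X = "mat r r (\<lambda>(m, l). X l m)" and ?Xh = "mat r r (\<lambda>(l, m). cnj (X l m))"
  let ?G = "mat r r (\<lambda>(k, l). \<Sum>i\<in>J. cnj (z (i, k)) * z (i, l))"
  have "mat r r (\<lambda>(k, l). \<Sum>i\<in>J. cnj (lincomb_cols z r (X k) i) * lincomb_cols z r (X l) i) = ?Xh * (?G * ?X)"
  proof (rule eq_matI)
    fix k l assume "k < dim_row (?Xh * (?G * ?X))" "l < dim_col (?Xh * (?G * ?X))"
    then have kl: "k < r" "l < r" by auto
    have "(\<Sum>i\<in>J. cnj (lincomb_cols z r (X k) i) * lincomb_cols z r (X l) i) =
      (\<Sum>i\<in>J. \<Sum>m<r. \<Sum>p<r. cnj (X k m) * (cnj (z (i, m)) * z (i, p) * X l p))"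
      unfolding lincomb_cols_def cnj_sum sum_product by (intro sum.cong refl) (simp add: mult_ac)
    also have "\<dots> = (\<Sum>m<r. \<Sum>i\<in>J. \<Sum>p<r. cnj (X k m) * (cnj (z (i, m)) * z (i, p) * X l p))"
      by (rule sum.swap)
    also have "\<dots> = (\<Sum>m<r. \<Sum>p<r. \<Sum>i\<in>J. cnj (X k m) * (cnj (z (i, m)) * z (i, p) * X l p))"
      by (intro sum.cong refl sum.swap)
    also have "\<dots> = (?Xh * (?G * ?X)) $$ (k, l)"
      using kl by (simp add: scalar_prod_def atLeast0LessThan sum_distrib_left sum_distrib_right)
    finally show "mat r r (\<lambda>(k, l). \<Sum>i\<in>J. cnj (lincomb_cols z r (X k) i) * lincomb_cols z r (X l) i) $$ (k, l)
       = (?Xh * (?G * ?X)) $$ (k, l)"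
      using kl by simp
  qed auto
  then have "gramdet J r (\<lambda>(i, l). lincomb_cols z r (X l) i) = det ?Xh * (det ?G * det ?X)"
    unfolding gramdet_def by (simp add: det_mult[of _ r] mult_carrier_mat[of _ r r _ r])
  also have "det ?Xh = cnj (det ?X)"
  proof -
    have "?Xh = transpose_mat (map_mat cnj ?X)"
      by (rule eq_matI) auto
    moreover have "det (transpose_mat (map_mat cnj ?X)) = det (map_mat cnj ?X)"
      by (rule det_transpose[of _ r]) simp
    moreover have "det (map_mat cnj ?X) = cnj (det ?X)"
      by (simp add: det_def sign_def if_distrib[of cnj] cong: if_cong)
    ultimately show ?thesis by simp
  qed
  finally show ?thesis
    unfolding gramdet_def cnj_mult_self[symmetric] by simp
qed

lemma gramdet_orthonormal:
  assumes "\<And>k l. k < r \<Longrightarrow> l < r \<Longrightarrow> (\<Sum>i\<in>J. cnj (z (i, k)) * z (i, l)) = (if k = l then 1 else 0)"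
  shows "gramdet J r z = 1"
proof -
  have "mat r r (\<lambda>(k, l). \<Sum>i\<in>J. cnj (z (i, k)) * z (i, l)) = 1\<^sub>m r"
    by (rule eq_matI) (auto simp: assms)
  then show ?thesis by (simp add: gramdet_def)
qed

text \<open>Apply the adjugate of the Gram matrix to Z^H (Z w). The coefficients thus depend
  linearly on the combined vector, which gives injectivity and a bound on the coefficients of unit
  vectors.\<close>

lemma gramdet_cramer:
  "\<exists>d. \<forall>w. \<forall>m<a. gramdet {..<n} a z * w m = (\<Sum>i<n. d m i * lincomb_cols z a w i)"
proof -
  let ?G = "mat a a (\<lambda>(k, l). \<Sum>i<n. cnj (z (i, k)) * z (i, l))"
  obtain A where A: "A \<in> carrier_mat a a" "A * ?G = det ?G \<cdot>\<^sub>m 1\<^sub>m a"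
    using adj_mat[of ?G a] by auto
  define d where "d m i = (\<Sum>k<a. A $$ (m, k) * cnj (z (i, k)))" for m i
  have "gramdet {..<n} a z * w m = (\<Sum>i<n. d m i * lincomb_cols z a w i)" if m: "m < a" for w m
  proof -
    have "(\<Sum>i<n. d m i * lincomb_cols z a w i) =
        (\<Sum>i<n. \<Sum>k<a. \<Sum>l<a. A $$ (m, k) * (cnj (z (i, k)) * z (i, l)) * w l)"
      unfolding d_def lincomb_cols_def sum_product by (intro sum.cong refl) (simp add: mult_ac)
    also have "\<dots> = (\<Sum>k<a. \<Sum>i<n. \<Sum>l<a. A $$ (m, k) * (cnj (z (i, k)) * z (i, l)) * w l)"
      by (rule sum.swap)
    also have "\<dots> = (\<Sum>k<a. \<Sum>l<a. \<Sum>i<n. A $$ (m, k) * (cnj (z (i, k)) * z (i, l)) * w l)"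
      by (intro sum.cong refl sum.swap)
    also have "\<dots> = (\<Sum>l<a. \<Sum>k<a. \<Sum>i<n. A $$ (m, k) * (cnj (z (i, k)) * z (i, l)) * w l)"
      by (rule sum.swap)
    also have "\<dots> = (\<Sum>l<a. (A * ?G) $$ (m, l) * w l)"
      using A(1) m by (simp add: scalar_prod_def atLeast0LessThan sum_distrib_left sum_distrib_right)
    also have "\<dots> = (\<Sum>l<a. if l = m then det ?G * w m else 0)"
      unfolding A(2) using m by (intro sum.cong) auto
    also have "\<dots> = gramdet {..<n} a z * w m"
      using m by (simp add: gramdet_def)
    finally show ?thesis ..
  qed
  then show ?thesis by blast
qed

lemma lincomb_cols_inj:
  assumes "gramdet {..<n} a z \<noteq> 0" "\<And>i. i < n \<Longrightarrow> lincomb_cols z a w i = 0" "m < a"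
  shows "w m = 0"
proof -
  obtain d where "\<And>w m. m < a \<Longrightarrow> gramdet {..<n} a z * w m = (\<Sum>i<n. d m i * lincomb_cols z a w i)"
    using gramdet_cramer[where n=n and a=a and z=z] by blast
  from this[OF assms(3), of w] assms(1,2) show ?thesis by simp
qed

lemma lincomb_cols_bounded:
  assumes "gramdet {..<n} a z \<noteq> 0"
  shows "\<exists>c. \<forall>w. inner_upto n (lincomb_cols z a w) (lincomb_cols z a w) = 1 \<longrightarrow> (\<forall>m<a. cmod (w m) \<le> c)"
proof -
  let ?g = "gramdet {..<n} a z"
  obtain d where d: "\<And>w m. m < a \<Longrightarrow> ?g * w m = (\<Sum>i<n. d m i * lincomb_cols z a w i)"
    using gramdet_cramer[where n=n and a=a and z=z] by blast
  define c where "c = (\<Sum>m<a. \<Sum>i<n. cmod (d m i)) / cmod ?g"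
  have "cmod (w m) \<le> c" if w: "inner_upto n (lincomb_cols z a w) (lincomb_cols z a w) = 1" and m: "m < a" for w m
  proof -
    let ?x = "lincomb_cols z a w"
    have 1: "(\<Sum>i<n. (cmod (?x i))\<^sup>2) = 1"
      using w unfolding inner_upto_self by (simp only: of_real_eq_1_iff)
    have x1: "cmod (?x i) \<le> 1" if "i < n" for i
    proof -
      have "(cmod (?x i))\<^sup>2 \<le> (\<Sum>i<n. (cmod (?x i))\<^sup>2)"
        using that by (intro member_le_sum) auto
      then show ?thesis by (simp add: 1 abs_square_le_1)
    qed
    have "cmod ?g * cmod (w m) = cmod (\<Sum>i<n. d m i * ?x i)"
      using d[OF m, of w] by (simp add: norm_mult[symmetric])
    also have "\<dots> \<le> (\<Sum>i<n. cmod (d m i) * 1)"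
      by (rule order_trans[OF norm_sum]) (auto simp: norm_mult intro!: sum_mono mult_left_le x1)
    also have "\<dots> \<le> (\<Sum>m<a. \<Sum>i<n. cmod (d m i))"
      using m by (simp, intro member_le_sum) (auto intro!: sum_nonneg)
    finally show ?thesis using assms by (simp add: c_def field_simps)
  qed
  then show ?thesis by blast
qed

lemma lincomb_cols_scale: "lincomb_cols z a (\<lambda>m. s * w m) i = s * lincomb_cols z a w i"
  by (simp add: lincomb_cols_def sum_distrib_left mult_ac)

lemma lincomb_cols_add: "lincomb_cols z a (\<lambda>m. w m + u m) i = lincomb_cols z a w i + lincomb_cols z a u i"
  by (simp add: lincomb_cols_def sum.distrib ring_distribs)

lemma inner_upto_scale: "inner_upto n (\<lambda>i. s * x i) y = s * inner_upto n x y"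
  by (simp add: inner_upto_def sum_distrib_left mult_ac)

lemma inner_upto_scale_right: "inner_upto n x (\<lambda>i. s * y i) = cnj s * inner_upto n x y"
  by (simp add: inner_upto_def sum_distrib_left mult_ac)

lemma inner_upto_add: "inner_upto n (\<lambda>i. x i + y i) u = inner_upto n x u + inner_upto n y u"
  by (simp add: inner_upto_def sum.distrib ring_distribs)

lemma inner_upto_add_right: "inner_upto n u (\<lambda>i. x i + y i) = inner_upto n u x + inner_upto n u y"
  by (simp add: inner_upto_def sum.distrib ring_distribs)

section \<open>Existence of maximising pairs of unit vectors\<close>

lemma exists_unit_orthogonal:
  assumes g: "gramdet {..<n} b z \<noteq> 0" and k: "k < b"
  shows "\<exists>w. inner_upto n (lincomb_cols z b w) (lincomb_cols z b w) = 1 \<and>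
    (\<forall>i<k. inner_upto n (lincomb_cols z b w) (f i) = 0)"
proof -
  \<comment> \<open>The \<open>k\<close> orthogonality conditions on \<open>b > k\<close>
    coefficients, padded with zero rows to a square matrix. It is singular, and the nonzero Gram
    determinant keeps the combination given by a kernel vector from vanishing.\<close>
  let ?M = "mat b b (\<lambda>(i, m). if i < k then \<Sum>j<n. z (j, m) * cnj (f i j) else 0)"
  have "det ?M = det (transpose_mat ?M)"
    by (rule det_transpose[symmetric]) auto
  also have "\<dots> = 0"
    using k by (intro det_zero_col[of _ b "b - 1"]) auto
  finally obtain v where v: "v \<in> carrier_vec b" "v \<noteq> 0\<^sub>v b" "?M *\<^sub>v v = 0\<^sub>v b"
    using det_0_iff_vec_prod_zero[of ?M b] by auto
  let ?x = "lincomb_cols z b (($) v)"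
  have orth: "inner_upto n ?x (f i) = 0" if i: "i < k" for i
  proof -
    have "inner_upto n ?x (f i) = (\<Sum>j<n. \<Sum>m<b. z (j, m) * cnj (f i j) * v $ m)"
      by (simp add: inner_upto_def lincomb_cols_def sum_distrib_left sum_distrib_right mult_ac)
    also have "\<dots> = (\<Sum>m<b. \<Sum>j<n. z (j, m) * cnj (f i j) * v $ m)"
      by (rule sum.swap)
    also have "\<dots> = (?M *\<^sub>v v) $ i"
      using i k v(1) by (auto simp: scalar_prod_def atLeast0LessThan sum_distrib_right)
    finally show ?thesis using i k v(3) by simp
  qed
  obtain m where m: "m < b" "v $ m \<noteq> 0"
    using v(1,2) by (metis carrier_vecD eq_vecI index_zero_vec(1) index_zero_vec(2))
  define s where "s = sqrt (\<Sum>i<n. (cmod (?x i))\<^sup>2)"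
  have "s \<noteq> 0"
  proof
    assume "s = 0"
    then have "\<forall>i<n. ?x i = 0" by (simp add: s_def sum_nonneg_eq_0_iff)
    then show False using lincomb_cols_inj[OF g, of "($) v" m] m by auto
  qed
  let ?w = "\<lambda>m. of_real (1 / s) * v $ m"
  have wx: "lincomb_cols z b ?w = (\<lambda>i. of_real (1 / s) * ?x i)"
    by (rule ext) (rule lincomb_cols_scale)
  have s2: "s\<^sup>2 = (\<Sum>i<n. (cmod (?x i))\<^sup>2)"
    by (simp add: s_def sum_nonneg)
  have "inner_upto n (lincomb_cols z b ?w) (lincomb_cols z b ?w) = 1"
    unfolding inner_upto_self wx using \<open>s \<noteq> 0\<close>
    by (simp add: norm_mult norm_divide power_divide sum_divide_distrib[symmetric] s2[symmetric]
        del: of_real_sum of_real_divide)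
  moreover have "\<forall>i<k. inner_upto n (lincomb_cols z b ?w) (f i) = 0"
    unfolding wx inner_upto_scale using orth by simp
  ultimately show ?thesis by blast
qed

lemma bounded_imp_convergent_subseq_pointwise:
  fixes f :: "nat \<Rightarrow> 'i \<Rightarrow> complex"
  assumes "finite I" "\<And>n i. i \<in> I \<Longrightarrow> cmod (f n i) \<le> c"
  shows "\<exists>\<sigma> l. strict_mono \<sigma> \<and> (\<forall>i\<in>I. (\<lambda>n. f (\<sigma> n) i) \<longlonglongrightarrow> l i)"
  using assms
proof (induction I rule: finite_induct)
  case empty
  show ?case by (intro exI[of _ id]) (auto simp: strict_mono_id)
next
  case (insert i I)
  then obtain \<sigma> l where \<sigma>: "strict_mono \<sigma>" "\<And>j. j \<in> I \<Longrightarrow> (\<lambda>n. f (\<sigma> n) j) \<longlonglongrightarrow> l j" by blast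
  have "seq_compact (cball (0::complex) c)"
    by (simp add: seq_compact_eq_compact)
  then obtain x \<tau> where \<tau>: "strict_mono \<tau>" "((\<lambda>n. f (\<sigma> n) i) \<circ> \<tau>) \<longlonglongrightarrow> x"
    using insert.prems by (elim seq_compactE[of _ "\<lambda>n. f (\<sigma> n) i"]) auto
  have "(\<lambda>n. f ((\<sigma> \<circ> \<tau>) n) j) \<longlonglongrightarrow> (l(i := x)) j" if "j \<in> insert i I" for j
  proof (cases "j = i")
    case True then show ?thesis using \<tau>(2) by (simp add: comp_def)
  next
    case False
    then have "(\<lambda>n. f (\<sigma> n) j) \<longlonglongrightarrow> l j" using that \<sigma>(2) by auto
    from LIMSEQ_subseq_LIMSEQ[OF this \<tau>(1)] show ?thesis using False by (simp add: comp_def)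
  qed
  then show ?case using strict_mono_o[OF \<sigma>(1) \<tau>(1)] by blast
qed

text \<open>Values outside the finite set \<open>I\<close> are not bounded by the hypotheses, so
  compactness is established for the image of \<open>K\<close> under \<open>\<phi>\<close>, by
  extracting subsequences that converge at the coordinates in \<open>I\<close>.\<close>

lemma continuous_attains_sup_pointwise:
  fixes K :: "('i \<Rightarrow> complex) set" and \<phi> :: "('i \<Rightarrow> complex) \<Rightarrow> real"
  assumes I: "finite I" and K: "K \<noteq> {}"
    and bdd: "\<And>u i. u \<in> K \<Longrightarrow> i \<in> I \<Longrightarrow> cmod (u i) \<le> c"
    and closed: "\<And>f l. (\<And>n. f n \<in> K) \<Longrightarrow> (\<And>i. i \<in> I \<Longrightarrow> (\<lambda>n. f n i) \<longlonglongrightarrow> l i) \<Longrightarrow> l \<in> K"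
    and cont: "\<And>f l. (\<And>n. f n \<in> K) \<Longrightarrow> (\<And>i. i \<in> I \<Longrightarrow> (\<lambda>n. f n i) \<longlonglongrightarrow> l i) \<Longrightarrow> (\<lambda>n. \<phi> (f n)) \<longlonglongrightarrow> \<phi> l"
  shows "\<exists>u\<in>K. \<forall>u'\<in>K. \<phi> u' \<le> \<phi> u"
proof -
  have sub: "\<exists>\<sigma> l. strict_mono \<sigma> \<and> l \<in> K \<and> (\<lambda>n. \<phi> (f (\<sigma> n))) \<longlonglongrightarrow> \<phi> l" if f: "\<And>n. f n \<in> K" for f :: "nat \<Rightarrow> 'i \<Rightarrow> complex"
  proof -
    obtain \<sigma> l where \<sigma>: "strict_mono \<sigma>" "\<And>i. i \<in> I \<Longrightarrow> (\<lambda>n. f (\<sigma> n) i) \<longlonglongrightarrow> l i"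
      using bounded_imp_convergent_subseq_pointwise[OF I, of f c] bdd[OF f] by blast
    then show ?thesis using closed[of "\<lambda>n. f (\<sigma> n)" l] cont[of "\<lambda>n. f (\<sigma> n)" l] f by blast
  qed
  have "seq_compact (\<phi> ` K)"
    unfolding seq_compact_def
  proof (intro allI impI)
    fix y :: "nat \<Rightarrow> real" assume "\<forall>n. y n \<in> \<phi> ` K"
    then have "\<forall>n. \<exists>u. u \<in> K \<and> y n = \<phi> u" by auto
    then obtain f where f: "\<And>n. f n \<in> K" "\<And>n. y n = \<phi> (f n)" by metis
    show "\<exists>l\<in>\<phi> ` K. \<exists>r. strict_mono r \<and> (y \<circ> r) \<longlonglongrightarrow> l"
    proof -
      obtain \<sigma> l where "strict_mono \<sigma>" "l \<in> K" "(\<lambda>n. \<phi> (f (\<sigma> n))) \<longlonglongrightarrow> \<phi> l"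
        using sub[of f, OF f(1)] by blast
      then show ?thesis using f(2) by (auto simp: comp_def)
    qed
  qed
  then have "compact (\<phi> ` K)" by (simp add: seq_compact_eq_compact)
  then show ?thesis using compact_attains_sup[of "\<phi> ` K"] K by auto
qed

lemma exists_maximal_pair:
  fixes f g :: "nat \<Rightarrow> nat \<Rightarrow> complex"
  assumes g1: "gramdet {..<n} a z1 \<noteq> 0" and g2: "gramdet {..<n} b z2 \<noteq> 0" and k: "k < a" "a \<le> b"
  defines "F w u \<equiv> (let x = lincomb_cols z1 a w; y = lincomb_cols z2 b u in
     inner_upto n x x = 1 \<and> inner_upto n y y = 1 \<and> (\<forall>i<k. inner_upto n x (f i) = 0 \<and> inner_upto n y (g i) = 0))"
  shows "\<exists>w u. F w u \<and> (\<forall>w' u'. F w' u' \<longrightarrow>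
     cmod (inner_upto n (lincomb_cols z1 a w') (lincomb_cols z2 b u')) \<le>
     cmod (inner_upto n (lincomb_cols z1 a w) (lincomb_cols z2 b u)))"
proof -
  \<comment> \<open>A pair of coefficient vectors is stored as one function, the second vector
    starting at index \<open>a\<close>, so that the extreme value lemma applies to pairs.\<close>
  let ?u = "\<lambda>w m. w (a + m)"
  define K where "K = {w. F w (?u w)}"
  let ?\<phi> = "\<lambda>w. cmod (inner_upto n (lincomb_cols z1 a w) (lincomb_cols z2 b (?u w)))"
  have lim: "(\<lambda>m. lincomb_cols z1 a (h m) i) \<longlonglongrightarrow> lincomb_cols z1 a l i"
    "(\<lambda>m. lincomb_cols z2 b (?u (h m)) i) \<longlonglongrightarrow> lincomb_cols z2 b (?u l) i"
    if "\<And>i. i \<in> {..<a + b} \<Longrightarrow> (\<lambda>m. h m i) \<longlonglongrightarrow> l i" for h l i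
    unfolding lincomb_cols_def using that by (auto intro!: tendsto_intros)
  have "\<exists>w\<in>K. \<forall>w'\<in>K. ?\<phi> w' \<le> ?\<phi> w"
  proof -
    obtain c1 where c1: "\<And>w m. inner_upto n (lincomb_cols z1 a w) (lincomb_cols z1 a w) = 1 \<Longrightarrow> m < a \<Longrightarrow> cmod (w m) \<le> c1"
      using lincomb_cols_bounded[OF g1] by blast
    obtain c2 where c2: "\<And>w m. inner_upto n (lincomb_cols z2 b w) (lincomb_cols z2 b w) = 1 \<Longrightarrow> m < b \<Longrightarrow> cmod (w m) \<le> c2"
      using lincomb_cols_bounded[OF g2] by blast
    show ?thesis
    proof (rule continuous_attains_sup_pointwise[of "{..<a + b}" _ "max c1 c2"])
      obtain w where w: "inner_upto n (lincomb_cols z1 a w) (lincomb_cols z1 a w) = 1"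
         "\<And>i. i < k \<Longrightarrow> inner_upto n (lincomb_cols z1 a w) (f i) = 0"
        using exists_unit_orthogonal[OF g1 k(1), of f] by blast
      obtain u where u: "inner_upto n (lincomb_cols z2 b u) (lincomb_cols z2 b u) = 1"
         "\<And>i. i < k \<Longrightarrow> inner_upto n (lincomb_cols z2 b u) (g i) = 0"
        using exists_unit_orthogonal[OF g2, of k g] k by auto
      let ?w = "\<lambda>m. if m < a then w m else u (m - a)"
      have "lincomb_cols z1 a ?w = lincomb_cols z1 a w" "lincomb_cols z2 b (?u ?w) = lincomb_cols z2 b u"
        by (auto simp: lincomb_cols_def fun_eq_iff)
      then have "?w \<in> K" unfolding K_def F_def using w u by (simp add: Let_def)
      then show "K \<noteq> {}" by blast
      show "cmod (w i) \<le> max c1 c2" if "w \<in> K" "i \<in> {..<a + b}" for w i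
      proof (cases "i < a")
        case True then show ?thesis using that c1[of w i] by (auto simp: K_def F_def Let_def le_max_iff_disj)
      next
        case False then show ?thesis using that c2[of "?u w" "i - a"] by (auto simp: K_def F_def Let_def le_max_iff_disj)
      qed
      show "l \<in> K" if h: "\<And>m. h m \<in> K" and l: "\<And>i. i \<in> {..<a + b} \<Longrightarrow> (\<lambda>m. h m i) \<longlonglongrightarrow> l i" for h l
      proof -
        have h': "inner_upto n (lincomb_cols z1 a (h m)) (lincomb_cols z1 a (h m)) = 1"
          "inner_upto n (lincomb_cols z2 b (?u (h m))) (lincomb_cols z2 b (?u (h m))) = 1"
          "i < k \<Longrightarrow> inner_upto n (lincomb_cols z1 a (h m)) (f i) = 0"
          "i < k \<Longrightarrow> inner_upto n (lincomb_cols z2 b (?u (h m))) (g i) = 0" for m i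
          using h[of m] by (auto simp: K_def F_def Let_def)
        have lims: "(\<lambda>m. inner_upto n (lincomb_cols z1 a (h m)) (lincomb_cols z1 a (h m))) \<longlonglongrightarrow> inner_upto n (lincomb_cols z1 a l) (lincomb_cols z1 a l)"
          "(\<lambda>m. inner_upto n (lincomb_cols z2 b (?u (h m))) (lincomb_cols z2 b (?u (h m)))) \<longlonglongrightarrow> inner_upto n (lincomb_cols z2 b (?u l)) (lincomb_cols z2 b (?u l))"
          "(\<lambda>m. inner_upto n (lincomb_cols z1 a (h m)) (f i)) \<longlonglongrightarrow> inner_upto n (lincomb_cols z1 a l) (f i)"
          "(\<lambda>m. inner_upto n (lincomb_cols z2 b (?u (h m))) (g i)) \<longlonglongrightarrow> inner_upto n (lincomb_cols z2 b (?u l)) (g i)" for i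
          unfolding inner_upto_def using lim[OF l] by (auto intro!: tendsto_intros)
        have "inner_upto n (lincomb_cols z1 a l) (lincomb_cols z1 a l) = 1"
          "inner_upto n (lincomb_cols z2 b (?u l)) (lincomb_cols z2 b (?u l)) = 1"
          using lims(1,2) unfolding h' by (auto simp: LIMSEQ_const_iff)
        moreover have "inner_upto n (lincomb_cols z1 a l) (f i) = 0"
          "inner_upto n (lincomb_cols z2 b (?u l)) (g i) = 0" if "i < k" for i
          using lims(3,4)[of i] unfolding h'(3,4)[OF that] by (auto simp: LIMSEQ_const_iff)
        ultimately show ?thesis by (simp add: K_def F_def Let_def)
      qed
      show "(\<lambda>m. ?\<phi> (h m)) \<longlonglongrightarrow> ?\<phi> l" if l: "\<And>i. i \<in> {..<a + b} \<Longrightarrow> (\<lambda>m. h m i) \<longlonglongrightarrow> l i" for h l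
        unfolding inner_upto_def using lim[OF l] by (auto intro!: tendsto_intros)
    qed auto
  qed
  then obtain w where w: "w \<in> K" "\<And>w'. w' \<in> K \<Longrightarrow> ?\<phi> w' \<le> ?\<phi> w" by blast
  have "cmod (inner_upto n (lincomb_cols z1 a w') (lincomb_cols z2 b u')) \<le> ?\<phi> w" if "F w' u'" for w' u'
  proof -
    let ?w = "\<lambda>m. if m < a then w' m else u' (m - a)"
    have *: "lincomb_cols z1 a ?w = lincomb_cols z1 a w'" "lincomb_cols z2 b (?u ?w) = lincomb_cols z2 b u'"
      by (auto simp: lincomb_cols_def fun_eq_iff)
    have "F ?w (?u ?w) = F w' u'"
      unfolding F_def by (simp only: *)
    then have "F ?w (?u ?w)" using that by (simp only:)
    then have "?w \<in> K" by (simp only: K_def mem_Collect_eq)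
    from w(2)[OF this] show ?thesis by (simp only: *)
  qed
  moreover have "F w (?u w)" using w(1) by (simp only: K_def mem_Collect_eq)
  ultimately show ?thesis by (intro exI[of _ w] exI[of _ "?u w"]) auto
qed

section \<open>Gram matrices of two orthonormal systems\<close>

lemma det_unit_diag_blocks:
  assumes ab: "a \<le> b"
  shows "det (mat (a + b) (a + b) (\<lambda>(k, l). if k = l then 1 else if l = a + k \<and> k < a then c k
      else if k = a + l \<and> l < a then cnj (c l) else 0)) = of_real (\<Prod>k<a. 1 - (cmod (c k))\<^sup>2)"
    (is "det ?M = _")
proof -
  \<comment> \<open>Block elimination: the Schur complement of the first identity block is diagonal,
    with entries \<open>1 - (cmod (c k))\<^sup>2\<close> in its first \<open>a\<close> places and 1
    afterwards.\<close>
  let ?L = "mat (a + b) (a + b) (\<lambda>(k, l). if k = l then 1 else if k = a + l \<and> l < a then cnj (c l) else 0)"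
  let ?U = "mat (a + b) (a + b) (\<lambda>(k, l). if k = l then (if a \<le> k \<and> k < a + a then 1 - of_real ((cmod (c (k - a)))\<^sup>2) else 1)
      else if l = a + k \<and> k < a then c k else 0)"
  have "?M = ?L * ?U"
  proof (rule eq_matI)
    fix k l assume "k < dim_row (?L * ?U)" "l < dim_col (?L * ?U)"
    then have kl: "k < a + b" "l < a + b" by auto
    define u where "u m = ?U $$ (m, l)" for m
    have "(?L * ?U) $$ (k, l) = (\<Sum>m<a + b. ?L $$ (k, m) * u m)"
      using kl by (simp add: scalar_prod_def atLeast0LessThan u_def)
    also have "\<dots> = u k + (if a \<le> k \<and> k < a + a then cnj (c (k - a)) * u (k - a) else 0)"
    proof (cases "a \<le> k \<and> k < a + a")
      case True
      then have "(\<Sum>m<a + b. ?L $$ (k, m) * u m) =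
          (\<Sum>m<a + b. (if m = k then u m else 0) + (if m = k - a then cnj (c m) * u m else 0))"
        using kl by (intro sum.cong refl) auto
      then show ?thesis using True kl by (simp add: sum.distrib)
    next
      case False
      then have "(\<Sum>m<a + b. ?L $$ (k, m) * u m) = (\<Sum>m<a + b. if m = k then u m else 0)"
        using kl by (intro sum.cong refl) auto
      then show ?thesis using False kl by auto
    qed
    also have "\<dots> = ?M $$ (k, l)"
    proof (cases "a \<le> k \<and> k < a + a")
      case True
      then obtain p where p: "k = a + p" "p < a" by (metis le_Suc_ex nat_add_left_cancel_less)
      show ?thesis
        using kl ab p cnj_mult_self[of "c p"] unfolding u_def p(1) by (cases "l = a + p"; cases "l = p") simp_all
    next
      case False
      then show ?thesis
        using kl unfolding u_def by (cases "k < a") simp_all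
    qed
    finally show "?M $$ (k, l) = (?L * ?U) $$ (k, l)" ..
  qed auto
  then have "det ?M = det ?L * det ?U"
    by (simp add: det_mult[of _ "a + b"])
  also have "det ?L = 1"
    by (subst det_lower_triangular[of "a + b"]) (auto simp: prod_list_diag_prod)
  also have "det ?U = (\<Prod>k<a + b. if a \<le> k \<and> k < a + a then 1 - of_real ((cmod (c (k - a)))\<^sup>2) else 1)"
    by (subst det_upper_triangular[of _ "a + b"]) (auto simp: prod_list_diag_prod atLeast0LessThan intro!: prod.cong)
  also have "\<dots> = (\<Prod>k\<in>{a..<a + a}. 1 - of_real ((cmod (c (k - a)))\<^sup>2))"
    using ab by (intro prod.mono_neutral_cong_right) auto
  also have "\<dots> = (\<Prod>k<a. 1 - of_real ((cmod (c k))\<^sup>2))"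
    by (intro prod.reindex_bij_witness[of _ "\<lambda>k. k + a" "\<lambda>k. k - a"]) auto
  finally show ?thesis by simp
qed

lemma gramdet_orthonormal_pair:
  assumes ab: "a \<le> b"
    and f: "\<And>k l. k < a \<Longrightarrow> l < a \<Longrightarrow> inner_upto n (f k) (f l) = (if k = l then 1 else 0)"
    and g: "\<And>k l. k < b \<Longrightarrow> l < b \<Longrightarrow> inner_upto n (g k) (g l) = (if k = l then 1 else 0)"
    and fg: "\<And>k l. k < a \<Longrightarrow> l < b \<Longrightarrow> k \<noteq> l \<Longrightarrow> inner_upto n (f k) (g l) = 0"
  shows "gramdet {..<n} (a + b) (\<lambda>(i, k). if k < a then f k i else g (k - a) i) =
    of_real (\<Prod>k<a. 1 - (cmod (inner_upto n (f k) (g k)))\<^sup>2)"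
proof -
  let ?h = "\<lambda>(i, k). if k < a then f k i else g (k - a) i"
  \<comment> \<open>Gram entries conjugate their first factor and \<open>inner_upto\<close> its
    second, hence the conjugate.\<close>
  define c where "c k = cnj (inner_upto n (f k) (g k))" for k
  have c: "inner_upto n (g k) (f k) = c k" "inner_upto n (f k) (g k) = cnj (c k)" for k
    unfolding c_def by (simp_all add: inner_upto_commute[of n "g k"])
  have gf: "inner_upto n (g l) (f k) = 0" if "k < a" "l < b" "k \<noteq> l" for k l
    using fg[OF that] by (simp add: inner_upto_commute[of n "g l"])
  have eq: "(\<Sum>i<n. cnj (x i) * y i) = inner_upto n y x" for x y
    by (simp add: inner_upto_def mult.commute)
  have "mat (a + b) (a + b) (\<lambda>(k, l). \<Sum>i<n. cnj (?h (i, k)) * ?h (i, l)) =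
    mat (a + b) (a + b) (\<lambda>(k, l). if k = l then 1 else if l = a + k \<and> k < a then c k
      else if k = a + l \<and> l < a then cnj (c l) else 0)" (is "?L = ?R")
  proof (rule eq_matI)
    fix k l assume "k < dim_row ?R" "l < dim_col ?R"
    then have kl: "k < a + b" "l < a + b" by auto
    consider "k < a" "l < a" | "k < a" "\<not> l < a" | "\<not> k < a" "l < a" | "\<not> k < a" "\<not> l < a" by blast
    then show "?L $$ (k, l) = ?R $$ (k, l)"
    proof cases
      case 1 then show ?thesis using kl by (auto simp: eq f)
    next
      case 2
      then show ?thesis using kl gf[of k "l - a"] c by (auto simp: eq)
    next
      case 3
      then show ?thesis using kl fg[of l "k - a"] c by (auto simp: eq)
    next
      case 4
      then show ?thesis using kl g[of "l - a" "k - a"] by (auto simp: eq)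
    qed
  qed auto
  then show ?thesis
    unfolding gramdet_def using det_unit_diag_blocks[OF ab, of c] by (simp add: c)
qed

text \<open>Unless \<open>d = 0\<close>, the unit vector \<open>(c y0 + d y) / N\<close> would beat the maximum.\<close>

lemma maximal_pair_orthogonal:
  assumes z: "inner_upto n y0 y0 = 1" "inner_upto n y y = 1" "inner_upto n y y0 = 0"
    and max: "\<And>s t. inner_upto n (\<lambda>i. s * y0 i + t * y i) (\<lambda>i. s * y0 i + t * y i) = 1 \<Longrightarrow>
      cmod (inner_upto n x (\<lambda>i. s * y0 i + t * y i)) \<le> cmod (inner_upto n x y0)"
  shows "inner_upto n x y = 0"
proof (rule ccontr)
  define c d where "c = inner_upto n x y0" "d = inner_upto n x y"
  assume "inner_upto n x y \<noteq> 0"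
  then have d: "0 < (cmod d)\<^sup>2" by (simp add: c_d_def)
  define N where "N = sqrt ((cmod c)\<^sup>2 + (cmod d)\<^sup>2)"
  have N: "0 < N" "N\<^sup>2 = (cmod c)\<^sup>2 + (cmod d)\<^sup>2"
    using d by (auto simp: N_def intro: add_nonneg_pos)
  define s t where "s = c / of_real N" "t = d / of_real N"
  have y0y: "inner_upto n y0 y = 0"
    using z(3) by (simp add: inner_upto_commute[of n y0])
  have s0: "cnj s * s = of_real ((cmod s)\<^sup>2)" "cnj t * t = of_real ((cmod t)\<^sup>2)"
    by (rule cnj_mult_self)+
  have "inner_upto n (\<lambda>i. s * y0 i + t * y i) (\<lambda>i. s * y0 i + t * y i) = cnj s * s + cnj t * t"
    by (simp only: inner_upto_add inner_upto_add_right inner_upto_scale inner_upto_scale_right z y0y) simp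
  also have "\<dots> = of_real ((cmod s)\<^sup>2 + (cmod t)\<^sup>2)"
    unfolding s0 by simp
  also have "(cmod s)\<^sup>2 + (cmod t)\<^sup>2 = ((cmod c)\<^sup>2 + (cmod d)\<^sup>2) / N\<^sup>2"
    using N(1) by (simp add: s_t_def norm_divide power_divide add_divide_distrib)
  also have "\<dots> = 1"
    using N(1) unfolding N(2)[symmetric] by simp
  finally have "cmod (inner_upto n x (\<lambda>i. s * y0 i + t * y i)) \<le> cmod c"
    using max unfolding c_d_def by simp
  moreover have "inner_upto n x (\<lambda>i. s * y0 i + t * y i) = cnj s * c + cnj t * d"
    by (simp only: c_d_def inner_upto_add_right inner_upto_scale_right)
  moreover have "\<dots> = of_real N"
  proof -
    have "cnj s * c + cnj t * d = (cnj c * c + cnj d * d) / of_real N"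
      by (simp add: s_t_def add_divide_distrib)
    also have "\<dots> = of_real ((cmod c)\<^sup>2 + (cmod d)\<^sup>2) / of_real N"
      unfolding cnj_mult_self by simp
    also have "\<dots> = of_real N"
      unfolding N(2)[symmetric] using N(1) by (simp add: power2_eq_square)
    finally show ?thesis .
  qed
  ultimately have "N \<le> cmod c" using N(1) by simp
  then have "N\<^sup>2 \<le> (cmod c)\<^sup>2" using N(1) by (intro power_mono) auto
  then show False using N(2) d by simp
qed

section \<open>Principal vectors in terms of coefficients\<close>

abbreviation (input) entries :: "complex mat \<Rightarrow> nat \<times> nat \<Rightarrow> complex" where
  "entries A \<equiv> \<lambda>p. A $$ p"

lemma mem_col_span:
  assumes "A \<in> carrier_mat n a"
  shows "x \<in> col_span A \<longleftrightarrow> (\<exists>w. x = vec n (lincomb_cols (entries A) a w))"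
proof -
  have eq: "A *\<^sub>v v = vec n (lincomb_cols (entries A) a (($) v))" if "v \<in> carrier_vec a" for v
    using assms that by (intro eq_vecI) (auto simp: lincomb_cols_def scalar_prod_def atLeast0LessThan)
  show ?thesis
  proof
    assume "x \<in> col_span A"
    then show "\<exists>w. x = vec n (lincomb_cols (entries A) a w)"
      using eq assms unfolding col_span_def by auto
  next
    assume "\<exists>w. x = vec n (lincomb_cols (entries A) a w)"
    then obtain w where w: "x = vec n (lincomb_cols (entries A) a w)" by blast
    have "x = A *\<^sub>v vec a w"
      unfolding w by (subst eq) (auto simp: lincomb_cols_def)
    then show "x \<in> col_span A"
      using assms unfolding col_span_def by auto
  qed
qed

lemma cscalar_prod_inner_upto:
  "x \<in> carrier_vec n \<Longrightarrow> y \<in> carrier_vec n \<Longrightarrow> x \<bullet>c y = inner_upto n (($) x) (($) y)"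
  by (auto simp: scalar_prod_def inner_upto_def atLeast0LessThan)

lemma inner_upto_cong:
  "(\<And>i. i < n \<Longrightarrow> x i = x' i) \<Longrightarrow> (\<And>i. i < n \<Longrightarrow> y i = y' i) \<Longrightarrow> inner_upto n x y = inner_upto n x' y'"
  by (simp add: inner_upto_def)

lemma inner_upto_vec [simp]:
  "inner_upto n (($) (vec n x)) y = inner_upto n x y" "inner_upto n x (($) (vec n y)) = inner_upto n x y"
  by (auto intro: inner_upto_cong)

text \<open>Quantifiers over vectors of the two spans become quantifiers over coefficient functions,
  the form in which the maximisation is available.\<close>

lemma principal_vectors_alt:
  assumes A: "A \<in> carrier_mat n a" and B: "B \<in> carrier_mat n b"
  defines "L1 \<equiv> lincomb_cols (entries A) a" and "L2 \<equiv> lincomb_cols (entries B) b"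
  shows "principal_vectors n k (col_span A) (col_span B) (\<lambda>i. vec n (L1 (w i))) (\<lambda>i. vec n (L2 (u i))) \<longleftrightarrow>
    (\<forall>j<k. inner_upto n (L1 (w j)) (L1 (w j)) = 1 \<and> inner_upto n (L2 (u j)) (L2 (u j)) = 1 \<and>
      (\<forall>i<j. inner_upto n (L1 (w j)) (L1 (w i)) = 0 \<and> inner_upto n (L2 (u j)) (L2 (u i)) = 0) \<and>
      (\<forall>w' u'. inner_upto n (L1 w') (L1 w') = 1 \<longrightarrow> inner_upto n (L2 u') (L2 u') = 1 \<longrightarrow>
        (\<forall>i<j. inner_upto n (L1 w') (L1 (w i)) = 0 \<and> inner_upto n (L2 u') (L2 (u i)) = 0) \<longrightarrow>
        cmod (inner_upto n (L1 w') (L2 u')) \<le> cmod (inner_upto n (L1 (w j)) (L2 (u j)))))"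
proof -
  have S: "x \<in> col_span A \<longleftrightarrow> (\<exists>w. x = vec n (L1 w))" "y \<in> col_span B \<longleftrightarrow> (\<exists>w. y = vec n (L2 w))" for x y
    unfolding L1_def L2_def using mem_col_span[OF A] mem_col_span[OF B] by auto
  have ip: "vec n x \<bullet>c vec n y = inner_upto n x y" for x y
    by (subst cscalar_prod_inner_upto) auto
  have allS: "(\<forall>x y. x \<in> col_span A \<longrightarrow> y \<in> col_span B \<longrightarrow> P x y) \<longleftrightarrow> (\<forall>w u. P (vec n (L1 w)) (vec n (L2 u)))" for P
    unfolding S by blast
  have mem: "vec n (L1 w) \<in> col_span A" "vec n (L2 w) \<in> col_span B" for w
    unfolding S by blast+
  show ?thesis
    by (simp only: principal_vectors_def allS mem unit_cvec_def ip vec_carrier simp_thms)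
qed

lemma principal_vectors_exist:
  assumes A: "A \<in> carrier_mat n a" and B: "B \<in> carrier_mat n b"
    and g: "gramdet {..<n} a (entries A) \<noteq> 0" "gramdet {..<n} b (entries B) \<noteq> 0" and ab: "a \<le> b"
  shows "\<exists>as bs. principal_vectors n a (col_span A) (col_span B) as bs"
proof -
  define L1 where "L1 = lincomb_cols (entries A) a"
  define L2 where "L2 = lincomb_cols (entries B) b"
  note alt = principal_vectors_alt[OF A B, folded L1_def L2_def]
  have "\<exists>w u. principal_vectors n k (col_span A) (col_span B) (\<lambda>i. vec n (L1 (w i))) (\<lambda>i. vec n (L2 (u i)))" if "k \<le> a" for k
    using that
  proof (induction k)
    case 0
    then show ?case by (simp add: principal_vectors_def)
  next
    case (Suc k)
    then obtain w u where wu: "principal_vectors n k (col_span A) (col_span B) (\<lambda>i. vec n (L1 (w i))) (\<lambda>i. vec n (L2 (u i)))"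
      by auto
    obtain w' u' where "inner_upto n (L1 w') (L1 w') = 1" "inner_upto n (L2 u') (L2 u') = 1"
        "\<forall>i<k. inner_upto n (L1 w') (L1 (w i)) = 0 \<and> inner_upto n (L2 u') (L2 (u i)) = 0"
        "\<And>x y. inner_upto n (L1 x) (L1 x) = 1 \<Longrightarrow> inner_upto n (L2 y) (L2 y) = 1 \<Longrightarrow>
          (\<forall>i<k. inner_upto n (L1 x) (L1 (w i)) = 0 \<and> inner_upto n (L2 y) (L2 (u i)) = 0) \<Longrightarrow>
          cmod (inner_upto n (L1 x) (L2 y)) \<le> cmod (inner_upto n (L1 w') (L2 u'))"
      using exists_maximal_pair[OF g, of k "\<lambda>i. L1 (w i)" "\<lambda>i. L2 (u i)"] Suc.prems ab
      unfolding L1_def[symmetric] L2_def[symmetric] Let_def by auto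
    then have "principal_vectors n (Suc k) (col_span A) (col_span B)
       (\<lambda>i. vec n (L1 ((w(k := w')) i))) (\<lambda>i. vec n (L2 ((u(k := u')) i)))"
      using wu unfolding alt by (auto simp: less_Suc_eq)
    then show ?case by blast
  qed
  then show ?thesis by blast
qed

text \<open>The recursive condition is symmetric; this lets the next orthogonality argument be used
  from either side.\<close>

lemma principal_vectors_swap:
  assumes "principal_vectors n a S T as bs" "S \<subseteq> carrier_vec n" "T \<subseteq> carrier_vec n"
  shows "principal_vectors n a T S bs as"
proof -
  have sym: "cmod (x \<bullet>c y) = cmod (y \<bullet>c x)" if "x \<in> carrier_vec n" "y \<in> carrier_vec n" for x y
    using that by (simp add: cscalar_prod_inner_upto inner_upto_commute[of n "($) x"])
  show ?thesis
    unfolding principal_vectors_def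
  proof (intro allI impI)
    fix k assume k: "k < a"
    note P = assms(1)[unfolded principal_vectors_def, rule_format, OF k]
    have c: "as k \<in> carrier_vec n" "bs k \<in> carrier_vec n"
      using P by (auto simp: unit_cvec_def)
    show "bs k \<in> T \<and> as k \<in> S \<and> unit_cvec n (bs k) \<and> unit_cvec n (as k) \<and>
      (\<forall>i<k. bs k \<bullet>c bs i = 0 \<and> as k \<bullet>c as i = 0) \<and>
      (\<forall>x y. x \<in> T \<longrightarrow> y \<in> S \<longrightarrow> unit_cvec n x \<longrightarrow> unit_cvec n y \<longrightarrow>
           (\<forall>i<k. x \<bullet>c bs i = 0 \<and> y \<bullet>c as i = 0) \<longrightarrow> cmod (x \<bullet>c y) \<le> cmod (bs k \<bullet>c as k))"
    proof (intro conjI allI impI)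
      fix x y
      assume x: "x \<in> T" "y \<in> S" "unit_cvec n x" "unit_cvec n y" "\<forall>i<k. x \<bullet>c bs i = 0 \<and> y \<bullet>c as i = 0"
      then have "cmod (y \<bullet>c x) \<le> cmod (as k \<bullet>c bs k)"
        using P by blast
      then show "cmod (x \<bullet>c y) \<le> cmod (bs k \<bullet>c as k)"
        using sym[OF c] sym[of x y] x(3,4) by (simp add: unit_cvec_def)
    qed (use P in auto)
  qed
qed

lemma col_span_carrier: "A \<in> carrier_mat n a \<Longrightarrow> col_span A \<subseteq> carrier_vec n"
  by (auto simp: col_span_def)

text \<open>If \<open>as k\<close> had a component along \<open>y\<close>, turning
  \<open>bs k\<close> towards \<open>y\<close> would enlarge the inner product, and the turned
  vector still competes because \<open>y\<close> is orthogonal to the earlier \<open>bs i\<close>.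
  Together with its mirror image this makes the matrix of cross inner products diagonal.\<close>

lemma principal_vectors_orthogonal:
  assumes A: "A \<in> carrier_mat n a" and B: "B \<in> carrier_mat n b"
    and pv: "principal_vectors n c (col_span A) (col_span B) as bs"
    and k: "k < c" and y: "y \<in> col_span B" "unit_cvec n y" "\<And>i. i \<le> k \<Longrightarrow> y \<bullet>c bs i = 0"
  shows "as k \<bullet>c y = 0"
proof -
  have P: "as j \<in> col_span A" "bs j \<in> col_span B" "unit_cvec n (as j)" "unit_cvec n (bs j)"
    "i < j \<Longrightarrow> as j \<bullet>c as i = 0" "i < j \<Longrightarrow> bs j \<bullet>c bs i = 0" if "j < c" for i j
    using pv that unfolding principal_vectors_def by auto
  have c: "as j \<in> carrier_vec n" "bs j \<in> carrier_vec n" "y \<in> carrier_vec n" if "j < c" for j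
    using P[OF that] y by (auto simp: unit_cvec_def)
  note ip = cscalar_prod_inner_upto
  have "inner_upto n (($) (as k)) (($) y) = 0"
  proof (rule maximal_pair_orthogonal)
    show "inner_upto n (($) (bs k)) (($) (bs k)) = 1" "inner_upto n (($) y) (($) y) = 1"
      "inner_upto n (($) y) (($) (bs k)) = 0"
      using P(4)[OF k] y(2) y(3)[of k] c[OF k] by (auto simp: unit_cvec_def ip)
    fix s t
    let ?y = "\<lambda>i. s * bs k $ i + t * y $ i"
    assume u: "inner_upto n ?y ?y = 1"
    have "vec n ?y \<in> col_span B"
    proof -
      obtain w u where "bs k = vec n (lincomb_cols (entries B) b w)" "y = vec n (lincomb_cols (entries B) b u)"
        using P(2)[OF k] y(1) unfolding mem_col_span[OF B] by auto
      then have "vec n ?y = vec n (lincomb_cols (entries B) b (\<lambda>m. s * w m + t * u m))"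
        by (intro eq_vecI) (auto simp: lincomb_cols_add lincomb_cols_scale)
      then show ?thesis unfolding mem_col_span[OF B] by blast
    qed
    moreover have "unit_cvec n (vec n ?y)"
      using u by (auto simp: unit_cvec_def ip[of _ n])
    moreover have "vec n ?y \<bullet>c bs i = 0" if i: "i < k" for i
    proof -
      have "vec n ?y \<bullet>c bs i = s * (bs k \<bullet>c bs i) + t * (y \<bullet>c bs i)"
        using i k c[of i] c[of k] by (simp add: ip[of _ n] inner_upto_add inner_upto_scale)
      then show ?thesis using P(6)[OF k i] y(3)[of i] i by simp
    qed
    ultimately have "cmod (as k \<bullet>c vec n ?y) \<le> cmod (as k \<bullet>c bs k)"
      using pv k P(1,3,5)[OF k] unfolding principal_vectors_def by blast
    then show "cmod (inner_upto n (($) (as k)) ?y) \<le> cmod (inner_upto n (($) (as k)) (($) (bs k)))"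
      using c[OF k] by (simp add: ip[of _ n])
  qed
  then show ?thesis using c[OF k] by (simp add: ip[of _ n])
qed

lemma extend_orthonormal:
  assumes g: "gramdet {..<n} b z \<noteq> 0" and cb: "c \<le> b"
    and w: "\<And>k l. k < c \<Longrightarrow> l < c \<Longrightarrow>
      inner_upto n (lincomb_cols z b (w k)) (lincomb_cols z b (w l)) = (if k = l then 1 else 0)"
  shows "\<exists>w'. (\<forall>k<c. w' k = w k) \<and> (\<forall>k<b. \<forall>l<b.
      inner_upto n (lincomb_cols z b (w' k)) (lincomb_cols z b (w' l)) = (if k = l then 1 else 0))"
proof -
  have "\<exists>w'. (\<forall>k<c. w' k = w k) \<and> (\<forall>k<d. \<forall>l<d.
      inner_upto n (lincomb_cols z b (w' k)) (lincomb_cols z b (w' l)) = (if k = l then 1 else 0))"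
    if "c \<le> d" "d \<le> b" for d
    using that
  proof (induction d rule: dec_induct)
    case base
    then show ?case using w by (intro exI[of _ w]) auto
  next
    case (step d)
    then obtain w' where w': "\<And>k. k < c \<Longrightarrow> w' k = w k"
      "\<And>k l. k < d \<Longrightarrow> l < d \<Longrightarrow> inner_upto n (lincomb_cols z b (w' k)) (lincomb_cols z b (w' l)) = (if k = l then 1 else 0)"
      by auto
    obtain x where x: "inner_upto n (lincomb_cols z b x) (lincomb_cols z b x) = 1"
      "\<And>k. k < d \<Longrightarrow> inner_upto n (lincomb_cols z b x) (lincomb_cols z b (w' k)) = 0"
      using exists_unit_orthogonal[OF g, of d "\<lambda>k. lincomb_cols z b (w' k)"] step.prems by auto
    have x': "inner_upto n (lincomb_cols z b (w' k)) (lincomb_cols z b x) = 0" if "k < d" for k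
      using x(2)[OF that] by (subst inner_upto_commute) simp
    show ?case
      using w' x x' step.hyps by (intro exI[of _ "w'(d := x)"]) (auto simp: less_Suc_eq)
  qed
  from this[OF cb order_refl] show ?thesis .
qed

definition juxtapose :: "nat \<Rightarrow> (nat \<times> nat \<Rightarrow> complex) \<Rightarrow> (nat \<times> nat \<Rightarrow> complex) \<Rightarrow> nat \<times> nat \<Rightarrow> complex" where
  "juxtapose a z1 z2 = (\<lambda>(i, k). if k < a then z1 (i, k) else z2 (i, k - a))"

text \<open>The two changes of basis form a single block diagonal one.\<close>

lemma gramdet_juxtapose_lincomb_cols:
  "gramdet {..<n} (a + b) (juxtapose a (\<lambda>(i, l). lincomb_cols z1 a (w l) i) (\<lambda>(i, l). lincomb_cols z2 b (u l) i)) =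
    of_real ((cmod (det (mat a a (\<lambda>(m, l). w l m))))\<^sup>2 * (cmod (det (mat b b (\<lambda>(m, l). u l m))))\<^sup>2) *
    gramdet {..<n} (a + b) (juxtapose a z1 z2)"
proof -
  define X where "X l m = (if l < a then (if m < a then w l m else 0) else (if m < a then 0 else u (l - a) (m - a)))" for l m
  have lc: "juxtapose a (\<lambda>(i, l). lincomb_cols z1 a (w l) i) (\<lambda>(i, l). lincomb_cols z2 b (u l) i) =
      (\<lambda>(i, l). lincomb_cols (juxtapose a z1 z2) (a + b) (X l) i)"
    unfolding juxtapose_def lincomb_cols_def sum_lessThan_add X_def by (auto simp: fun_eq_iff)
  let ?A = "mat a a (\<lambda>(m, l). w l m)" and ?B = "mat b b (\<lambda>(m, l). u l m)"
  have "mat (a + b) (a + b) (\<lambda>(m, l). X l m) = four_block_mat ?A (0\<^sub>m a b) (0\<^sub>m b a) ?B"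
    by (rule eq_matI) (auto simp: X_def)
  then have "det (mat (a + b) (a + b) (\<lambda>(m, l). X l m)) = det ?A * det ?B"
    by (simp add: det_four_block_mat_upper_right_zero[of _ a _ b])
  then show ?thesis
    unfolding lc gramdet_lincomb_cols by (simp add: norm_mult power_mult_distrib)
qed

text \<open>Passing to orthonormal bases built on the principal vectors multiplies the joint Gram
  determinant and the product of the separate ones by the same factor \<open>?x * ?y\<close>. In
  these bases the separate determinants are 1 and the joint one is the product of all 1 - cos^2.
  Since this holds for every system of principal vectors, the choice made in \<open>sin_sub\<close>
  is harmless.\<close>

lemma principal_vectors_gramdet:
  assumes A: "A \<in> carrier_mat n a" and B: "B \<in> carrier_mat n b"
    and g: "gramdet {..<n} b (entries B) \<noteq> 0" and ab: "a \<le> b"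
    and pv: "principal_vectors n a (col_span A) (col_span B) as bs"
  shows "gramdet {..<n} (a + b) (juxtapose a (entries A) (entries B)) =
    of_real (\<Prod>k<a. 1 - (cmod (as k \<bullet>c bs k))\<^sup>2) * gramdet {..<n} a (entries A) * gramdet {..<n} b (entries B)"
proof -
  define L1 where "L1 = lincomb_cols (entries A) a"
  define L2 where "L2 = lincomb_cols (entries B) b"
  note ip = cscalar_prod_inner_upto
  have P: "as j \<in> col_span A" "bs j \<in> col_span B" "unit_cvec n (as j)" "unit_cvec n (bs j)"
    "i < j \<Longrightarrow> as j \<bullet>c as i = 0" "i < j \<Longrightarrow> bs j \<bullet>c bs i = 0" if "j < a" for i j
    using pv that unfolding principal_vectors_def by auto
  have "\<forall>k. \<exists>w. k < a \<longrightarrow> as k = vec n (L1 w)"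
    using P(1) unfolding mem_col_span[OF A] L1_def by blast
  then obtain w where w: "\<And>k. k < a \<Longrightarrow> as k = vec n (L1 (w k))" by metis
  have "\<forall>k. \<exists>w. k < a \<longrightarrow> bs k = vec n (L2 w)"
    using P(2) unfolding mem_col_span[OF B] L2_def by blast
  then obtain u0 where u0: "\<And>k. k < a \<Longrightarrow> bs k = vec n (L2 (u0 k))" by metis
  have on1: "inner_upto n (L1 (w k)) (L1 (w l)) = (if k = l then 1 else 0)" if "k < a" "l < a" for k l
    using P(3)[of k] P(5)[of k l] P(5)[of l k] that
    by (cases k l rule: linorder_cases)
      (auto simp: unit_cvec_def w ip[of _ n] inner_upto_commute[of n "L1 (w k)" "L1 (w l)"])
  have on2: "inner_upto n (L2 (u0 k)) (L2 (u0 l)) = (if k = l then 1 else 0)" if "k < a" "l < a" for k l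
    using P(4)[of k] P(6)[of k l] P(6)[of l k] that
    by (cases k l rule: linorder_cases)
      (auto simp: unit_cvec_def u0 ip[of _ n] inner_upto_commute[of n "L2 (u0 k)" "L2 (u0 l)"])
  \<comment> \<open>Only \<open>a\<close> of the \<open>b\<close> basis vectors are principal; any
    orthonormal completion serves for the others.\<close>
  obtain u where u: "\<And>k. k < a \<Longrightarrow> u k = u0 k"
    "\<And>k l. k < b \<Longrightarrow> l < b \<Longrightarrow> inner_upto n (L2 (u k)) (L2 (u l)) = (if k = l then 1 else 0)"
    using extend_orthonormal[OF g ab, of u0] on2 unfolding L2_def by blast
  have bsu: "bs k = vec n (L2 (u k))" if "k < a" for k
    using u0 u(1) that by simp
  have uspan: "vec n (L2 (u l)) \<in> col_span B" for l
    unfolding mem_col_span[OF B] L2_def by blast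
  \<comment> \<open>For \<open>k < l\<close> the vector of \<open>u l\<close> is orthogonal to the
    first \<open>k + 1\<close> of the \<open>bs\<close>, whether or not \<open>l\<close> is below
    \<open>a\<close>. For \<open>l < k\<close> the roles are exchanged, with \<open>as k\<close> as
    the competing vector.\<close>
  have cross: "inner_upto n (L1 (w k)) (L2 (u l)) = 0" if kl: "k < a" "l < b" "k \<noteq> l" for k l
  proof (cases "k < l")
    case True
    have "as k \<bullet>c vec n (L2 (u l)) = 0"
    proof (rule principal_vectors_orthogonal[OF A B pv kl(1) uspan])
      show "unit_cvec n (vec n (L2 (u l)))"
        using u(2)[of l l] kl by (auto simp: unit_cvec_def ip[of _ n])
      show "vec n (L2 (u l)) \<bullet>c bs i = 0" if "i \<le> k" for i
        using that True kl ab u(2)[of l i] by (simp add: bsu ip[of _ n])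
    qed
    then show ?thesis using w[OF kl(1)] by (simp add: ip[of _ n])
  next
    case False
    then have lk: "l < k" "l < a" using kl by auto
    have "bs l \<bullet>c as k = 0"
    proof (rule principal_vectors_orthogonal[OF B A _ lk(2) P(1)[OF kl(1)] P(3)[OF kl(1)]])
      show "principal_vectors n a (col_span B) (col_span A) bs as"
        using pv col_span_carrier[OF A] col_span_carrier[OF B] by (rule principal_vectors_swap)
      show "as k \<bullet>c as i = 0" if "i \<le> l" for i
        using that lk P(5)[OF kl(1)] by auto
    qed
    then have "inner_upto n (L2 (u l)) (L1 (w k)) = 0"
      using w[OF kl(1)] bsu[OF lk(2)] by (simp add: ip[of _ n])
    then show ?thesis by (simp add: inner_upto_commute[of n "L1 (w k)"])
  qed
  let ?P = "of_real (\<Prod>k<a. 1 - (cmod (as k \<bullet>c bs k))\<^sup>2) :: complex"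
  let ?x = "complex_of_real ((cmod (det (mat a a (\<lambda>(m, l). w l m))))\<^sup>2)"
  let ?y = "complex_of_real ((cmod (det (mat b b (\<lambda>(m, l). u l m))))\<^sup>2)"
  have "gramdet {..<n} (a + b) (\<lambda>(i, k). if k < a then L1 (w k) i else L2 (u (k - a)) i) =
     of_real (\<Prod>k<a. 1 - (cmod (inner_upto n (L1 (w k)) (L2 (u k))))\<^sup>2)"
    by (rule gramdet_orthonormal_pair[OF ab on1 u(2) cross])
  also have "\<dots> = ?P"
    by (simp add: w bsu ip[of _ n])
  also have "(\<lambda>(i, k). if k < a then L1 (w k) i else L2 (u (k - a)) i) =
      juxtapose a (\<lambda>(i, l). L1 (w l) i) (\<lambda>(i, l). L2 (u l) i)"
    by (auto simp: juxtapose_def fun_eq_iff)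
  finally have 1: "?x * ?y * gramdet {..<n} (a + b) (juxtapose a (entries A) (entries B)) = ?P"
    unfolding L1_def L2_def gramdet_juxtapose_lincomb_cols by simp
  have eq: "(\<Sum>i<n. cnj (x i) * y i) = inner_upto n y x" for x y
    by (simp add: inner_upto_def mult.commute)
  have "gramdet {..<n} a (\<lambda>(i, l). L1 (w l) i) = 1"
    using on1 by (intro gramdet_orthonormal) (auto simp: eq)
  then have 2: "?x * gramdet {..<n} a (entries A) = 1"
    unfolding L1_def gramdet_lincomb_cols by simp
  have "gramdet {..<n} b (\<lambda>(i, l). L2 (u l) i) = 1"
    using u(2) by (intro gramdet_orthonormal) (auto simp: eq)
  then have 3: "?y * gramdet {..<n} b (entries B) = 1"
    unfolding L2_def gramdet_lincomb_cols by simp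
  have "?P * gramdet {..<n} a (entries A) * gramdet {..<n} b (entries B) =
     (?x * gramdet {..<n} a (entries A)) * (?y * gramdet {..<n} b (entries B)) *
     gramdet {..<n} (a + b) (juxtapose a (entries A) (entries B))"
    unfolding 1[symmetric] by (simp only: mult_ac)
  then show ?thesis unfolding 2 3 by simp
qed

text \<open>This keeps the argument of \<open>arccos\<close> inside its domain.\<close>

lemma cmod_inner_unit_le:
  assumes "unit_cvec n x" "unit_cvec n y"
  shows "cmod (x \<bullet>c y) \<le> 1"
proof -
  have c: "x \<in> carrier_vec n" "y \<in> carrier_vec n" using assms by (auto simp: unit_cvec_def)
  have "complex_of_real (\<Sum>i<n. (cmod (x $ i))\<^sup>2) = 1" "complex_of_real (\<Sum>i<n. (cmod (y $ i))\<^sup>2) = 1"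
    using assms c unfolding unit_cvec_def cscalar_prod_inner_upto[OF c(1) c(1)] cscalar_prod_inner_upto[OF c(2) c(2)]
      inner_upto_self by simp_all
  then have n: "(\<Sum>i<n. (cmod (x $ i))\<^sup>2) = 1" "(\<Sum>i<n. (cmod (y $ i))\<^sup>2) = 1"
    by (simp_all only: of_real_eq_1_iff)
  have "cmod (x \<bullet>c y) \<le> (\<Sum>i<n. cmod (x $ i * cnj (y $ i)))"
    unfolding cscalar_prod_inner_upto[OF c] inner_upto_def by (rule norm_sum)
  also have "\<dots> \<le> (\<Sum>i<n. ((cmod (x $ i))\<^sup>2 + (cmod (y $ i))\<^sup>2) / 2)"
  proof (intro sum_mono)
    fix i
    have "0 \<le> (cmod (x $ i) - cmod (y $ i))\<^sup>2" by simp
    then show "cmod (x $ i * cnj (y $ i)) \<le> ((cmod (x $ i))\<^sup>2 + (cmod (y $ i))\<^sup>2) / 2"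
      by (simp add: norm_mult power2_diff)
  qed
  also have "\<dots> = 1"
    by (simp add: sum_divide_distrib[symmetric] sum.distrib n)
  finally show ?thesis .
qed

lemma sin_sub_gramdet:
  assumes A: "A \<in> carrier_mat n a" and B: "B \<in> carrier_mat n b"
    and g: "gramdet {..<n} a (entries A) \<noteq> 0" "gramdet {..<n} b (entries B) \<noteq> 0" and ab: "a \<le> b"
  shows "gramdet {..<n} (a + b) (juxtapose a (entries A) (entries B)) =
    of_real ((sin_sub n a (col_span A) (col_span B))\<^sup>2) * gramdet {..<n} a (entries A) * gramdet {..<n} b (entries B)"
proof -
  obtain as bs where s: "(SOME (as, bs). principal_vectors n a (col_span A) (col_span B) as bs) = (as, bs)"
    by (cases "SOME (as, bs). principal_vectors n a (col_span A) (col_span B) as bs") auto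
  \<comment> \<open>Existence is what turns the unspecified value of \<open>SOME\<close> into a
    system of principal vectors.\<close>
  have "\<exists>x. case x of (as, bs) \<Rightarrow> principal_vectors n a (col_span A) (col_span B) as bs"
    using principal_vectors_exist[OF A B g ab] by auto
  from someI_ex[OF this] have pv: "principal_vectors n a (col_span A) (col_span B) as bs"
    unfolding s by simp
  have "(sin_sub n a (col_span A) (col_span B))\<^sup>2 = (\<Prod>k<a. (sin (arccos (cmod (as k \<bullet>c bs k))))\<^sup>2)"
    unfolding sin_sub_def s by (simp add: prod_power_distrib)
  also have "\<dots> = (\<Prod>k<a. 1 - (cmod (as k \<bullet>c bs k))\<^sup>2)"
  proof (intro prod.cong refl)
    fix k assume "k \<in> {..<a}"
    then have "cmod (as k \<bullet>c bs k) \<le> 1"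
      using pv unfolding principal_vectors_def by (intro cmod_inner_unit_le) auto
    moreover have "-1 \<le> cmod (as k \<bullet>c bs k)"
      by (rule order_trans[OF _ norm_ge_zero]) simp
    ultimately show "(sin (arccos (cmod (as k \<bullet>c bs k))))\<^sup>2 = 1 - (cmod (as k \<bullet>c bs k))\<^sup>2"
      by (simp add: sin_squared_eq)
  qed
  finally show ?thesis
    using principal_vectors_gramdet[OF A B g(2) ab pv] by simp
qed

section \<open>The sine against a coordinate subspace\<close>

lemma rank_eq_if_gramdet_nonzero:
  assumes A: "A \<in> carrier_mat n a" and g: "gramdet {..<n} a (entries A) \<noteq> 0"
  shows "vec_space.rank n A = a"
proof -
  interpret vec_space "TYPE(complex)" n .
  have inj: "v = 0\<^sub>v a" if v: "v \<in> carrier_vec a" "A *\<^sub>v v = 0\<^sub>v n" for v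
  proof -
    have "lincomb_cols (entries A) a (($) v) i = 0" if "i < n" for i
    proof -
      have "lincomb_cols (entries A) a (($) v) i = (A *\<^sub>v v) $ i"
        using A v(1) that by (auto simp: lincomb_cols_def scalar_prod_def atLeast0LessThan)
      then show ?thesis using v(2) that by simp
    qed
    then have "v $ m = 0" if "m < a" for m
      using lincomb_cols_inj[OF g, of "($) v" m] that by auto
    then show ?thesis using v(1) by (intro eq_vecI) auto
  qed
  have dist: "distinct (cols A)"
  proof (rule ccontr)
    assume "\<not> distinct (cols A)"
    then obtain k l where kl: "k < a" "l < a" "k \<noteq> l" "col A k = col A l"
      using A by (auto simp: distinct_conv_nth)
    have "A *\<^sub>v (unit_vec a k - unit_vec a l) = A *\<^sub>v unit_vec a k - A *\<^sub>v unit_vec a l"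
      using A by (intro mult_minus_distrib_mat_vec) auto
    also have "\<dots> = 0\<^sub>v n"
    proof -
      have "A *\<^sub>v unit_vec a m = col A m" if "m < a" for m
        using A that by (intro eq_vecI) auto
      then show ?thesis using A kl by auto
    qed
    finally have "unit_vec a k - unit_vec a l = (0\<^sub>v a :: complex vec)"
      by (intro inj) auto
    then have "(unit_vec a k - unit_vec a l) $ k = (0\<^sub>v a :: complex vec) $ k" by simp
    then show False using kl by simp
  qed
  show ?thesis
    using lin_indpt_full_rank[OF A dist] lin_depE[OF A _ dist] inj by metis
qed

text \<open>The determinant of a permutation matrix has modulus 1. The modulus is found by
  evaluating the change-of-basis identity on the identity matrix, whose permuted columns are again
  orthonormal.\<close>

lemma gramdet_permute_cols:
  fixes J :: "nat set"
  assumes inj: "inj_on \<pi> {..<q}" and range: "\<And>k. k < q \<Longrightarrow> \<pi> k < q"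
  shows "gramdet J q (\<lambda>(i, k). z (i, \<pi> k)) = gramdet J q z"
proof -
  define X :: "nat \<Rightarrow> nat \<Rightarrow> complex" where "X l m = (if m = \<pi> l then 1 else 0)" for l m
  define D where "D = complex_of_real ((cmod (det (mat q q (\<lambda>(m, l). X l m))))\<^sup>2)"
  have X: "lincomb_cols z q (X l) i = z (i, \<pi> l)" if "l < q" for z :: "nat \<times> nat \<Rightarrow> complex" and l i
    using range[OF that] by (simp add: lincomb_cols_def X_def if_distrib[where f="\<lambda>x. _ * x"] cong: if_cong)
  let ?e = "\<lambda>(i, k). if i = k then 1 else 0 :: complex"
  have "gramdet {..<q} q (\<lambda>(i, l). lincomb_cols ?e q (X l) i) = 1"
  proof (rule gramdet_orthonormal)
    fix k l assume kl: "k < q" "l < q"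
    have "(\<Sum>i<q. cnj (case (i, k) of (i, l) \<Rightarrow> lincomb_cols ?e q (X l) i) * (case (i, l) of (i, l) \<Rightarrow> lincomb_cols ?e q (X l) i)) =
       (\<Sum>i<q. if i = \<pi> k then (if \<pi> k = \<pi> l then 1 else 0) else 0)"
      using kl by (intro sum.cong) (auto simp: X)
    also have "\<dots> = (if k = l then 1 else 0)"
      using kl range[of k] inj by (auto simp: inj_on_def)
    finally show "(\<Sum>i<q. cnj (case (i, k) of (i, l) \<Rightarrow> lincomb_cols ?e q (X l) i) * (case (i, l) of (i, l) \<Rightarrow> lincomb_cols ?e q (X l) i)) = (if k = l then 1 else 0)" .
  qed
  moreover have "gramdet {..<q} q ?e = 1"
  proof (rule gramdet_orthonormal)
    fix k l assume kl: "k < q" "l < q"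
    have "(\<Sum>i<q. cnj (?e (i, k)) * ?e (i, l)) = (\<Sum>i<q. if i = k then (if k = l then 1 else 0) else 0)"
      by (intro sum.cong) auto
    then show "(\<Sum>i<q. cnj (?e (i, k)) * ?e (i, l)) = (if k = l then 1 else 0)"
      using kl by simp
  qed
  ultimately have D: "D = 1"
    unfolding gramdet_lincomb_cols D_def by simp
  have "gramdet J q (\<lambda>(i, k). z (i, \<pi> k)) = gramdet J q (\<lambda>(i, l). lincomb_cols z q (X l) i)"
    by (rule gramdet_cong) (simp add: X)
  also have "\<dots> = D * gramdet J q z"
    unfolding gramdet_lincomb_cols D_def ..
  finally show ?thesis by (simp add: D)
qed

text \<open>\<open>sin_mat\<close> puts the lower-dimensional span first, so both orders of the two
  blocks occur.\<close>

lemma gramdet_juxtapose_swap: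
  "gramdet J (a + b) (juxtapose a x y) = gramdet J (b + a) (juxtapose b y x)"
proof -
  let ?\<pi> = "\<lambda>k. if k < a then b + k else k - a"
  have "gramdet J (a + b) (juxtapose a x y) = gramdet J (a + b) (\<lambda>(i, k). juxtapose b y x (i, ?\<pi> k))"
    by (rule gramdet_cong) (auto simp: juxtapose_def)
  also have "\<dots> = gramdet J (a + b) (juxtapose b y x)"
    by (rule gramdet_permute_cols) (auto simp: inj_on_def)
  finally show ?thesis by (simp add: add.commute)
qed

text \<open>An axis column is 1 on its own row and 0 elsewhere, so expanding along it deletes that
  row.\<close>

lemma gramdet_juxtapose_axes:
  assumes "finite J" "{..<m} \<subseteq> J" and e: "\<And>i k. i \<in> J \<Longrightarrow> k < m \<Longrightarrow> e (i, k) = (if i = k then 1 else 0)"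
  shows "gramdet J (r + m) (juxtapose r y e) = gramdet (J - {..<m}) r y"
  using assms
proof (induction m arbitrary: J)
  case 0
  show ?case by (simp, rule gramdet_cong) (simp add: juxtapose_def)
next
  case (Suc m)
  have "gramdet J (r + Suc m) (juxtapose r y e) = gramdet J (Suc (r + m)) (juxtapose r y e)"
    by simp
  also have "\<dots> = of_real ((cmod (juxtapose r y e (m, r + m)))\<^sup>2) * gramdet (J - {m}) (r + m) (juxtapose r y e)"
    using Suc.prems by (intro gramdet_Suc_axis) (auto simp: juxtapose_def)
  also have "juxtapose r y e (m, r + m) = 1"
    using Suc.prems by (auto simp: juxtapose_def)
  also have "gramdet (J - {m}) (r + m) (juxtapose r y e) = gramdet (J - {m} - {..<m}) r y"
    using Suc.prems by (intro Suc.IH) auto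
  also have "J - {m} - {..<m} = J - {..<Suc m}" by auto
  finally show ?case by simp
qed

text \<open>Joining the first \<open>ts\<close> axes to \<open>Y\<close> deletes the first
  \<open>ts\<close> rows, so the joint Gram determinant is the one over the remaining rows, that of
  the component of \<open>Y\<close> orthogonal to the axes.\<close>

lemma sin_mat_Ink_sq:
  assumes Y: "Y \<in> carrier_mat n r" and g: "gramdet {..<n} r (entries Y) \<noteq> 0" and ts: "ts \<le> n"
  shows "(sin_mat (Ink n ts) Y)\<^sup>2 = Re (gramdet {ts..<n} r (entries Y)) / Re (gramdet {..<n} r (entries Y))"
proof -
  have I: "Ink n ts \<in> carrier_mat n ts" by (simp add: Ink_def)
  have e: "entries (Ink n ts) (i, k) = (if i = k then 1 else 0)" if "i < n" "k < ts" for i k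
    using that by (simp add: Ink_def)
  have gI: "gramdet {..<n} ts (entries (Ink n ts)) = 1"
  proof (rule gramdet_orthonormal)
    fix k l assume kl: "k < ts" "l < ts"
    have "(\<Sum>i<n. cnj (Ink n ts $$ (i, k)) * Ink n ts $$ (i, l)) = (\<Sum>i<n. if i = k then (if k = l then 1 else 0) else 0)"
      using kl by (intro sum.cong) (auto simp: e)
    then show "(\<Sum>i<n. cnj (Ink n ts $$ (i, k)) * Ink n ts $$ (i, l)) = (if k = l then 1 else 0)"
      using kl ts by simp
  qed
  have rk: "vec_space.rank n (Ink n ts) = ts" "vec_space.rank n Y = r"
    using rank_eq_if_gramdet_nonzero[OF I] gI rank_eq_if_gramdet_nonzero[OF Y g] by auto
  have "{..<n} - {..<ts} = {ts..<n}" by auto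
  then have gYI: "gramdet {..<n} (r + ts) (juxtapose r (entries Y) (entries (Ink n ts))) = gramdet {ts..<n} r (entries Y)"
    using gramdet_juxtapose_axes[of "{..<n}" ts "entries (Ink n ts)" r "entries Y"] ts e by simp
  have "gramdet {ts..<n} r (entries Y) = of_real ((sin_mat (Ink n ts) Y)\<^sup>2) * gramdet {..<n} r (entries Y)"
  proof (cases "ts \<le> r")
    case True
    then show ?thesis
      using sin_sub_gramdet[OF I Y _ g True] gI gYI gramdet_juxtapose_swap[of "{..<n}" ts r "entries (Ink n ts)" "entries Y"] I
      by (simp add: sin_mat_def rk Let_def)
  next
    case False
    then show ?thesis
      using sin_sub_gramdet[OF Y I g] gI gYI I
      by (simp add: sin_mat_def rk Let_def)
  qed
  moreover obtain x where "gramdet {..<n} r (entries Y) = of_real x"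
    using gramdet_nonneg[of "{..<n}" r "entries Y"] by auto
  ultimately show ?thesis using g by simp
qed

subsection \<open>Unitary averaging\<close>

text \<open>Matrices are plain functions of index pairs, the type of the points of the Gaussian
  product space. The argument \<open>n\<close> is the inner dimension; outer dimensions are imposed
  by \<open>restrict\<close> or by bounds on the indices.\<close>

definition mmult :: "nat \<Rightarrow> (nat \<times> nat \<Rightarrow> complex) \<Rightarrow> (nat \<times> nat \<Rightarrow> complex) \<Rightarrow> nat \<times> nat \<Rightarrow> complex" where
  "mmult n x y = (\<lambda>(i, k). \<Sum>j<n. x (i, j) * y (j, k))"

definition ctranspose :: "(nat \<times> nat \<Rightarrow> complex) \<Rightarrow> nat \<times> nat \<Rightarrow> complex" where
  "ctranspose x = (\<lambda>(i, j). cnj (x (j, i)))"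

definition delta :: "nat \<times> nat \<Rightarrow> complex" where
  "delta = (\<lambda>(i, j). if i = j then 1 else 0)"

definition unitary :: "nat \<Rightarrow> (nat \<times> nat \<Rightarrow> complex) \<Rightarrow> bool" where
  "unitary n v \<longleftrightarrow> (\<forall>i<n. \<forall>j<n. mmult n v (ctranspose v) (i, j) = delta (i, j) \<and> mmult n (ctranspose v) v (i, j) = delta (i, j))"

lemma mmult_apply: "mmult n x y (i, k) = (\<Sum>j<n. x (i, j) * y (j, k))"
  by (simp add: mmult_def)

lemma mmult_assoc: "mmult n x (mmult m y z) = mmult m (mmult n x y) z"
proof -
  have "(\<Sum>j<n. x (i, j) * (\<Sum>l<m. y (j, l) * z (l, k))) = (\<Sum>l<m. (\<Sum>j<n. x (i, j) * y (j, l)) * z (l, k))" for i k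
    by (simp add: sum_distrib_left sum_distrib_right mult.assoc) (rule sum.swap)
  then show ?thesis by (simp add: mmult_def)
qed

lemma mmult_cong:
  "(\<And>j. j < n \<Longrightarrow> x (i, j) = x' (i, j)) \<Longrightarrow> (\<And>j. j < n \<Longrightarrow> y (j, k) = y' (j, k)) \<Longrightarrow> mmult n x y (i, k) = mmult n x' y' (i, k)"
  by (simp add: mmult_def)

lemma mmult_delta_left: "i < n \<Longrightarrow> mmult n delta z (i, k) = z (i, k)"
  by (simp add: mmult_def delta_def if_distrib[where f="\<lambda>x. x * _"] cong: if_cong)

lemma mmult_delta_right: "k < n \<Longrightarrow> mmult n z delta (i, k) = z (i, k)"
  by (simp add: mmult_def delta_def if_distrib[where f="\<lambda>x. _ * x"] cong: if_cong)

lemma unitaryD: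
  assumes "unitary n v" "i < n" "k < n"
  shows "mmult n v (ctranspose v) (i, k) = delta (i, k)" "mmult n (ctranspose v) v (i, k) = delta (i, k)"
  using assms by (auto simp: unitary_def)

lemma unitary_cancel:
  assumes "unitary n v" "i < n"
  shows "mmult n v (mmult n (ctranspose v) z) (i, k) = z (i, k)" "mmult n (ctranspose v) (mmult n v z) (i, k) = z (i, k)"
    "mmult n (mmult n z v) (ctranspose v) (k, i) = z (k, i)" "mmult n (mmult n z (ctranspose v)) v (k, i) = z (k, i)"
proof -
  have "mmult n (mmult n v (ctranspose v)) z (i, k) = mmult n delta z (i, k)"
    using assms by (intro mmult_cong) (auto simp: unitaryD)
  then show "mmult n v (mmult n (ctranspose v) z) (i, k) = z (i, k)"
    using assms by (simp add: mmult_assoc mmult_delta_left)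
  have "mmult n (mmult n (ctranspose v) v) z (i, k) = mmult n delta z (i, k)"
    using assms by (intro mmult_cong) (auto simp: unitaryD)
  then show "mmult n (ctranspose v) (mmult n v z) (i, k) = z (i, k)"
    using assms by (simp add: mmult_assoc mmult_delta_left)
  have "mmult n z (mmult n v (ctranspose v)) (k, i) = mmult n z delta (k, i)"
    using assms by (intro mmult_cong) (auto simp: unitaryD)
  then show "mmult n (mmult n z v) (ctranspose v) (k, i) = z (k, i)"
    using assms by (simp add: mmult_assoc mmult_delta_right)
  have "mmult n z (mmult n (ctranspose v) v) (k, i) = mmult n z delta (k, i)"
    using assms by (intro mmult_cong) (auto simp: unitaryD)
  then show "mmult n (mmult n z (ctranspose v)) v (k, i) = z (k, i)"
    using assms by (simp add: mmult_assoc mmult_delta_right)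
qed

lemma ctranspose_ctranspose [simp]: "ctranspose (ctranspose v) = v"
  by (simp add: ctranspose_def fun_eq_iff)

lemma unitary_ctranspose: "unitary n v \<Longrightarrow> unitary n (ctranspose v)"
  by (auto simp: unitary_def)

lemma unitaryI_left:
  assumes "\<And>i j. i < n \<Longrightarrow> j < n \<Longrightarrow> mmult n v (ctranspose v) (i, j) = delta (i, j)"
  shows "unitary n v"
proof -
  let ?V = "mat n n v" and ?W = "mat n n (ctranspose v)"
  have mult: "mat n n x * mat n n y = mat n n (mmult n x y)" for x y
    by (rule eq_matI) (auto simp: scalar_prod_def mmult_def atLeast0LessThan)
  have 1: "?V * ?W = 1\<^sub>m n"
    unfolding mult by (rule eq_matI) (auto simp: assms delta_def)
  have "?W * ?V = 1\<^sub>m n"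
    by (rule mat_mult_left_right_inverse[OF _ _ 1]) auto
  then have "mat n n (mmult n (ctranspose v) v) = 1\<^sub>m n"
    unfolding mult .
  then have "mmult n (ctranspose v) v (i, j) = delta (i, j)" if "i < n" "j < n" for i j
  proof -
    have "mat n n (mmult n (ctranspose v) v) $$ (i, j) = 1\<^sub>m n $$ (i, j)"
      unfolding \<open>mat n n (mmult n (ctranspose v) v) = 1\<^sub>m n\<close> ..
    then show ?thesis using that by (simp add: delta_def)
  qed
  then show ?thesis using assms unfolding unitary_def by blast
qed

lemma unitaryI_right:
  assumes "\<And>i j. i < n \<Longrightarrow> j < n \<Longrightarrow> mmult n (ctranspose v) v (i, j) = delta (i, j)"
  shows "unitary n v"
proof -
  have "unitary n (ctranspose v)"
    by (rule unitaryI_left) (simp only: ctranspose_ctranspose assms)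
  from unitary_ctranspose[OF this] show ?thesis by simp
qed

lemma unitary_inner:
  assumes v: "unitary n v"
  shows "(\<Sum>i<n. cnj (mmult n v x (i, k)) * mmult n v y (i, l)) = (\<Sum>i<n. cnj (x (i, k)) * y (i, l))"
proof -
  have "(\<Sum>i<n. cnj (mmult n v x (i, k)) * mmult n v y (i, l)) = mmult n (ctranspose (mmult n v x)) (mmult n v y) (k, l)"
    by (simp add: mmult_def ctranspose_def)
  also have "ctranspose (mmult n v x) = mmult n (ctranspose x) (ctranspose v)"
    by (simp add: ctranspose_def mmult_def fun_eq_iff mult.commute)
  also have "mmult n (mmult n (ctranspose x) (ctranspose v)) (mmult n v y) (k, l) = mmult n (ctranspose x) (mmult n (ctranspose v) (mmult n v y)) (k, l)"
    by (simp add: mmult_assoc)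
  also have "\<dots> = mmult n (ctranspose x) y (k, l)"
    by (intro mmult_cong) (auto simp: unitary_cancel[OF v])
  finally show ?thesis by (simp add: mmult_def ctranspose_def)
qed

lemma gramdet_mmult:
  fixes z :: "nat \<times> nat \<Rightarrow> complex"
  shows "gramdet J r (mmult r z x) = of_real ((cmod (det (mat r r x)))\<^sup>2) * gramdet J r z"
proof -
  have "mmult r z x = (\<lambda>(i, l). lincomb_cols z r (\<lambda>m. x (m, l)) i)"
    by (simp add: mmult_def lincomb_cols_def)
  then show ?thesis
    by (simp add: gramdet_lincomb_cols)
qed

lemma gramdet_delta: "r \<le> n \<Longrightarrow> gramdet {..<n} r delta = 1"
proof (rule gramdet_orthonormal)
  fix k l assume kl: "k < r" "l < r" and "r \<le> n"
  have "(\<Sum>i<n. cnj (delta (i, k)) * delta (i, l)) = (\<Sum>i<n. if i = k then (if k = l then 1 else 0) else 0)"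
    by (intro sum.cong) (auto simp: delta_def)
  then show "(\<Sum>i<n. cnj (delta (i, k)) * delta (i, l)) = (if k = l then 1 else 0)"
    using kl \<open>r \<le> n\<close> by simp
qed

lemma gramdet_square: "gramdet {..<n} n z = of_real ((cmod (det (mat n n z)))\<^sup>2)"
proof -
  have "gramdet {..<n} n z = gramdet {..<n} n (mmult n delta z)"
    by (rule gramdet_cong) (simp add: mmult_delta_left)
  then show ?thesis
    by (simp add: gramdet_mmult gramdet_delta)
qed

lemma measurable_mmult [measurable (raw)]:
  assumes "\<And>i j. i < p \<Longrightarrow> j < n \<Longrightarrow> (\<lambda>w. x w (i, j)) \<in> borel_measurable M"
    "\<And>j k. j < n \<Longrightarrow> k < q \<Longrightarrow> (\<lambda>w. y w (j, k)) \<in> borel_measurable M"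
  shows "(\<lambda>w. restrict (mmult n (x w) (y w)) ({..<p} \<times> {..<q})) \<in> M \<rightarrow>\<^sub>M PiM ({..<p} \<times> {..<q}) (\<lambda>_. borel)"
proof (rule measurable_restrict)
  fix ik assume "ik \<in> {..<p} \<times> {..<q}"
  then obtain i k where ik: "ik = (i, k)" "i < p" "k < q" by auto
  show "(\<lambda>w. mmult n (x w) (y w) ik) \<in> borel_measurable M"
    unfolding ik(1) mmult_apply using assms ik by (intro borel_measurable_sum borel_measurable_times) auto
qed

lemma mmult_add_left: "mmult n x (\<lambda>p. y p + z p) = (\<lambda>p. mmult n x y p + mmult n x z p)"
  by (simp add: mmult_def fun_eq_iff ring_distribs sum.distrib)

lemma mmult_add_right: "mmult n (\<lambda>p. y p + z p) x = (\<lambda>p. mmult n y x p + mmult n z x p)"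
  by (simp add: mmult_def fun_eq_iff ring_distribs sum.distrib)

lemma distr_gauss_unitary_left:
  assumes v: "unitary n v"
  shows "distr (gauss ({..<n} \<times> {..<r})) (gauss ({..<n} \<times> {..<r})) (\<lambda>z. restrict (mmult n v z) ({..<n} \<times> {..<r}))
    = gauss ({..<n} \<times> {..<r})"
proof (rule distr_gauss_isometry)
  let ?I = "{..<n} \<times> {..<r}"
  show "(\<lambda>z. restrict (mmult n v z) ?I) \<in> PiM ?I (\<lambda>_. borel) \<rightarrow>\<^sub>M PiM ?I (\<lambda>_. borel)"
    by (intro measurable_mmult) (auto intro!: measurable_component_singleton)
  show "(\<Sum>p\<in>?I. (cmod (restrict (mmult n v z) ?I p))\<^sup>2) = (\<Sum>p\<in>?I. (cmod (z p))\<^sup>2)" for z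
  proof (rule sum_cmod_sq_eqI)
    have "(\<Sum>k<r. \<Sum>i<n. cnj (mmult n v z (i, k)) * mmult n v z (i, k)) = (\<Sum>k<r. \<Sum>i<n. cnj (z (i, k)) * z (i, k))"
      by (simp add: unitary_inner[OF v])
    then show "(\<Sum>p\<in>?I. cnj (restrict (mmult n v z) ?I p) * restrict (mmult n v z) ?I p) = (\<Sum>p\<in>?I. cnj (z p) * z p)"
      by (simp add: sum.cartesian_product' sum.swap[of _ "{..<r}"])
  qed
  show "\<exists>w'. \<forall>z\<in>extensional ?I. restrict (mmult n v (\<lambda>p\<in>?I. z p + w' p)) ?I = (\<lambda>p\<in>?I. restrict (mmult n v z) ?I p + w p)" for w
  proof (intro exI ballI ext)
    fix z p
    show "restrict (mmult n v (\<lambda>p\<in>?I. z p + mmult n (ctranspose v) w p)) ?I p = (\<lambda>p\<in>?I. restrict (mmult n v z) ?I p + w p) p"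
    proof (cases "p \<in> ?I")
      case True
      then obtain i k where p: "p = (i, k)" "i < n" "k < r" by auto
      have "mmult n v (\<lambda>p\<in>?I. z p + mmult n (ctranspose v) w p) p = mmult n v (\<lambda>p. z p + mmult n (ctranspose v) w p) p"
        unfolding p(1) using p by (intro mmult_cong) auto
      then show ?thesis using p by (simp add: mmult_add_left unitary_cancel[OF v])
    qed simp
  qed
qed simp

text \<open>Conjugate transposition exchanges rows and columns, so the norm identity reduces to
  multiplication from the left. This is the invariance behind the random unitary.\<close>

lemma distr_gauss_unitary_right:
  assumes v: "unitary n v"
  shows "distr (gauss ({..<m} \<times> {..<n})) (gauss ({..<m} \<times> {..<n})) (\<lambda>z. restrict (mmult n z v) ({..<m} \<times> {..<n}))
    = gauss ({..<m} \<times> {..<n})"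
proof (rule distr_gauss_isometry)
  let ?I = "{..<m} \<times> {..<n}"
  show "(\<lambda>z. restrict (mmult n z v) ?I) \<in> PiM ?I (\<lambda>_. borel) \<rightarrow>\<^sub>M PiM ?I (\<lambda>_. borel)"
    by (intro measurable_mmult) (auto intro!: measurable_component_singleton)
  show "(\<Sum>p\<in>?I. (cmod (restrict (mmult n z v) ?I p))\<^sup>2) = (\<Sum>p\<in>?I. (cmod (z p))\<^sup>2)" for z
  proof (rule sum_cmod_sq_eqI)
    have tr: "cnj (mmult n z v (i, k)) = mmult n (ctranspose v) (ctranspose z) (k, i)" for i k
      by (simp add: mmult_def ctranspose_def mult.commute)
    have "(\<Sum>k<n. cnj (mmult n z v (i, k)) * mmult n z v (i, k)) = (\<Sum>k<n. cnj (z (i, k)) * z (i, k))" for i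
    proof -
      have "mmult n z v (i, k) = cnj (mmult n (ctranspose v) (ctranspose z) (k, i))" for k
        by (simp add: tr[symmetric])
      then have "(\<Sum>k<n. cnj (mmult n z v (i, k)) * mmult n z v (i, k)) =
          (\<Sum>k<n. cnj (mmult n (ctranspose v) (ctranspose z) (k, i)) * mmult n (ctranspose v) (ctranspose z) (k, i))"
        by (simp add: mult.commute)
      also have "\<dots> = (\<Sum>k<n. cnj (ctranspose z (k, i)) * ctranspose z (k, i))"
        by (rule unitary_inner[OF unitary_ctranspose[OF v]])
      finally show ?thesis by (simp add: ctranspose_def mult.commute)
    qed
    then show "(\<Sum>p\<in>?I. cnj (restrict (mmult n z v) ?I p) * restrict (mmult n z v) ?I p) = (\<Sum>p\<in>?I. cnj (z p) * z p)"
      by (simp add: sum.cartesian_product')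
  qed
  show "\<exists>w'. \<forall>z\<in>extensional ?I. restrict (mmult n (\<lambda>p\<in>?I. z p + w' p) v) ?I = (\<lambda>p\<in>?I. restrict (mmult n z v) ?I p + w p)" for w
  proof (intro exI ballI ext)
    fix z p
    show "restrict (mmult n (\<lambda>p\<in>?I. z p + mmult n w (ctranspose v) p) v) ?I p = (\<lambda>p\<in>?I. restrict (mmult n z v) ?I p + w p) p"
    proof (cases "p \<in> ?I")
      case True
      then obtain i k where p: "p = (i, k)" "i < m" "k < n" by auto
      have "mmult n (\<lambda>p\<in>?I. z p + mmult n w (ctranspose v) p) v p = mmult n (\<lambda>p. z p + mmult n w (ctranspose v) p) v p"
        unfolding p(1) using p by (intro mmult_cong) auto
      then show ?thesis using p by (simp add: mmult_add_right unitary_cancel[OF v])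
    qed simp
  qed
qed simp

section \<open>A random unitary matrix from Gram-Schmidt\<close>

fun gram_schmidt_row :: "nat \<Rightarrow> (nat \<times> nat \<Rightarrow> complex) \<Rightarrow> nat \<Rightarrow> nat \<Rightarrow> complex" where
  "gram_schmidt_row n z i = (\<lambda>c. z (i, c) - (\<Sum>j<i. inner_upto n (\<lambda>d. z (i, d)) (gram_schmidt_row n z j) /
      inner_upto n (gram_schmidt_row n z j) (gram_schmidt_row n z j) * gram_schmidt_row n z j c))"

declare gram_schmidt_row.simps [simp del]

text \<open>Rows rather than columns, so that multiplication by a unitary from the right commutes
  with the construction. Normalising only here keeps square roots out of the recursion.\<close>

definition orthonormalise :: "nat \<Rightarrow> (nat \<times> nat \<Rightarrow> complex) \<Rightarrow> nat \<times> nat \<Rightarrow> complex" where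
  "orthonormalise n z = (\<lambda>(i, c). gram_schmidt_row n z i c /
     of_real (sqrt (\<Sum>d<n. (cmod (gram_schmidt_row n z i d))\<^sup>2)))"

lemma gram_schmidt_row_cong:
  assumes "\<And>i c. i < n \<Longrightarrow> c < n \<Longrightarrow> z (i, c) = z' (i, c)" "i < n" "c < n"
  shows "gram_schmidt_row n z i c = gram_schmidt_row n z' i c"
  using assms(2,3)
proof (induction i arbitrary: c rule: less_induct)
  case (less i)
  have "inner_upto n (\<lambda>d. z (i, d)) (gram_schmidt_row n z j) = inner_upto n (\<lambda>d. z' (i, d)) (gram_schmidt_row n z' j)"
    "inner_upto n (gram_schmidt_row n z j) (gram_schmidt_row n z j) = inner_upto n (gram_schmidt_row n z' j) (gram_schmidt_row n z' j)"
    if "j < i" for j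
    using less that assms(1) by (auto intro!: inner_upto_cong)
  then show ?case
    using less.IH less.prems assms(1) by (subst (1 2) gram_schmidt_row.simps) (auto intro!: sum.cong)
qed

lemma inner_upto_diff: "inner_upto n (\<lambda>i. x i - y i) u = inner_upto n x u - inner_upto n y u"
  by (simp add: inner_upto_def sum_subtractf ring_distribs)

lemma inner_upto_sum: "inner_upto n (\<lambda>i. \<Sum>j\<in>A. x j i) u = (\<Sum>j\<in>A. inner_upto n (x j) u)"
  unfolding inner_upto_def sum_distrib_right by (rule sum.swap)

lemma inner_upto_eq_0:
  assumes "inner_upto n x x = 0" "i < n"
  shows "x i = 0"
  using assms unfolding inner_upto_self by (simp del: of_real_sum add: sum_nonneg_eq_0_iff)

lemma gram_schmidt_row_orthogonal:
  assumes "j < i"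
  shows "inner_upto n (gram_schmidt_row n z i) (gram_schmidt_row n z j) = 0"
  using assms
proof (induction i arbitrary: j rule: less_induct)
  case (less i)
  let ?g = "gram_schmidt_row n z" and ?z = "\<lambda>d. z (i, d)"
  have orth: "inner_upto n (?g l) (?g j) = 0" if "l < i" "l \<noteq> j" for l
  proof (cases "j < l")
    case True then show ?thesis using less.IH[of l j] that by simp
  next
    case False
    then have "inner_upto n (?g j) (?g l) = 0" using less.IH[of j l] less.prems that by simp
    then show ?thesis by (subst inner_upto_commute) simp
  qed
  have "inner_upto n (?g i) (?g j) = inner_upto n ?z (?g j) -
     (\<Sum>l<i. inner_upto n ?z (?g l) / inner_upto n (?g l) (?g l) * inner_upto n (?g l) (?g j))"
    by (subst (1) gram_schmidt_row.simps) (simp only: inner_upto_diff inner_upto_sum inner_upto_scale)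
  also have "(\<Sum>l<i. inner_upto n ?z (?g l) / inner_upto n (?g l) (?g l) * inner_upto n (?g l) (?g j)) =
     (\<Sum>l<i. if l = j then inner_upto n ?z (?g j) / inner_upto n (?g j) (?g j) * inner_upto n (?g j) (?g j) else 0)"
    by (intro sum.cong refl) (auto simp: orth)
  also have "\<dots> = inner_upto n ?z (?g j) / inner_upto n (?g j) (?g j) * inner_upto n (?g j) (?g j)"
    using less.prems by simp
  also have "\<dots> = inner_upto n ?z (?g j)"
  \<comment> \<open>A vanishing row \<open>j\<close> makes the quotient 0, but then its inner
    product with the row of \<open>z\<close> is 0 as well; orthogonality therefore holds for
    singular \<open>z\<close> too.\<close>
  proof (cases "inner_upto n (?g j) (?g j) = 0")
    case True
    then have "inner_upto n ?z (?g j) = inner_upto n ?z (\<lambda>_. 0)"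
      by (intro inner_upto_cong) (auto dest: inner_upto_eq_0)
    then show ?thesis using True by (simp add: inner_upto_def)
  qed simp
  finally show ?case by simp
qed

text \<open>\<open>z\<close> is a unit lower triangular matrix times the matrix of its Gram-Schmidt
  rows, so a zero row would make \<open>z\<close> singular.\<close>

lemma gram_schmidt_row_nonzero:
  assumes g: "gramdet {..<n} n z \<noteq> 0" and i: "i < n"
  shows "inner_upto n (gram_schmidt_row n z i) (gram_schmidt_row n z i) \<noteq> 0"
proof
  let ?g = "gram_schmidt_row n z"
  assume 0: "inner_upto n (?g i) (?g i) = 0"
  let ?L = "mat n n (\<lambda>(k, j). if j = k then 1 else if j < k then inner_upto n (\<lambda>d. z (k, d)) (?g j) / inner_upto n (?g j) (?g j) else 0)"
  let ?W = "mat n n (\<lambda>(k, c). ?g k c)"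
  have "mat n n z = ?L * ?W"
  proof (rule eq_matI)
    fix k c assume "k < dim_row (?L * ?W)" "c < dim_col (?L * ?W)"
    then have kc: "k < n" "c < n" by auto
    have "(?L * ?W) $$ (k, c) = (\<Sum>j<n. ?L $$ (k, j) * ?W $$ (j, c))"
      using kc by (simp add: scalar_prod_def atLeast0LessThan)
    also have "\<dots> = (\<Sum>j<n. (if j = k then ?g k c else 0) +
        (if j < k then inner_upto n (\<lambda>d. z (k, d)) (?g j) / inner_upto n (?g j) (?g j) * ?g j c else 0))"
      using kc by (intro sum.cong refl) auto
    also have "\<dots> = ?g k c + (\<Sum>j<n. if j < k then inner_upto n (\<lambda>d. z (k, d)) (?g j) / inner_upto n (?g j) (?g j) * ?g j c else 0)"
      using kc by (simp add: sum.distrib)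
    also have "(\<Sum>j<n. if j < k then inner_upto n (\<lambda>d. z (k, d)) (?g j) / inner_upto n (?g j) (?g j) * ?g j c else 0) =
      (\<Sum>j<k. inner_upto n (\<lambda>d. z (k, d)) (?g j) / inner_upto n (?g j) (?g j) * ?g j c)"
      using kc by (intro sum.mono_neutral_cong_right) auto
    finally show "mat n n z $$ (k, c) = (?L * ?W) $$ (k, c)"
      using kc by (subst (asm) gram_schmidt_row.simps[of n z k]) simp
  qed auto
  then have "det (mat n n z) = det ?L * det ?W"
    by (simp add: det_mult[of _ n])
  also have "det ?W = det (transpose_mat ?W)"
    by (rule det_transpose[symmetric]) auto
  also have "\<dots> = 0"
    using i inner_upto_eq_0[OF 0] by (intro det_zero_col[of _ n i]) auto
  finally show False using g by (simp add: gramdet_square)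
qed

lemma unitary_orthonormalise:
  assumes "gramdet {..<n} n z \<noteq> 0"
  shows "unitary n (orthonormalise n z)"
proof (rule unitaryI_left)
  fix i k assume ik: "i < n" "k < n"
  let ?g = "gram_schmidt_row n z"
  define s where "s i = sqrt (\<Sum>d<n. (cmod (?g i d))\<^sup>2)" for i
  have "mmult n (orthonormalise n z) (ctranspose (orthonormalise n z)) (i, k) =
      inner_upto n (?g i) (?g k) / (of_real (s i) * of_real (s k))"
    by (simp add: mmult_def ctranspose_def orthonormalise_def inner_upto_def s_def sum_divide_distrib)
  also have "\<dots> = delta (i, k)"
  proof (cases "i = k")
    case True
    have "inner_upto n (?g i) (?g i) = of_real ((s i)\<^sup>2)"
      unfolding inner_upto_self s_def by (simp add: sum_nonneg)
    moreover have "inner_upto n (?g i) (?g i) \<noteq> 0"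
      using gram_schmidt_row_nonzero[OF assms] ik by simp
    ultimately show ?thesis using True by (simp add: delta_def power2_eq_square)
  next
    case False
    then consider "k < i" | "i < k" by linarith
    then have "inner_upto n (?g i) (?g k) = 0"
    proof cases
      case 1 then show ?thesis by (rule gram_schmidt_row_orthogonal)
    next
      case 2 then show ?thesis
        by (subst inner_upto_commute) (simp add: gram_schmidt_row_orthogonal)
    qed
    then show ?thesis using False by (simp add: delta_def)
  qed
  finally show "mmult n (orthonormalise n z) (ctranspose (orthonormalise n z)) (i, k) = delta (i, k)" .
qed

lemma inner_upto_unitary_right:
  assumes "unitary n v"
  shows "inner_upto n (\<lambda>c. \<Sum>d<n. x d * v (d, c)) (\<lambda>c. \<Sum>d<n. y d * v (d, c)) = inner_upto n x y"
proof -
  have "inner_upto n (\<lambda>c. \<Sum>d<n. x d * v (d, c)) (\<lambda>c. \<Sum>d<n. y d * v (d, c)) =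
     (\<Sum>c<n. cnj (mmult n (ctranspose v) (\<lambda>(d, _). cnj (x d)) (c, 0)) * mmult n (ctranspose v) (\<lambda>(d, _). cnj (y d)) (c, 0))"
    by (simp add: inner_upto_def mmult_def ctranspose_def mult.commute)
  also have "\<dots> = inner_upto n x y"
    by (subst unitary_inner[OF unitary_ctranspose[OF assms]]) (simp add: inner_upto_def)
  finally show ?thesis .
qed

text \<open>The Gram-Schmidt coefficients are quotients of inner products of rows, which a unitary
  on the right preserves.\<close>

lemma gram_schmidt_row_mmult:
  assumes v: "unitary n v"
  shows "gram_schmidt_row n (mmult n z v) i c = (\<Sum>d<n. gram_schmidt_row n z i d * v (d, c))"
proof (induction i arbitrary: c rule: less_induct)
  case (less i)
  let ?g = "gram_schmidt_row n z" and ?h = "gram_schmidt_row n (mmult n z v)"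
  have h: "?h j = (\<lambda>c. \<Sum>d<n. ?g j d * v (d, c))" if "j < i" for j
    using less.IH[OF that] by (simp add: fun_eq_iff)
  have "?h i c = mmult n z v (i, c) - (\<Sum>j<i. inner_upto n (\<lambda>d. mmult n z v (i, d)) (?h j) / inner_upto n (?h j) (?h j) * ?h j c)"
    by (subst gram_schmidt_row.simps) simp
  also have "\<dots> = (\<Sum>d<n. z (i, d) * v (d, c)) -
     (\<Sum>j<i. inner_upto n (\<lambda>d. z (i, d)) (?g j) / inner_upto n (?g j) (?g j) * (\<Sum>d<n. ?g j d * v (d, c)))"
    by (intro arg_cong2[where f=minus] sum.cong) (auto simp: h mmult_apply inner_upto_unitary_right[OF v])
  also have "\<dots> = (\<Sum>d<n. z (i, d) * v (d, c)) -
     (\<Sum>d<n. (\<Sum>j<i. inner_upto n (\<lambda>d. z (i, d)) (?g j) / inner_upto n (?g j) (?g j) * ?g j d) * v (d, c))"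
    by (simp add: sum_distrib_left sum_distrib_right mult.assoc) (rule sum.swap)
  also have "\<dots> = (\<Sum>d<n. ?g i d * v (d, c))"
    by (subst (3) gram_schmidt_row.simps) (simp add: ring_distribs sum_subtractf)
  finally show ?case .
qed

lemma orthonormalise_mmult:
  assumes v: "unitary n v"
  shows "orthonormalise n (mmult n z v) = mmult n (orthonormalise n z) v"
proof -
  let ?g = "gram_schmidt_row n z" and ?h = "gram_schmidt_row n (mmult n z v)"
  have "inner_upto n (?h i) (?h i) = inner_upto n (?g i) (?g i)" for i
    unfolding gram_schmidt_row_mmult[OF v, abs_def] by (rule inner_upto_unitary_right[OF v])
  then have s: "(\<Sum>d<n. (cmod (?h i d))\<^sup>2) = (\<Sum>d<n. (cmod (?g i d))\<^sup>2)" for i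
    unfolding inner_upto_self of_real_eq_iff .
  show ?thesis
    unfolding orthonormalise_def s unfolding gram_schmidt_row_mmult[OF v]
    by (auto simp: mmult_def sum_divide_distrib fun_eq_iff)
qed

lemma orthonormalise_cong:
  assumes "\<And>i c. i < n \<Longrightarrow> c < n \<Longrightarrow> z (i, c) = z' (i, c)" "i < n" "c < n"
  shows "orthonormalise n z (i, c) = orthonormalise n z' (i, c)"
proof -
  have "gram_schmidt_row n z i d = gram_schmidt_row n z' i d" if "d < n" for d
    by (rule gram_schmidt_row_cong[OF _ assms(2) that]) (rule assms(1))
  then show ?thesis using assms(3) by (simp add: orthonormalise_def)
qed

lemma borel_measurable_inner_upto:
  assumes "\<And>i. i < n \<Longrightarrow> (\<lambda>w. x w i) \<in> borel_measurable M" "\<And>i. i < n \<Longrightarrow> (\<lambda>w. y w i) \<in> borel_measurable M"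
  shows "(\<lambda>w. inner_upto n (x w) (y w)) \<in> borel_measurable M"
  unfolding inner_upto_def using assms
  by (intro borel_measurable_sum borel_measurable_times borel_measurable_cnj) auto

lemma borel_measurable_gram_schmidt_row:
  assumes "i < n" "c < n"
  shows "(\<lambda>z. gram_schmidt_row n z i c) \<in> borel_measurable (PiM ({..<n} \<times> {..<n}) (\<lambda>_. borel))"
  using assms
proof (induction i arbitrary: c rule: less_induct)
  case (less i)
  then show ?case
    by (subst gram_schmidt_row.simps)
      (intro borel_measurable_diff borel_measurable_sum borel_measurable_times borel_measurable_divide
        borel_measurable_inner_upto measurable_component_singleton; auto)
qed

lemma borel_measurable_orthonormalise:
  assumes "i < n" "c < n"
  shows "(\<lambda>z. orthonormalise n z (i, c)) \<in> borel_measurable (PiM ({..<n} \<times> {..<n}) (\<lambda>_. borel))"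
proof -
  have [measurable]: "(\<lambda>z. gram_schmidt_row n z i d) \<in> borel_measurable (PiM ({..<n} \<times> {..<n}) (\<lambda>_. borel))" if "d < n" for d
    using assms(1) that by (rule borel_measurable_gram_schmidt_row)
  show ?thesis
    unfolding orthonormalise_def prod.case
    using assms(2) by measurable
qed

section \<open>Averaging over the random unitary\<close>

lemma full_rank_factor:
  assumes g: "gramdet {..<n} r y \<noteq> 0" and r: "r \<le> n"
  shows "\<exists>v x. unitary n v \<and> det (mat r r x) \<noteq> 0 \<and> (\<forall>i<n. \<forall>k<r. mmult r y x (i, k) = v (i, k))"
proof -
  \<comment> \<open>Extending the empty system gives an orthonormal basis of the column span of
    \<open>y\<close>; its coefficients become the columns of \<open>x\<close>.\<close>
  obtain w where w: "\<And>k l. k < r \<Longrightarrow> l < r \<Longrightarrow>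
      inner_upto n (lincomb_cols y r (w k)) (lincomb_cols y r (w l)) = (if k = l then 1 else 0)"
    using extend_orthonormal[OF g, of 0 "\<lambda>_ _. 0"] by auto
  define x where "x = (\<lambda>(m, k). w k m)"
  have lx: "lincomb_cols y r (w k) = (\<lambda>i. mmult r y x (i, k))" for k
    by (simp add: lincomb_cols_def mmult_def x_def fun_eq_iff)
  have ld: "lincomb_cols delta n u i = u i" if "i < n" for u i
    using that by (simp add: lincomb_cols_def delta_def if_distrib[where f="\<lambda>x. x * _"] cong: if_cong)
  \<comment> \<open>The columns of \<open>delta\<close> span the whole space, so the same extension
    lemma completes this basis to the columns of a unitary matrix.\<close>
  have gd: "gramdet {..<n} n delta \<noteq> 0" by (simp add: gramdet_delta)
  have w': "inner_upto n (lincomb_cols delta n (\<lambda>i. mmult r y x (i, k))) (lincomb_cols delta n (\<lambda>i. mmult r y x (i, l))) = (if k = l then 1 else 0)"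
    if "k < r" "l < r" for k l
    using w[OF that] by (subst inner_upto_cong[OF ld ld]) (simp_all add: lx)
  obtain u where u: "\<And>k. k < r \<Longrightarrow> u k = (\<lambda>i. mmult r y x (i, k))"
    "\<And>k l. k < n \<Longrightarrow> l < n \<Longrightarrow> inner_upto n (lincomb_cols delta n (u k)) (lincomb_cols delta n (u l)) = (if k = l then 1 else 0)"
    using extend_orthonormal[OF gd r, of "\<lambda>k i. mmult r y x (i, k)"] w' by blast
  define v where "v = (\<lambda>(i, k). u k i)"
  have "unitary n v"
  proof (rule unitaryI_right)
    fix k l assume kl: "k < n" "l < n"
    have "mmult n (ctranspose v) v (k, l) = inner_upto n (u l) (u k)"
      by (simp add: mmult_def ctranspose_def v_def inner_upto_def mult.commute)
    also have "\<dots> = inner_upto n (lincomb_cols delta n (u l)) (lincomb_cols delta n (u k))"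
      by (rule inner_upto_cong) (simp_all add: ld)
    finally show "mmult n (ctranspose v) v (k, l) = delta (k, l)"
      using u(2) kl by (simp add: delta_def)
  qed
  moreover have "det (mat r r x) \<noteq> 0"
  proof
    assume "det (mat r r x) = 0"
    then have "gramdet {..<n} r (mmult r y x) = 0" by (simp add: gramdet_mmult)
    moreover have "gramdet {..<n} r (mmult r y x) = 1"
    proof (rule gramdet_orthonormal)
      fix k l assume kl: "k < r" "l < r"
      have "(\<Sum>i<n. cnj (mmult r y x (i, k)) * mmult r y x (i, l)) = inner_upto n (lincomb_cols y r (w l)) (lincomb_cols y r (w k))"
        by (simp add: inner_upto_def lx mult.commute)
      then show "(\<Sum>i<n. cnj (mmult r y x (i, k)) * mmult r y x (i, l)) = (if k = l then 1 else 0)"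
        using w kl by simp
    qed
    ultimately show False by simp
  qed
  moreover have "\<forall>i<n. \<forall>k<r. mmult r y x (i, k) = v (i, k)"
    by (simp add: v_def u(1))
  ultimately show ?thesis by blast
qed

text \<open>The rows of a square Gaussian matrix, orthonormalised, form a unitary matrix whose law is
  invariant under right multiplication. So it moves any fixed full-rank matrix to the same
  distribution, up to an invertible factor on the right.\<close>

lemma orthonormalise_law_const:
  assumes D: "D \<in> sets (gauss ({..<n} \<times> {..<r}))" and r: "r \<le> n"
    and inv: "\<And>y x. det (mat r r x) \<noteq> 0 \<Longrightarrow>
      restrict (mmult r y x) ({..<n} \<times> {..<r}) \<in> D \<longleftrightarrow> restrict y ({..<n} \<times> {..<r}) \<in> D"
    and g: "gramdet {..<n} r y \<noteq> 0"
  shows "(\<integral>\<^sup>+z. indicator D (restrict (mmult n (orthonormalise n z) y) ({..<n} \<times> {..<r})) \<partial>gauss ({..<n} \<times> {..<n})) =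
    (\<integral>\<^sup>+z. indicator D (restrict (mmult n (orthonormalise n z) delta) ({..<n} \<times> {..<r})) \<partial>gauss ({..<n} \<times> {..<n}))"
proof -
  let ?I = "{..<n} \<times> {..<r}" and ?Z = "gauss ({..<n} \<times> {..<n})"
  obtain v x where v: "unitary n v" and x: "det (mat r r x) \<noteq> 0"
    and yx: "\<And>i k. i < n \<Longrightarrow> k < r \<Longrightarrow> mmult r y x (i, k) = v (i, k)"
    using full_rank_factor[OF g r] by blast
  let ?T = "\<lambda>z. restrict (mmult n z v) ({..<n} \<times> {..<n})"
  let ?f = "\<lambda>z. indicator D (restrict (mmult n (orthonormalise n z) delta) ?I) :: ennreal"
  have T: "?T \<in> ?Z \<rightarrow>\<^sub>M ?Z"
    unfolding measurable_cong_sets[OF sets_gauss sets_gauss]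
    by (intro measurable_mmult) (auto intro!: measurable_component_singleton)
  have [measurable]: "(\<lambda>z. restrict (mmult n (orthonormalise n z) delta) ?I) \<in> ?Z \<rightarrow>\<^sub>M gauss ?I"
    unfolding measurable_cong_sets[OF sets_gauss sets_gauss]
    by (intro measurable_mmult) (auto intro!: borel_measurable_orthonormalise)
  have f: "?f \<in> borel_measurable ?Z" using D by measurable
  \<comment> \<open>Multiplication by \<open>x\<close> on the right, which \<open>D\<close> does not
    see, turns \<open>y\<close> into the first \<open>r\<close> columns of \<open>v\<close>; then
    \<open>v\<close> is absorbed into the Gaussian matrix \<open>z\<close>.\<close>
  have "(restrict (mmult n (orthonormalise n z) y) ?I \<in> D) = (restrict (mmult n (orthonormalise n (?T z)) delta) ?I \<in> D)" for z
  proof -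
    have eq: "mmult r (mmult n (orthonormalise n z) y) x (i, k) = mmult n (orthonormalise n (?T z)) delta (i, k)"
      if ik: "i < n" "k < r" for i k
    proof -
      have "mmult r (mmult n (orthonormalise n z) y) x (i, k) = mmult n (orthonormalise n z) (mmult r y x) (i, k)"
        by (simp add: mmult_assoc)
      also have "\<dots> = mmult n (orthonormalise n z) v (i, k)"
        using ik by (intro mmult_cong) (auto simp: yx)
      also have "\<dots> = orthonormalise n (mmult n z v) (i, k)"
        by (simp add: orthonormalise_mmult[OF v])
      also have "\<dots> = orthonormalise n (?T z) (i, k)"
        using ik r by (intro orthonormalise_cong) auto
      also have "\<dots> = mmult n (orthonormalise n (?T z)) delta (i, k)"
        using ik r by (simp add: mmult_delta_right)
      finally show ?thesis .
    qed
    have "(restrict (mmult n (orthonormalise n z) y) ?I \<in> D) = (restrict (mmult r (mmult n (orthonormalise n z) y) x) ?I \<in> D)"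
      by (rule inv[OF x, symmetric])
    also have "restrict (mmult r (mmult n (orthonormalise n z) y) x) ?I = restrict (mmult n (orthonormalise n (?T z)) delta) ?I"
      by (rule restrict_ext) (auto simp: eq)
    finally show ?thesis .
  qed
  then have "(\<integral>\<^sup>+z. indicator D (restrict (mmult n (orthonormalise n z) y) ?I) \<partial>?Z) = (\<integral>\<^sup>+z. ?f (?T z) \<partial>?Z)"
    by (simp add: indicator_def)
  also have "\<dots> = (\<integral>\<^sup>+z. ?f z \<partial>distr ?Z ?Z ?T)"
    by (rule nn_integral_distr[OF T, symmetric]) (use f in simp)
  also have "distr ?Z ?Z ?T = ?Z"
    by (rule distr_gauss_unitary_right[OF v])
  finally show ?thesis .
qed

text \<open>Integrate over the random unitary and over \<open>y\<close> in both orders. For almost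
  every unitary the average over \<open>y\<close> is at least \<open>\<tau>\<close>; for almost
  every \<open>y\<close> the average over unitaries is one constant \<open>q\<close>. The same
  \<open>q\<close> arises for Gaussian \<open>y\<close>, where the rotation has no effect and the
  value is the measure of \<open>D\<close>.\<close>

lemma emeasure_gauss_ge_if_unitary_averages_ge:
  assumes D: "D \<in> sets (gauss ({..<n} \<times> {..<r}))" and r: "r \<le> n"
    and inv: "\<And>y x. det (mat r r x) \<noteq> 0 \<Longrightarrow>
      restrict (mmult r y x) ({..<n} \<times> {..<r}) \<in> D \<longleftrightarrow> restrict y ({..<n} \<times> {..<r}) \<in> D"
    and N: "prob_space N" and sN: "sets N = sets (gauss ({..<n} \<times> {..<r}))"
    and full: "AE y in N. gramdet {..<n} r y \<noteq> 0"
    and ge: "\<And>v. unitary n v \<Longrightarrow> \<tau> \<le> (\<integral>\<^sup>+y. indicator D (restrict (mmult n v y) ({..<n} \<times> {..<r})) \<partial>N)"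
  shows "\<tau> \<le> emeasure (gauss ({..<n} \<times> {..<r})) D"
proof -
  let ?I = "{..<n} \<times> {..<r}" and ?Z = "gauss ({..<n} \<times> {..<n})"
  interpret N: prob_space N by (rule N)
  interpret Z: prob_space ?Z by (rule prob_space_gauss)
  interpret G: prob_space "gauss ?I" by (rule prob_space_gauss)
  let ?F = "\<lambda>z y. indicator D (restrict (mmult n (orthonormalise n z) y) ?I) :: ennreal"
  define q where "q = (\<integral>\<^sup>+z. ?F z delta \<partial>?Z)"
  \<comment> \<open>Stated for a general law \<open>M\<close> because it is applied both to
    \<open>N\<close> and to the Gaussian law.\<close>
  have Fub: "(\<integral>\<^sup>+z. (\<integral>\<^sup>+y. ?F z y \<partial>M) \<partial>?Z) = q"
    if M: "prob_space M" and sM: "sets M = sets (gauss ?I)" and fM: "AE y in M. gramdet {..<n} r y \<noteq> 0" for M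
  proof -
    interpret M: prob_space M by (rule M)
    interpret P: pair_sigma_finite M ?Z ..
    have sM': "sets M = sets (PiM ?I (\<lambda>_. borel))" using sM by (simp add: sets_gauss)
    have "(\<lambda>w. restrict (mmult n (orthonormalise n (snd w)) (fst w)) ?I) \<in> M \<Otimes>\<^sub>M ?Z \<rightarrow>\<^sub>M PiM ?I (\<lambda>_. borel)"
    proof (rule measurable_mmult)
      show "(\<lambda>w. orthonormalise n (snd w) (i, j)) \<in> borel_measurable (M \<Otimes>\<^sub>M ?Z)" if "i < n" "j < n" for i j
        using borel_measurable_orthonormalise[OF that] unfolding measurable_cong_sets[OF sets_gauss[symmetric] refl]
        by (rule measurable_compose[OF measurable_snd])
      show "(\<lambda>w. fst w (j, k)) \<in> borel_measurable (M \<Otimes>\<^sub>M ?Z)" if "j < n" "k < r" for j k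
      proof (rule measurable_compose[OF measurable_fst])
        show "(\<lambda>y. y (j, k)) \<in> borel_measurable M"
          unfolding measurable_cong_sets[OF sM' refl] using that by (intro measurable_component_singleton) auto
      qed
    qed
    then have m: "(\<lambda>(y, z). ?F z y) \<in> borel_measurable (M \<Otimes>\<^sub>M ?Z)"
      using D unfolding sets_gauss by (simp add: case_prod_beta) measurable
    have "(\<integral>\<^sup>+z. (\<integral>\<^sup>+y. ?F z y \<partial>M) \<partial>?Z) = (\<integral>\<^sup>+y. (\<integral>\<^sup>+z. ?F z y \<partial>?Z) \<partial>M)"
      using P.Fubini'[OF m] by simp
    also have "\<dots> = (\<integral>\<^sup>+y. q \<partial>M)"
      unfolding q_def by (rule nn_integral_cong_AE, use fM in eventually_elim) (rule orthonormalise_law_const[OF D r inv])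
    finally show ?thesis by (simp add: M.emeasure_space_1)
  qed
  have uni: "AE z in ?Z. unitary n (orthonormalise n z)"
    using AE_gramdet_nonzero[of "{..<n}" n] by (auto elim: eventually_mono intro: unitary_orthonormalise)
  have "\<tau> = (\<integral>\<^sup>+z. \<tau> \<partial>?Z)" by (simp add: Z.emeasure_space_1)
  also have "\<dots> \<le> (\<integral>\<^sup>+z. (\<integral>\<^sup>+y. ?F z y \<partial>N) \<partial>?Z)"
    by (rule nn_integral_mono_AE, use uni in eventually_elim) (rule ge)
  also have "\<dots> = q" by (rule Fub[OF N sN full])
  also have "\<dots> = (\<integral>\<^sup>+z. (\<integral>\<^sup>+y. ?F z y \<partial>gauss ?I) \<partial>?Z)"
    using r by (intro Fub[symmetric] prob_space_gauss refl AE_gramdet_nonzero) auto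
  also have "\<dots> = (\<integral>\<^sup>+z. emeasure (gauss ?I) D \<partial>?Z)"
  proof (rule nn_integral_cong_AE, use uni in eventually_elim)
    fix z assume u: "unitary n (orthonormalise n z)"
    let ?T = "\<lambda>y. restrict (mmult n (orthonormalise n z) y) ?I"
    have T: "?T \<in> gauss ?I \<rightarrow>\<^sub>M gauss ?I"
      unfolding measurable_cong_sets[OF sets_gauss sets_gauss]
      by (intro measurable_mmult) (auto intro!: measurable_component_singleton)
    have "(\<integral>\<^sup>+y. indicator D (?T y) \<partial>gauss ?I) = (\<integral>\<^sup>+y. indicator D y \<partial>distr (gauss ?I) (gauss ?I) ?T)"
      by (rule nn_integral_distr[OF T, symmetric]) (use D in simp)
    also have "\<dots> = emeasure (gauss ?I) D"
      using D by (simp add: distr_gauss_unitary_left[OF u])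
    finally show "(\<integral>\<^sup>+y. ?F z y \<partial>gauss ?I) = emeasure (gauss ?I) D" .
  qed
  also have "\<dots> = emeasure (gauss ?I) D" by (simp add: Z.emeasure_space_1)
  finally show ?thesis .
qed

subsection \<open>The coding theorem\<close>

text \<open>The Gaussian density is positive everywhere, so Gaussian and Lebesgue null sets agree,
  and the latter are translation invariant.\<close>

lemma AE_gauss_translate:
  fixes w :: "'i \<Rightarrow> complex"
  assumes I: "finite I" and P: "{z \<in> space (gauss I). P z} \<in> sets (gauss I)" and ae: "AE z in gauss I. P z"
  shows "AE z in gauss I. P (\<lambda>i\<in>I. z i + w i)"
proof -
  let ?L = "PiM I (\<lambda>_. lborel :: complex measure)"
  let ?T = "\<lambda>z. \<lambda>i\<in>I. z i + w i"
  have sL[measurable_cong]: "sets ?L = sets (PiM I (\<lambda>_. borel :: complex measure))"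
    by (intro sets_PiM_cong) auto
  have pos: "(\<Prod>i\<in>I. ennreal (exp (- (cmod (z i))\<^sup>2) / pi)) > 0" for z
    using I by (simp add: prod_ennreal prod_pos)
  have AE_iff: "(AE z in gauss I. Q z) \<longleftrightarrow> (AE z in ?L. Q z)" for Q
    unfolding gauss_density[OF I] by (subst AE_density) (use pos in auto)
  have T: "?T \<in> ?L \<rightarrow>\<^sub>M ?L" by measurable
  have P': "{z \<in> space ?L. P z} \<in> sets ?L"
    using P unfolding sets_gauss sL by (simp add: space_gauss space_PiM)
  have "AE z in distr ?L ?L ?T. P z"
    using ae by (simp only: AE_iff distr_translate_PiM_lborel[OF I])
  then show ?thesis
    unfolding AE_iff by (subst (asm) AE_distr_iff[OF T P'])
qed

text \<open>The bound \<open>\<gamma>\<close> on sin^2 of the angles between the output and the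
  first \<open>s\<close> columns of \<open>v\<close>, multiplied out. For an output of deficient
  rank both determinants are 0 and the test accepts.\<close>

definition small_angle :: "nat \<Rightarrow> nat \<Rightarrow> nat \<Rightarrow> real \<Rightarrow> (nat \<times> nat \<Rightarrow> complex) \<Rightarrow> (nat \<times> nat \<Rightarrow> complex) \<Rightarrow> bool" where
  "small_angle n r s \<gamma> v y \<longleftrightarrow>
     Re (gramdet {s..<n} r (mmult n (ctranspose v) y)) \<le> \<gamma> * Re (gramdet {..<n} r (mmult n (ctranspose v) y))"

definition decoding_set :: "nat \<Rightarrow> nat \<Rightarrow> nat \<Rightarrow> real \<Rightarrow> (nat \<times> nat \<Rightarrow> complex) \<Rightarrow> (nat \<times> nat \<Rightarrow> complex) set" where
  "decoding_set n r s \<gamma> v = {y \<in> space (gauss ({..<n} \<times> {..<r})). small_angle n r s \<gamma> v y}"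

lemma small_angle_cong:
  assumes "\<And>i k. i < n \<Longrightarrow> k < r \<Longrightarrow> y (i, k) = y' (i, k)"
  shows "small_angle n r s \<gamma> v y \<longleftrightarrow> small_angle n r s \<gamma> v y'"
proof -
  have "gramdet J r (mmult n (ctranspose v) y) = gramdet J r (mmult n (ctranspose v) y')" for J
    using assms by (intro gramdet_cong mmult_cong) auto
  then show ?thesis by (simp add: small_angle_def)
qed

lemma restrict_mem_decoding_set:
  "restrict y ({..<n} \<times> {..<r}) \<in> decoding_set n r s \<gamma> v \<longleftrightarrow> small_angle n r s \<gamma> v y"
  using small_angle_cong[of n r "restrict y ({..<n} \<times> {..<r})" y s \<gamma> v]
  by (simp add: decoding_set_def space_gauss)

text \<open>Both determinants acquire the same positive factor: the test sees only the column
  span.\<close>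

lemma small_angle_mmult_right:
  assumes "det (mat r r x) \<noteq> 0"
  shows "small_angle n r s \<gamma> v (mmult r y x) \<longleftrightarrow> small_angle n r s \<gamma> v y"
proof -
  have g: "Re (gramdet J r (mmult n (ctranspose v) (mmult r y x))) =
      (cmod (det (mat r r x)))\<^sup>2 * Re (gramdet J r (mmult n (ctranspose v) y))" for J
    unfolding mmult_assoc[of n "ctranspose v"] gramdet_mmult by (simp del: of_real_power)
  have "0 < (cmod (det (mat r r x)))\<^sup>2" using assms by simp
  then show ?thesis
    unfolding small_angle_def g mult.left_commute[of \<gamma>] by (rule mult_le_cancel_left_pos)
qed

text \<open>Reduces the test of every codeword on its own output to the test of the unrotated
  one.\<close>

lemma small_angle_mmult_left:
  assumes "unitary n v"
  shows "small_angle n r s \<gamma> v (mmult n v y) \<longleftrightarrow> small_angle n r s \<gamma> delta y"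
proof -
  have "gramdet J r (mmult n (ctranspose v) (mmult n v y)) = gramdet J r (mmult n (ctranspose delta) y)" if "J \<subseteq> {..<n}" for J
  proof (rule gramdet_cong)
    fix i k assume "i \<in> J"
    then have "i < n" using that by auto
    moreover have "ctranspose delta = delta" by (simp add: ctranspose_def delta_def fun_eq_iff)
    ultimately show "mmult n (ctranspose v) (mmult n v y) (i, k) = mmult n (ctranspose delta) y (i, k)"
      by (simp add: unitary_cancel[OF assms] mmult_delta_left)
  qed
  from this[of "{s..<n}"] this[of "{..<n}"] show ?thesis
    by (simp add: small_angle_def subset_eq)
qed

lemma small_angle_delta:
  "small_angle n r s \<gamma> delta y \<longleftrightarrow> Re (gramdet {s..<n} r y) \<le> \<gamma> * Re (gramdet {..<n} r y)"
proof -
  have "ctranspose delta = delta" by (simp add: ctranspose_def delta_def fun_eq_iff)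
  then have "gramdet J r (mmult n (ctranspose delta) y) = gramdet J r y" if "J \<subseteq> {..<n}" for J
    using that by (intro gramdet_cong) (auto simp: mmult_delta_left)
  from this[of "{s..<n}"] this[of "{..<n}"] show ?thesis
    by (simp add: small_angle_def subset_eq)
qed

lemma sets_decoding_set: "decoding_set n r s \<gamma> v \<in> sets (gauss ({..<n} \<times> {..<r}))"
proof -
  have [measurable]: "(\<lambda>y. gramdet J r (mmult n (ctranspose v) y)) \<in> borel_measurable (gauss ({..<n} \<times> {..<r}))" for J
    unfolding measurable_cong_sets[OF sets_gauss refl]
    by (intro borel_measurable_gramdet, unfold mmult_apply, intro borel_measurable_sum borel_measurable_times
        borel_measurable_const measurable_component_singleton) auto
  show ?thesis
    unfolding decoding_set_def small_angle_def by measurable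
qed

lemma emeasure_gauss_decoding_set:
  assumes v: "unitary n v" and s: "s + r \<le> n"
  shows "emeasure (gauss ({..<n} \<times> {..<r})) (decoding_set n r s \<gamma> v) = ennreal (prod_beta_prob n s r \<gamma>)"
proof -
  let ?G = "gauss ({..<n} \<times> {..<r})" and ?D = "decoding_set n r s \<gamma>"
  let ?T = "\<lambda>z. restrict (mmult n v z) ({..<n} \<times> {..<r})"
  have T: "?T \<in> ?G \<rightarrow>\<^sub>M ?G"
    unfolding measurable_cong_sets[OF sets_gauss sets_gauss]
    by (intro measurable_mmult) (auto intro!: measurable_component_singleton)
  have "emeasure ?G (?D v) = emeasure (distr ?G ?G ?T) (?D v)"
    by (simp add: distr_gauss_unitary_left[OF v])
  also have "\<dots> = emeasure ?G (?T -` ?D v \<inter> space ?G)"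
    by (rule emeasure_distr[OF T sets_decoding_set])
  also have "?T -` ?D v \<inter> space ?G = ?D delta"
    by (auto simp: restrict_mem_decoding_set small_angle_mmult_left[OF v]) (auto simp: decoding_set_def)
  also have "emeasure ?G (?D delta) = (\<integral>\<^sup>+y. indicator (?D delta) y \<partial>?G)"
    by (simp add: sets_decoding_set)
  also have "\<dots> = (\<integral>\<^sup>+y. indicator {..\<gamma>} (Re (gramdet {s..<n} r y) / Re (gramdet {..<n} r y)) \<partial>?G)"
  proof (rule nn_integral_cong_AE)
    have "AE y in ?G. gramdet {..<n} r y \<noteq> 0"
      using s by (intro AE_gramdet_nonzero) auto
    then show "AE y in ?G. indicator (?D delta) y =
        (indicator {..\<gamma>} (Re (gramdet {s..<n} r y) / Re (gramdet {..<n} r y)) :: ennreal)"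
      using AE_space
    proof eventually_elim
      fix y assume y: "gramdet {..<n} r y \<noteq> 0" "y \<in> space ?G"
      obtain x where "x \<ge> 0" "gramdet {..<n} r y = complex_of_real x"
        using gramdet_nonneg[of "{..<n}" r y] by auto
      then have "0 < Re (gramdet {..<n} r y)" using y by simp
      then show "indicator (?D delta) y =
        (indicator {..\<gamma>} (Re (gramdet {s..<n} r y) / Re (gramdet {..<n} r y)) :: ennreal)"
        using y(2) by (simp add: indicator_def decoding_set_def small_angle_delta pos_divide_le_eq)
    qed
  qed
  \<comment> \<open>The ratio law with offset 0: \<open>n - s\<close> of the \<open>n\<close> rows
    remain, and \<open>s + r \<le> n\<close> makes them at least \<open>r\<close>.\<close>
  also have "\<dots> = (\<integral>\<^sup>+b. indicator {..\<gamma>} (\<Prod>j\<in>{0+1..0+r}. b j)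
       \<partial>PiM {0+1..0+r} (\<lambda>j. beta_measure (real (card {s..<n} + 0 - j + 1)) (real (card {..<n} - card {s..<n}))))"
    using s by (intro nn_integral_gramdet_ratio) auto
  also have "\<dots> = (\<integral>\<^sup>+b. indicator {..\<gamma>} (\<Prod>j\<in>{1..r}. b j) \<partial>PiM {1..r} (\<lambda>j. beta_measure (real (n - s - j + 1)) (real s)))"
    using s by simp
  also have "\<dots> = ennreal (prod_beta_prob n s r \<gamma>)"
  proof -
    let ?P = "PiM {1..r} (\<lambda>j. beta_measure (real (n - s - j + 1)) (real s))"
    interpret P: prob_space ?P
      by (intro prob_space_PiM prob_space_beta_measure) simp
    have "(\<integral>\<^sup>+b. indicator {..\<gamma>} (\<Prod>j\<in>{1..r}. b j) \<partial>?P) = (\<integral>\<^sup>+b. indicator {b \<in> space ?P. (\<Prod>j\<in>{1..r}. b j) \<le> \<gamma>} b \<partial>?P)"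
      by (intro nn_integral_cong) (auto simp: indicator_def)
    also have "\<dots> = emeasure ?P {b \<in> space ?P. (\<Prod>j\<in>{1..r}. b j) \<le> \<gamma>}"
      by (rule nn_integral_indicator) measurable
    finally show ?thesis
      unfolding prod_beta_prob_def Let_def P.emeasure_eq_measure .
  qed
  finally show ?thesis .
qed

text \<open>The maximal coding argument: if no codeword could be added, every output law would give
  the union \<open>D\<close> of the decoding sets mass at least \<open>\<tau>\<close>; so would their average over all unitary
  rotations, under which \<open>D\<close> has the same mass as under the Gaussian law.\<close>

lemma codebook_exists:
  fixes N :: "(nat \<times> nat \<Rightarrow> complex) measure"
  assumes s: "s + r \<le> n"
    and N: "prob_space N" and sN: "sets N = sets (gauss ({..<n} \<times> {..<r}))"
    and full: "AE y in N. gramdet {..<n} r y \<noteq> 0"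
    and typical: "1 - \<epsilon> + \<tau> \<le> measure N (decoding_set n r s \<gamma> delta)"
    and k: "real (k - 1) * prod_beta_prob n s r \<gamma> < \<tau>" and \<tau>: "0 \<le> \<tau>"
  shows "\<exists>v. \<forall>j<k. unitary n (v j) \<and>
    1 - \<epsilon> \<le> measure N {y \<in> space N. small_angle n r s \<gamma> (v j) (mmult n (v j) y) \<and> (\<forall>i<j. \<not> small_angle n r s \<gamma> (v i) (mmult n (v j) y))}"
  using k
proof (induction k)
  case 0
  show ?case by simp
next
  case (Suc k)
  interpret N: prob_space N by (rule N)
  let ?G = "gauss ({..<n} \<times> {..<r})" and ?\<beta> = "prod_beta_prob n s r \<gamma>"
  let ?S = "small_angle n r s \<gamma>" and ?r = "\<lambda>y. restrict y ({..<n} \<times> {..<r})"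
  have \<beta>: "0 \<le> ?\<beta>" by (simp add: prod_beta_prob_def Let_def)
  have "real (k - 1) * ?\<beta> \<le> real k * ?\<beta>"
    using \<beta> by (intro mult_right_mono) auto
  then have "real (k - 1) * ?\<beta> < \<tau>" using Suc.prems by simp
  from Suc.IH[OF this] obtain v where v: "\<And>j. j < k \<Longrightarrow> unitary n (v j)"
    "\<And>j. j < k \<Longrightarrow> 1 - \<epsilon> \<le> measure N {y \<in> space N. ?S (v j) (mmult n (v j) y) \<and> (\<forall>i<j. \<not> ?S (v i) (mmult n (v j) y))}"
    by blast
  have T: "(\<lambda>y. ?r (mmult n u y)) \<in> N \<rightarrow>\<^sub>M ?G" for u
    unfolding measurable_cong_sets[OF sN refl] measurable_cong_sets[OF sets_gauss sets_gauss]
    by (intro measurable_mmult) (auto intro!: measurable_component_singleton)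
  have S[measurable]: "Measurable.pred N (\<lambda>y. ?S u (mmult n w y))" for u w
  proof -
    have "{y \<in> space N. ?r (mmult n w y) \<in> decoding_set n r s \<gamma> u} \<in> sets N"
      using measurable_sets[OF T sets_decoding_set, of w s \<gamma> u] by (simp add: vimage_def Int_def conj_commute)
    then show ?thesis by (simp add: restrict_mem_decoding_set pred_def)
  qed
  have "\<exists>u. unitary n u \<and> 1 - \<epsilon> \<le> measure N {y \<in> space N. ?S u (mmult n u y) \<and> (\<forall>i<k. \<not> ?S (v i) (mmult n u y))}"
  proof (rule ccontr)
    assume "\<not> ?thesis"
    then have less: "measure N {y \<in> space N. ?S u (mmult n u y) \<and> (\<forall>i<k. \<not> ?S (v i) (mmult n u y))} < 1 - \<epsilon>"
      if "unitary n u" for u using that by force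
    define D where "D = (\<Union>i<k. decoding_set n r s \<gamma> (v i))"
    have Dm: "D \<in> sets ?G" unfolding D_def using sets_decoding_set by auto
    have memD: "?r y \<in> D \<longleftrightarrow> (\<exists>i<k. ?S (v i) y)" for y
      by (auto simp: D_def restrict_mem_decoding_set)
    have "ennreal \<tau> \<le> emeasure ?G D"
    proof (rule emeasure_gauss_ge_if_unitary_averages_ge[OF Dm _ _ N sN full])
      show "r \<le> n" using s by simp
      show "?r (mmult r y x) \<in> D \<longleftrightarrow> ?r y \<in> D" if "det (mat r r x) \<noteq> 0" for y x
        unfolding memD small_angle_mmult_right[OF that] ..
      fix u assume u: "unitary n u"
      have eq: "{y \<in> space N. ?S u (mmult n u y)} = decoding_set n r s \<gamma> delta"
        using sets_eq_imp_space_eq[OF sN] by (auto simp: small_angle_mmult_left[OF u] decoding_set_def)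
      \<comment> \<open>The word \<open>u\<close> accepts its own output with probability at least
        \<open>1 - \<epsilon> + \<tau>\<close>, but less than \<open>1 - \<epsilon>\<close> of this
        avoids the earlier decoding sets; so these sets catch at least
        \<open>\<tau>\<close>.\<close>
      have "1 - \<epsilon> + \<tau> \<le> measure N {y \<in> space N. ?S u (mmult n u y)}"
        unfolding eq by (rule typical)
      also have "\<dots> \<le> measure N ({y \<in> space N. ?S u (mmult n u y) \<and> (\<forall>i<k. \<not> ?S (v i) (mmult n u y))} \<union>
          {y \<in> space N. \<exists>i<k. ?S (v i) (mmult n u y)})"
        by (intro N.finite_measure_mono) auto
      also have "\<dots> \<le> measure N {y \<in> space N. ?S u (mmult n u y) \<and> (\<forall>i<k. \<not> ?S (v i) (mmult n u y))} +
          measure N {y \<in> space N. \<exists>i<k. ?S (v i) (mmult n u y)}"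
        by (intro measure_Un_le) measurable
      finally have "\<tau> \<le> measure N {y \<in> space N. \<exists>i<k. ?S (v i) (mmult n u y)}"
        using less[OF u] by simp
      then have "ennreal \<tau> \<le> emeasure N {y \<in> space N. \<exists>i<k. ?S (v i) (mmult n u y)}"
        by (simp add: N.emeasure_eq_measure)
      also have "\<dots> = (\<integral>\<^sup>+y. indicator {y \<in> space N. \<exists>i<k. ?S (v i) (mmult n u y)} y \<partial>N)"
        by (rule nn_integral_indicator[symmetric]) measurable
      also have "\<dots> = (\<integral>\<^sup>+y. indicator D (?r (mmult n u y)) \<partial>N)"
        by (intro nn_integral_cong) (auto simp: indicator_def memD)
      finally show "ennreal \<tau> \<le> (\<integral>\<^sup>+y. indicator D (?r (mmult n u y)) \<partial>N)" .
    qed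
    also have "emeasure ?G D \<le> (\<Sum>i<k. emeasure ?G (decoding_set n r s \<gamma> (v i)))"
      unfolding D_def using sets_decoding_set by (intro emeasure_subadditive_finite) auto
    also have "\<dots> = (\<Sum>i<k. ennreal ?\<beta>)"
      using v(1) s by (intro sum.cong refl emeasure_gauss_decoding_set) auto
    also have "\<dots> = ennreal (real k * ?\<beta>)"
      using \<beta> by (simp add: ennreal_mult ennreal_of_nat_eq_real_of_nat)
    \<comment> \<open>The hypothesis for \<open>Suc k\<close> speaks of \<open>Suc k - 1 = k\<close>
      words, exactly those already chosen.\<close>
    finally have "\<tau> \<le> real k * ?\<beta>"
      using \<beta> \<tau> by (simp add: ennreal_le_iff)
    then show False using Suc.prems by simp
  qed
  then obtain u where u: "unitary n u"
    "1 - \<epsilon> \<le> measure N {y \<in> space N. ?S u (mmult n u y) \<and> (\<forall>i<k. \<not> ?S (v i) (mmult n u y))}" by blast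
  have "unitary n ((v(k := u)) j) \<and> 1 - \<epsilon> \<le> measure N {y \<in> space N. ?S ((v(k := u)) j) (mmult n ((v(k := u)) j) y) \<and>
      (\<forall>i<j. \<not> ?S ((v(k := u)) i) (mmult n ((v(k := u)) j) y))}" if "j < Suc k" for j
  proof (cases "j = k")
    case True
    have "{y \<in> space N. ?S ((v(k := u)) j) (mmult n ((v(k := u)) j) y) \<and>
      (\<forall>i<j. \<not> ?S ((v(k := u)) i) (mmult n ((v(k := u)) j) y))} = {y \<in> space N. ?S u (mmult n u y) \<and> (\<forall>i<k. \<not> ?S (v i) (mmult n u y))}"
      using True by auto
    then show ?thesis using u True by simp
  next
    case False
    then have "j < k" using that by simp
    then have "{y \<in> space N. ?S ((v(k := u)) j) (mmult n ((v(k := u)) j) y) \<and>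
      (\<forall>i<j. \<not> ?S ((v(k := u)) i) (mmult n ((v(k := u)) j) y))} =
      {y \<in> space N. ?S (v j) (mmult n (v j) y) \<and> (\<forall>i<j. \<not> ?S (v i) (mmult n (v j) y))}"
      by auto
    then show ?thesis using v \<open>j < k\<close> by simp
  qed
  then show ?case by blast
qed

section \<open>The channel output: rotation and full rank\<close>

lemma channel_rotate:
  fixes h :: "nat \<times> nat \<Rightarrow> complex" and X Y :: "'w \<Rightarrow> nat \<times> nat \<Rightarrow> complex"
  assumes X: "X \<in> M \<rightarrow>\<^sub>M PiM K (\<lambda>_. borel)" and Y: "Y \<in> M \<rightarrow>\<^sub>M gauss ({..<n} \<times> {..<r})"
    and joint: "distr M (PiM K (\<lambda>_. borel) \<Otimes>\<^sub>M gauss ({..<n} \<times> {..<r})) (\<lambda>\<omega>. (X \<omega>, Y \<omega>)) =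
      distr M (PiM K (\<lambda>_. borel)) X \<Otimes>\<^sub>M gauss ({..<n} \<times> {..<r})"
    and M: "prob_space M"
    and f: "\<And>i k. i < n \<Longrightarrow> k < r \<Longrightarrow> (\<lambda>x. f x (i, k)) \<in> borel_measurable (PiM K (\<lambda>_. borel))"
    and v: "unitary n v" and A: "A \<in> sets (gauss ({..<n} \<times> {..<r}))"
  shows "emeasure M {\<omega> \<in> space M. (\<lambda>p\<in>{..<n} \<times> {..<r}. mmult n v (f (X \<omega>)) p + Y \<omega> p) \<in> A} =
    emeasure M {\<omega> \<in> space M. restrict (mmult n v (\<lambda>p\<in>{..<n} \<times> {..<r}. f (X \<omega>) p + Y \<omega> p)) ({..<n} \<times> {..<r}) \<in> A}"
proof -
  let ?I = "{..<n} \<times> {..<r}"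
  let ?G = "gauss ?I" and ?K = "PiM K (\<lambda>_. borel :: complex measure)"
  let ?\<mu> = "distr M ?K X"
  interpret M: prob_space M by (rule M)
  interpret \<mu>: prob_space ?\<mu> by (rule M.prob_space_distr[OF X])
  interpret G: prob_space ?G by (rule prob_space_gauss)
  have XY: "(\<lambda>\<omega>. (X \<omega>, Y \<omega>)) \<in> M \<rightarrow>\<^sub>M ?K \<Otimes>\<^sub>M ?G" using X Y by measurable
  \<comment> \<open>The product form of the joint law lets the fading \<open>x\<close> be fixed
    before the noise is averaged; both events of the claim have this shape.\<close>
  have law: "emeasure M {\<omega> \<in> space M. \<phi> (X \<omega>) (Y \<omega>) \<in> A} = (\<integral>\<^sup>+x. (\<integral>\<^sup>+y. indicator A (\<phi> x y) \<partial>?G) \<partial>?\<mu>)"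
    if \<phi>: "(\<lambda>(x, y). \<phi> x y) \<in> ?K \<Otimes>\<^sub>M ?G \<rightarrow>\<^sub>M ?G" for \<phi>
  proof -
    have ind: "(\<lambda>w. indicator A (\<phi> (fst w) (snd w)) :: ennreal) \<in> borel_measurable (?K \<Otimes>\<^sub>M ?G)"
      using measurable_compose[OF \<phi>, of "indicator A :: _ \<Rightarrow> ennreal"] A by (simp add: case_prod_beta)
    have sets: "{\<omega> \<in> space M. \<phi> (X \<omega>) (Y \<omega>) \<in> A} \<in> sets M"
      using measurable_sets[OF measurable_compose[OF XY \<phi>] A] by (simp add: vimage_def Int_def conj_commute)
    have "emeasure M {\<omega> \<in> space M. \<phi> (X \<omega>) (Y \<omega>) \<in> A} = (\<integral>\<^sup>+\<omega>. indicator {\<omega> \<in> space M. \<phi> (X \<omega>) (Y \<omega>) \<in> A} \<omega> \<partial>M)"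
      by (rule nn_integral_indicator[symmetric]) (rule sets)
    also have "\<dots> = (\<integral>\<^sup>+\<omega>. (\<lambda>w. indicator A (\<phi> (fst w) (snd w))) (X \<omega>, Y \<omega>) \<partial>M)"
      by (intro nn_integral_cong) (auto simp: indicator_def)
    also have "\<dots> = (\<integral>\<^sup>+w. indicator A (\<phi> (fst w) (snd w)) \<partial>distr M (?K \<Otimes>\<^sub>M ?G) (\<lambda>\<omega>. (X \<omega>, Y \<omega>)))"
      by (rule nn_integral_distr[OF XY, symmetric]) (use ind in simp)
    also have "\<dots> = (\<integral>\<^sup>+x. (\<integral>\<^sup>+y. indicator A (\<phi> x y) \<partial>?G) \<partial>?\<mu>)"
      unfolding joint by (subst G.nn_integral_fst[symmetric]) (use ind in \<open>simp_all add: cong: measurable_cong_sets\<close>)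
    finally show ?thesis .
  qed
  have sG: "sets ?G = sets (PiM ?I (\<lambda>_. borel))" by (rule sets_gauss)
  have fm: "(\<lambda>w. f (fst w) (i, k)) \<in> borel_measurable (?K \<Otimes>\<^sub>M ?G)" if "i < n" "k < r" for i k
    by (rule measurable_compose[OF measurable_fst f[OF that]])
  have ym: "(\<lambda>w. snd w (i, k)) \<in> borel_measurable (?K \<Otimes>\<^sub>M ?G)" if "i < n" "k < r" for i k
  proof (rule measurable_compose[OF measurable_snd])
    show "(\<lambda>y. y (i, k)) \<in> borel_measurable ?G"
      unfolding measurable_cong_sets[OF sG refl] using that by (intro measurable_component_singleton) auto
  qed
  have fmm: "(\<lambda>w. mmult n v (f (fst w)) (i, k)) \<in> borel_measurable (?K \<Otimes>\<^sub>M ?G)" if "i < n" "k < r" for i k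
    unfolding mmult_apply using that by (intro borel_measurable_sum borel_measurable_times borel_measurable_const fm) auto
  have \<phi>1: "(\<lambda>(x, y). \<lambda>p\<in>?I. mmult n v (f x) p + y p) \<in> ?K \<Otimes>\<^sub>M ?G \<rightarrow>\<^sub>M ?G"
    unfolding case_prod_beta measurable_cong_sets[OF refl sG]
    by (intro measurable_restrict borel_measurable_add) (auto intro: fmm ym)
  have sum: "(\<lambda>w. \<lambda>p\<in>?I. f (fst w) p + snd w p) \<in> ?K \<Otimes>\<^sub>M ?G \<rightarrow>\<^sub>M PiM ?I (\<lambda>_. borel)"
    by (intro measurable_restrict borel_measurable_add) (auto intro: fm ym)
  have rot: "(\<lambda>y. restrict (mmult n v y) ?I) \<in> PiM ?I (\<lambda>_. borel) \<rightarrow>\<^sub>M PiM ?I (\<lambda>_. borel)"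
    by (intro measurable_mmult) (auto intro!: measurable_component_singleton)
  have \<phi>2: "(\<lambda>(x, y). restrict (mmult n v (\<lambda>p\<in>?I. f x p + y p)) ?I) \<in> ?K \<Otimes>\<^sub>M ?G \<rightarrow>\<^sub>M ?G"
    using measurable_compose[OF sum rot] by (simp add: case_prod_beta measurable_cong_sets[OF refl sG])
  have rot': "(\<lambda>y. restrict (mmult n v y) ?I) \<in> ?G \<rightarrow>\<^sub>M ?G"
    using rot by (simp add: measurable_cong_sets[OF sG sG])
  \<comment> \<open>For fixed fading the noise is replaced by its rotated copy, which has the same
    law, and \<open>v\<close> is factored out of the sum.\<close>
  have "(\<integral>\<^sup>+y. indicator A (\<lambda>p\<in>?I. mmult n v (f x) p + y p) \<partial>?G) =
        (\<integral>\<^sup>+y. indicator A (restrict (mmult n v (\<lambda>p\<in>?I. f x p + y p)) ?I) \<partial>?G)" for x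
  proof -
    let ?F = "\<lambda>y. indicator A (\<lambda>p\<in>?I. mmult n v (f x) p + y p) :: ennreal"
    have "(\<lambda>y. \<lambda>p\<in>?I. mmult n v (f x) p + y p) \<in> ?G \<rightarrow>\<^sub>M ?G"
      unfolding measurable_cong_sets[OF sG sG]
      by (intro measurable_restrict borel_measurable_add) (auto intro!: measurable_component_singleton)
    then have F: "?F \<in> borel_measurable ?G" using A by measurable
    have "(\<integral>\<^sup>+y. ?F y \<partial>?G) = (\<integral>\<^sup>+y. ?F y \<partial>distr ?G ?G (\<lambda>y. restrict (mmult n v y) ?I))"
      by (simp add: distr_gauss_unitary_left[OF v])
    also have "\<dots> = (\<integral>\<^sup>+y. ?F (restrict (mmult n v y) ?I) \<partial>?G)"
      by (rule nn_integral_distr[OF rot']) (use F in simp)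
    also have "\<dots> = (\<integral>\<^sup>+y. indicator A (restrict (mmult n v (\<lambda>p\<in>?I. f x p + y p)) ?I) \<partial>?G)"
    proof (intro nn_integral_cong arg_cong[where f="indicator A"] restrict_ext)
      fix y p assume p: "p \<in> ?I"
      then obtain i k where ik: "p = (i, k)" "i < n" "k < r" by auto
      have "mmult n v (\<lambda>p\<in>?I. f x p + y p) p = mmult n v (\<lambda>p. f x p + y p) p"
        unfolding ik(1) using ik by (intro mmult_cong) auto
      then show "mmult n v (f x) p + restrict (mmult n v y) ?I p = mmult n v (\<lambda>p\<in>?I. f x p + y p) p"
        using p by (simp add: mmult_add_left)
    qed
    finally show ?thesis .
  qed
  then show ?thesis
    using law[OF \<phi>1] law[OF \<phi>2] by simp
qed

text \<open>Given the fading, the output is a translate of Gaussian noise, which has the same null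
  sets as the noise itself.\<close>

lemma AE_channel_full_rank:
  fixes X Y :: "'w \<Rightarrow> nat \<times> nat \<Rightarrow> complex"
  assumes X: "X \<in> M \<rightarrow>\<^sub>M PiM K (\<lambda>_. borel)" and Y: "Y \<in> M \<rightarrow>\<^sub>M gauss ({..<n} \<times> {..<r})"
    and joint: "distr M (PiM K (\<lambda>_. borel) \<Otimes>\<^sub>M gauss ({..<n} \<times> {..<r})) (\<lambda>\<omega>. (X \<omega>, Y \<omega>)) =
      distr M (PiM K (\<lambda>_. borel)) X \<Otimes>\<^sub>M gauss ({..<n} \<times> {..<r})"
    and M: "prob_space M" and r: "r \<le> n"
    and f: "\<And>i k. i < n \<Longrightarrow> k < r \<Longrightarrow> (\<lambda>x. f x (i, k)) \<in> borel_measurable (PiM K (\<lambda>_. borel))"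
  shows "AE \<omega> in M. gramdet {..<n} r (\<lambda>p\<in>{..<n} \<times> {..<r}. f (X \<omega>) p + Y \<omega> p) \<noteq> 0"
proof -
  let ?I = "{..<n} \<times> {..<r}"
  let ?G = "gauss ?I" and ?K = "PiM K (\<lambda>_. borel :: complex measure)"
  let ?\<mu> = "distr M ?K X"
  interpret M: prob_space M by (rule M)
  interpret \<mu>: prob_space ?\<mu> by (rule M.prob_space_distr[OF X])
  interpret G: prob_space ?G by (rule prob_space_gauss)
  interpret P: pair_sigma_finite ?\<mu> ?G ..
  have XY: "(\<lambda>\<omega>. (X \<omega>, Y \<omega>)) \<in> M \<rightarrow>\<^sub>M ?K \<Otimes>\<^sub>M ?G" using X Y by measurable
  have sG: "sets ?G = sets (PiM ?I (\<lambda>_. borel))" by (rule sets_gauss)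
  let ?g = "\<lambda>w. gramdet {..<n} r (\<lambda>p\<in>?I. f (fst w) p + snd w p)"
  have "(\<lambda>w. f (fst w) (i, k)) \<in> borel_measurable (?K \<Otimes>\<^sub>M ?G)" if "i < n" "k < r" for i k
    by (rule measurable_compose[OF measurable_fst f[OF that]])
  moreover have "(\<lambda>w. snd w (i, k)) \<in> borel_measurable (?K \<Otimes>\<^sub>M ?G)" if "i < n" "k < r" for i k
  proof (rule measurable_compose[OF measurable_snd])
    show "(\<lambda>y. y (i, k)) \<in> borel_measurable ?G"
      unfolding measurable_cong_sets[OF sG refl] using that by (intro measurable_component_singleton) auto
  qed
  ultimately have gm: "?g \<in> borel_measurable (?K \<Otimes>\<^sub>M ?G)"
    by (intro borel_measurable_gramdet) auto
  have P: "{w \<in> space (?K \<Otimes>\<^sub>M ?G). ?g w \<noteq> 0} \<in> sets (?K \<Otimes>\<^sub>M ?G)"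
    using gm by measurable
  have "{w \<in> space (?\<mu> \<Otimes>\<^sub>M ?G). ?g w \<noteq> 0} \<in> sets (?\<mu> \<Otimes>\<^sub>M ?G)"
    using P by (simp add: space_pair_measure cong: sets_pair_measure_cong)
  moreover have "AE y in ?G. ?g (x, y) \<noteq> 0" for x
  proof -
    have g0: "AE z in ?G. gramdet {..<n} r z \<noteq> 0"
      using r by (intro AE_gramdet_nonzero) auto
    have "gramdet {..<n} r \<in> borel_measurable ?G" by (rule measurable_gramdet_gauss) auto
    then have "{z \<in> space ?G. gramdet {..<n} r z \<noteq> 0} \<in> sets ?G" by measurable
    from AE_gauss_translate[OF _ this g0, of "f x"] show ?thesis by (simp add: add.commute)
  qed
  ultimately have "AE w in ?\<mu> \<Otimes>\<^sub>M ?G. ?g w \<noteq> 0"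
    by (intro P.AE_pair_measure) auto
  then have "AE w in distr M (?K \<Otimes>\<^sub>M ?G) (\<lambda>\<omega>. (X \<omega>, Y \<omega>)). ?g w \<noteq> 0"
    unfolding joint .
  then show ?thesis
    by (subst (asm) AE_distr_iff[OF XY P]) simp
qed

lemma mat_adjoint_index:
  fixes U :: "complex mat"
  assumes "i < dim_row U" "m < dim_col U"
  shows "mat_adjoint U $$ (m, i) = cnj (U $$ (i, m))"
  using assms by (simp add: mat_adjoint_def mat_of_rows_index)

text \<open>A unitary factor preserves column norms and \<open>Ink n s\<close> only appends zero
  rows, so the squared norm is n tr (U^H U) = n tr Q.\<close>

lemma frob_sq_codeword:
  assumes v: "unitary n v" and U: "U \<in> carrier_mat s t" "mat_adjoint U * U = Q" and s: "s \<le> n"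
    and Q: "Re (cmat_trace Q) \<le> \<rho>"
  shows "frob_sq (mat n t (mmult n v (entries (complex_of_real (sqrt (real n)) \<cdot>\<^sub>m (Ink n s * U))))) \<le> real n * \<rho>"
proof -
  let ?b = "entries (complex_of_real (sqrt (real n)) \<cdot>\<^sub>m (Ink n s * U))"
  have b: "?b (i, m) = (if i < s then of_real (sqrt (real n)) * U $$ (i, m) else 0)" if "i < n" "m < t" for i m
  proof -
    have "(Ink n s * U) $$ (i, m) = (\<Sum>j<s. Ink n s $$ (i, j) * U $$ (j, m))"
      using that U by (simp add: scalar_prod_def atLeast0LessThan Ink_def)
    also have "\<dots> = (\<Sum>j<s. if i = j then U $$ (i, m) else 0)"
      using that by (intro sum.cong) (auto simp: Ink_def)
    finally show ?thesis using that U by (simp add: Ink_def)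
  qed
  have "frob_sq (mat n t (mmult n v ?b)) = (\<Sum>m<t. \<Sum>i<n. (cmod (mmult n v ?b (i, m)))\<^sup>2)"
    unfolding frob_sq_def by (simp, rule sum.swap)
  also have "\<dots> = (\<Sum>m<t. \<Sum>i<n. (cmod (?b (i, m)))\<^sup>2)"
    by (intro sum.cong refl sum_cmod_sq_eqI unitary_inner[OF v])
  also have "\<dots> = (\<Sum>m<t. real n * (\<Sum>i<s. (cmod (U $$ (i, m)))\<^sup>2))"
  proof (intro sum.cong refl)
    fix m assume m: "m \<in> {..<t}"
    have "(\<Sum>i<n. (cmod (?b (i, m)))\<^sup>2) = (\<Sum>i<s. real n * (cmod (U $$ (i, m)))\<^sup>2)"
      using m s b by (intro sum.mono_neutral_cong_right) (auto simp: norm_mult power_mult_distrib)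
    then show "(\<Sum>i<n. (cmod (?b (i, m)))\<^sup>2) = real n * (\<Sum>i<s. (cmod (U $$ (i, m)))\<^sup>2)"
      by (simp add: sum_distrib_left)
  qed
  also have "\<dots> = real n * Re (cmat_trace Q)"
  proof -
    have "Q $$ (m, m) = of_real (\<Sum>i<s. (cmod (U $$ (i, m)))\<^sup>2)" if m: "m < t" for m
    proof -
      have "mat_adjoint U \<in> carrier_mat t s" using U(1) by (auto simp: mat_adjoint_def)
      then have "Q $$ (m, m) = (\<Sum>i<s. mat_adjoint U $$ (m, i) * U $$ (i, m))"
        using m U by (auto simp: scalar_prod_def atLeast0LessThan)
      also have "\<dots> = (\<Sum>i<s. cnj (U $$ (i, m)) * U $$ (i, m))"
        using m U by (intro sum.cong) (auto simp: mat_adjoint_index)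
      finally show ?thesis by (simp only: cnj_mult_self of_real_sum)
    qed
    moreover have "dim_row Q = t" using U by (auto simp: mat_adjoint_def)
    ultimately have "cmat_trace Q = of_real (\<Sum>m<t. \<Sum>i<s. (cmod (U $$ (i, m)))\<^sup>2)"
      by (simp add: cmat_trace_def)
    then show ?thesis by (simp add: sum_distrib_left)
  qed
  also have "\<dots> \<le> real n * \<rho>"
    using Q by (rule mult_left_mono) simp
  finally show ?thesis .
qed

theorem theorem4:
  fixes \<Omega> :: "'w measure" and H W :: "'w \<Rightarrow> complex mat"
    and t r n ts :: nat and \<rho> \<epsilon> \<tau> \<gamma> :: real and Qs U :: "complex mat"
  assumes prob: "prob_space \<Omega>"
    and t: "1 \<le> t" and r: "1 \<le> r" and rho: "0 < \<rho>"
    and H_dim: "\<forall>\<omega>\<in>space \<Omega>. H \<omega> \<in> carrier_mat t r"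
    and H_meas: "\<forall>i<t. \<forall>j<r. (\<lambda>\<omega>. H \<omega> $$ (i, j)) \<in> borel_measurable \<Omega>"
    and W_dim: "\<forall>\<omega>\<in>space \<Omega>. W \<omega> \<in> carrier_mat n r"
    and W_gauss: "\<forall>i<n. \<forall>k<r. distributed \<Omega> lborel (\<lambda>\<omega>. W \<omega> $$ (i, k))
                        (\<lambda>z. ennreal (exp (- (cmod z)\<^sup>2) / pi))"
    and W_indep: "prob_space.indep_vars \<Omega> (\<lambda>_. borel) (\<lambda>p \<omega>. W \<omega> $$ p) ({..<n} \<times> {..<r})"
    and HW_indep: "prob_space.indep_var \<Omega>
          (PiM ({..<t} \<times> {..<r}) (\<lambda>_. borel)) (\<lambda>\<omega>. \<lambda>p\<in>{..<t} \<times> {..<r}. H \<omega> $$ p)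
          (PiM ({..<n} \<times> {..<r}) (\<lambda>_. borel)) (\<lambda>\<omega>. \<lambda>p\<in>{..<n} \<times> {..<r}. W \<omega> $$ p)"
    and eps: "0 < \<epsilon>" "\<epsilon> < 1"
    and Qs: "Qs \<in> input_set t \<rho>"
    and attained: "Inf ((\<lambda>Q. measure \<Omega> {\<omega> \<in> space \<Omega>. logdet_io Q (H \<omega>) \<le> C_no \<Omega> H t \<rho> \<epsilon>})
                          ` input_set t \<rho>)
                 = measure \<Omega> {\<omega> \<in> space \<Omega>. logdet_io Qs (H \<omega>) \<le> C_no \<Omega> H t \<rho> \<epsilon>}"
    and ts: "ts = vec_space.rank t Qs"
    and U: "U \<in> carrier_mat ts t" "mat_adjoint U * U = Qs"
    and n: "ts + r \<le> n"
    and tau: "0 < \<tau>" "\<tau> < \<epsilon>"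
    and gam: "0 \<le> \<gamma>" "\<gamma> \<le> 1"
    and gam_prob: "1 - \<epsilon> + \<tau> \<le> measure \<Omega> {\<omega> \<in> space \<Omega>.
          (sin_mat (Ink n ts) (complex_of_real (sqrt (real n)) \<cdot>\<^sub>m (Ink n ts * U * H \<omega>) + W \<omega>))\<^sup>2 \<le> \<gamma>}"
  shows "\<exists>M::nat. is_code_no \<Omega> H W t \<rho> n M \<epsilon> \<and>
           ln (real M) / real n \<ge> (1 / real n) * ln (\<tau> / prod_beta_prob n ts r \<gamma>)"
proof -
  interpret \<Omega>: prob_space \<Omega> by (rule prob)
  let ?I = "{..<n} \<times> {..<r}" and ?K = "{..<t} \<times> {..<r}"
  let ?G = "gauss ?I" and ?\<beta> = "prod_beta_prob n ts r \<gamma>"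
  define X where "X \<omega> = restrict (entries (H \<omega>)) ?K" for \<omega>
  define Y where "Y \<omega> = restrict (entries (W \<omega>)) ?I" for \<omega>
  have sG: "sets ?G = sets (PiM ?I (\<lambda>_. borel))" by (rule sets_gauss)
  have X: "X \<in> \<Omega> \<rightarrow>\<^sub>M PiM ?K (\<lambda>_. borel)"
    unfolding X_def[abs_def] using H_meas by (intro measurable_restrict) auto
  have W_law: "distr \<Omega> borel (\<lambda>\<omega>. W \<omega> $$ p) = cnormal" if p: "p \<in> ?I" for p
  proof -
    have "distributed \<Omega> lborel (\<lambda>\<omega>. W \<omega> $$ p) (\<lambda>z. ennreal (exp (- (cmod z)\<^sup>2) / pi))"
      using p W_gauss by auto
    then have "distr \<Omega> lborel (\<lambda>\<omega>. W \<omega> $$ p) = cnormal"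
      by (simp add: distributed_def cnormal_def)
    moreover have "distr \<Omega> borel (\<lambda>\<omega>. W \<omega> $$ p) = distr \<Omega> lborel (\<lambda>\<omega>. W \<omega> $$ p)"
      by (intro distr_cong) auto
    ultimately show ?thesis by simp
  qed
  have W_meas: "(\<lambda>\<omega>. W \<omega> $$ p) \<in> borel_measurable \<Omega>" if "p \<in> ?I" for p
  proof -
    have "distributed \<Omega> lborel (\<lambda>\<omega>. W \<omega> $$ p) (\<lambda>z. ennreal (exp (- (cmod z)\<^sup>2) / pi))"
      using that W_gauss by auto
    then show ?thesis by (simp add: distributed_def)
  qed
  have I_ne: "?I \<noteq> {}" using n r by (auto simp: lessThan_empty_iff)
  have "distr \<Omega> (PiM ?I (\<lambda>_. borel)) Y = PiM ?I (\<lambda>p. distr \<Omega> borel (\<lambda>\<omega>. W \<omega> $$ p))"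
    using \<Omega>.indep_vars_iff_distr_eq_PiM'[OF I_ne, of "\<lambda>p \<omega>. W \<omega> $$ p" "\<lambda>_. borel"] W_meas W_indep
    unfolding Y_def[abs_def] by simp
  also have "\<dots> = ?G"
    unfolding gauss_def by (intro PiM_cong refl W_law)
  finally have Y_law: "distr \<Omega> (PiM ?I (\<lambda>_. borel)) Y = ?G" .
  have joint: "distr \<Omega> (PiM ?K (\<lambda>_. borel) \<Otimes>\<^sub>M ?G) (\<lambda>\<omega>. (X \<omega>, Y \<omega>)) = distr \<Omega> (PiM ?K (\<lambda>_. borel)) X \<Otimes>\<^sub>M ?G"
  proof -
    have "distr \<Omega> (PiM ?K (\<lambda>_. borel) \<Otimes>\<^sub>M ?G) (\<lambda>\<omega>. (X \<omega>, Y \<omega>)) =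
        distr \<Omega> (PiM ?K (\<lambda>_. borel) \<Otimes>\<^sub>M PiM ?I (\<lambda>_. borel)) (\<lambda>\<omega>. (X \<omega>, Y \<omega>))"
      by (intro distr_cong refl sets_pair_measure_cong sG)
    also have "\<dots> = distr \<Omega> (PiM ?K (\<lambda>_. borel)) X \<Otimes>\<^sub>M distr \<Omega> (PiM ?I (\<lambda>_. borel)) Y"
      using HW_indep unfolding \<Omega>.indep_var_distribution_eq X_def[abs_def] Y_def[abs_def] by simp
    finally show ?thesis by (simp add: Y_law)
  qed
  have Y: "Y \<in> \<Omega> \<rightarrow>\<^sub>M ?G"
    unfolding measurable_cong_sets[OF refl sG] Y_def[abs_def] by (intro measurable_restrict W_meas)
  \<comment> \<open>\<open>b\<close> is the unrotated codeword and \<open>f\<close> its noiseless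
    output as a function of the fading. Below, \<open>Z\<close> is the channel output for
    \<open>b\<close>, \<open>N\<close> its law, and \<open>R v\<close> the output for the codeword
    rotated by \<open>v\<close>.\<close>
  define b where "b = entries (complex_of_real (sqrt (real n)) \<cdot>\<^sub>m (Ink n ts * U))"
  define f where "f = mmult t b"
  have f: "(\<lambda>x. f x (i, k)) \<in> borel_measurable (PiM ?K (\<lambda>_. borel))" if "i < n" "k < r" for i k
    unfolding f_def mmult_apply using that
    by (intro borel_measurable_sum borel_measurable_times borel_measurable_const measurable_component_singleton) auto
  define R where "R v \<omega> = (\<lambda>p\<in>?I. mmult n v (f (X \<omega>)) p + Y \<omega> p)" for v \<omega>
  define Z where "Z \<omega> = (\<lambda>p\<in>?I. f (X \<omega>) p + Y \<omega> p)" for \<omega>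
  define N where "N = distr \<Omega> ?G Z"
  have Ym: "(\<lambda>\<omega>. Y \<omega> (i, k)) \<in> borel_measurable \<Omega>" if "i < n" "k < r" for i k
    using W_meas[of "(i, k)"] that by (simp add: Y_def)
  have Z: "Z \<in> \<Omega> \<rightarrow>\<^sub>M ?G"
    unfolding measurable_cong_sets[OF refl sG] Z_def[abs_def]
    by (intro measurable_restrict borel_measurable_add) (auto intro: Ym measurable_compose[OF X f])
  have R: "R v \<in> \<Omega> \<rightarrow>\<^sub>M ?G" for v
  proof -
    have "(\<lambda>\<omega>. mmult n v (f (X \<omega>)) (i, k)) \<in> borel_measurable \<Omega>" if "i < n" "k < r" for i k
      unfolding mmult_apply using that
      by (intro borel_measurable_sum borel_measurable_times borel_measurable_const measurable_compose[OF X f]) auto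
    then show ?thesis
      unfolding measurable_cong_sets[OF refl sG] R_def[abs_def]
      by (intro measurable_restrict borel_measurable_add) (auto intro: Ym)
  qed
  have N: "prob_space N" unfolding N_def by (rule \<Omega>.prob_space_distr[OF Z])
  have sN: "sets N = sets ?G" by (simp add: N_def)
  have rn: "r \<le> n" "ts \<le> n" using n by auto
  have full_\<Omega>: "AE \<omega> in \<Omega>. gramdet {..<n} r (Z \<omega>) \<noteq> 0"
    unfolding Z_def by (rule AE_channel_full_rank[where f=f, OF X Y joint prob rn(1) f])
  have gm: "{y \<in> space ?G. gramdet {..<n} r y \<noteq> 0} \<in> sets ?G"
  proof -
    have "gramdet {..<n} r \<in> borel_measurable ?G" by (rule measurable_gramdet_gauss) auto
    then show ?thesis by measurable
  qed
  have full: "AE y in N. gramdet {..<n} r y \<noteq> 0"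
    unfolding N_def using full_\<Omega> by (simp add: AE_distr_iff[OF Z gm])
  have N_measure: "measure N A = measure \<Omega> {\<omega> \<in> space \<Omega>. Z \<omega> \<in> A}" if "A \<in> sets ?G" for A
    unfolding N_def using that by (subst measure_distr[OF Z]) (auto intro!: arg_cong[where f="measure \<Omega>"])
  have typical: "1 - \<epsilon> + \<tau> \<le> measure N (decoding_set n r ts \<gamma> delta)"
  proof -
    let ?Y = "\<lambda>\<omega>. complex_of_real (sqrt (real n)) \<cdot>\<^sub>m (Ink n ts * U * H \<omega>) + W \<omega>"
    let ?S = "{\<omega> \<in> space \<Omega>. (sin_mat (Ink n ts) (?Y \<omega>))\<^sup>2 \<le> \<gamma>}"
    \<comment> \<open>The sine is defined by a choice, so measurability is read off from the
      hypothesis: a set that is not an event has measure 0, while \<open>gam_prob\<close> forces a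
      positive value.\<close>
    have S: "?S \<in> sets \<Omega>"
    proof (rule ccontr)
      assume "?S \<notin> sets \<Omega>"
      then have "measure \<Omega> ?S = 0" by (rule measure_notin_sets)
      then show False using gam_prob eps tau by simp
    qed
    have D: "{\<omega> \<in> space \<Omega>. Z \<omega> \<in> decoding_set n r ts \<gamma> delta} \<in> sets \<Omega>"
      using measurable_sets[OF Z sets_decoding_set, of ts \<gamma> delta] by (simp add: vimage_def Int_def conj_commute)
    \<comment> \<open>Off the null set of outputs of deficient rank, sin^2 is the Gram determinant
      ratio with positive denominator, so the multiplied-out test is the same event.\<close>
    have "AE \<omega> in \<Omega>. \<omega> \<in> ?S \<longleftrightarrow> \<omega> \<in> {\<omega> \<in> space \<Omega>. Z \<omega> \<in> decoding_set n r ts \<gamma> delta}"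
      using full_\<Omega> AE_space
    proof eventually_elim
      fix \<omega> assume \<omega>: "gramdet {..<n} r (Z \<omega>) \<noteq> 0" "\<omega> \<in> space \<Omega>"
      have H: "H \<omega> \<in> carrier_mat t r" and W: "W \<omega> \<in> carrier_mat n r"
        using H_dim W_dim \<omega>(2) by auto
      have Ink: "Ink n ts \<in> carrier_mat n ts" by (simp add: Ink_def)
      have IU: "Ink n ts * U \<in> carrier_mat n t" using Ink U(1) by simp
      have Yc: "?Y \<omega> \<in> carrier_mat n r" using IU H W by simp
      have "?Y \<omega> $$ (i, k) = Z \<omega> (i, k)" if ik: "i < n" "k < r" for i k
      proof -
        define P where "P = Ink n ts * U"
        have P: "P \<in> carrier_mat n t" using IU by (simp add: P_def)
        have "?Y \<omega> $$ (i, k) = complex_of_real (sqrt (real n)) * (\<Sum>m<t. P $$ (i, m) * H \<omega> $$ (m, k)) + W \<omega> $$ (i, k)"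
          using ik P H W unfolding P_def[symmetric] by (simp add: scalar_prod_def atLeast0LessThan)
        also have "\<dots> = Z \<omega> (i, k)"
          using ik P unfolding Z_def f_def b_def P_def[symmetric]
          by (auto simp: mmult_apply X_def Y_def sum_distrib_left mult.assoc)
        finally show ?thesis .
      qed
      then have g: "gramdet J r (entries (?Y \<omega>)) = gramdet J r (Z \<omega>)" if "J \<subseteq> {..<n}" for J
        using that by (intro gramdet_cong) auto
      have g': "gramdet {..<n} r (entries (?Y \<omega>)) = gramdet {..<n} r (Z \<omega>)"
        "gramdet {ts..<n} r (entries (?Y \<omega>)) = gramdet {ts..<n} r (Z \<omega>)"
        by (auto intro!: g)
      obtain x where "x \<ge> 0" "gramdet {..<n} r (Z \<omega>) = complex_of_real x"
        using gramdet_nonneg[of "{..<n}" r "Z \<omega>"] by auto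
      then have pos: "0 < Re (gramdet {..<n} r (Z \<omega>))" using \<omega> by simp
      have "(sin_mat (Ink n ts) (?Y \<omega>))\<^sup>2 = Re (gramdet {ts..<n} r (Z \<omega>)) / Re (gramdet {..<n} r (Z \<omega>))"
        using sin_mat_Ink_sq[OF Yc _ rn(2)] \<omega>(1) unfolding g' by simp
      moreover have "Z \<omega> \<in> space ?G" using measurable_space[OF Z \<omega>(2)] .
      ultimately show "\<omega> \<in> ?S \<longleftrightarrow> \<omega> \<in> {\<omega> \<in> space \<Omega>. Z \<omega> \<in> decoding_set n r ts \<gamma> delta}"
        using \<omega>(2) pos by (simp add: decoding_set_def small_angle_delta pos_divide_le_eq)
    qed
    then have "measure \<Omega> ?S = measure \<Omega> {\<omega> \<in> space \<Omega>. Z \<omega> \<in> decoding_set n r ts \<gamma> delta}"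
      by (rule measure_eq_AE[OF _ S D])
    then show ?thesis using gam_prob by (simp add: N_measure sets_decoding_set)
  qed
  \<comment> \<open>The ceiling gives \<open>\<tau> / ?\<beta> \<le> real m\<close> for the rate and
    \<open>real (m - 1) * ?\<beta> < \<tau>\<close> for the greedy choice. The maximum with 1 covers
    \<open>?\<beta> = 0\<close>, where the quotient is 0 by convention but a message must
    exist.\<close>
  define m where "m = max 1 (nat \<lceil>\<tau> / ?\<beta>\<rceil>)"
  have \<beta>: "0 \<le> ?\<beta>" by (simp add: prod_beta_prob_def Let_def)
  have m1: "1 \<le> m" by (simp add: m_def)
  have "real (m - 1) * ?\<beta> < \<tau>"
  proof (cases "m = 1")
    case True then show ?thesis using tau by simp
  next
    case False
    then have m: "m = nat \<lceil>\<tau> / ?\<beta>\<rceil>" "1 < m" unfolding m_def by linarith+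
    then have "?\<beta> \<noteq> 0" by auto
    then have "0 < ?\<beta>" using \<beta> by simp
    moreover have "real (m - 1) < \<tau> / ?\<beta>" using m by linarith
    ultimately show ?thesis by (simp add: pos_less_divide_eq)
  qed
  from codebook_exists[OF n N sN full typical this] tau(1) obtain v where v: "\<And>j. j < m \<Longrightarrow> unitary n (v j)"
    "\<And>j. j < m \<Longrightarrow> 1 - \<epsilon> \<le> measure N {y \<in> space N. small_angle n r ts \<gamma> (v j) (mmult n (v j) y) \<and>
        (\<forall>i<j. \<not> small_angle n r ts \<gamma> (v i) (mmult n (v j) y))}"
    by auto
  \<comment> \<open>The outputs decoded to word \<open>j\<close>: those that it accepts and no
    earlier word does.\<close>
  define A where "A j = decoding_set n r ts \<gamma> (v j) - (\<Union>i<j. decoding_set n r ts \<gamma> (v i))" for j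
  have A: "A j \<in> sets ?G" for j
    unfolding A_def using sets_decoding_set by auto
  have R_ge: "1 - \<epsilon> \<le> measure \<Omega> {\<omega> \<in> space \<Omega>. R (v j) \<omega> \<in> A j}" if j: "j < m" for j
  proof -
    let ?T = "\<lambda>y. restrict (mmult n (v j) y) ?I"
    have T: "?T \<in> ?G \<rightarrow>\<^sub>M ?G"
      unfolding measurable_cong_sets[OF sG sG]
      by (intro measurable_mmult) (auto intro!: measurable_component_singleton)
    have eq: "{y \<in> space N. small_angle n r ts \<gamma> (v j) (mmult n (v j) y) \<and>
        (\<forall>i<j. \<not> small_angle n r ts \<gamma> (v i) (mmult n (v j) y))} = ?T -` A j \<inter> space ?G"
      using sets_eq_imp_space_eq[OF sN] by (auto simp: A_def restrict_mem_decoding_set)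
    have "1 - \<epsilon> \<le> measure N (?T -` A j \<inter> space ?G)"
      using v(2)[OF j] unfolding eq .
    also have "\<dots> = measure \<Omega> {\<omega> \<in> space \<Omega>. Z \<omega> \<in> ?T -` A j \<inter> space ?G}"
      by (rule N_measure[OF measurable_sets[OF T A]])
    also have "{\<omega> \<in> space \<Omega>. Z \<omega> \<in> ?T -` A j \<inter> space ?G} = {\<omega> \<in> space \<Omega>. ?T (Z \<omega>) \<in> A j}"
      using measurable_space[OF Z] by auto
    also have "measure \<Omega> \<dots> = measure \<Omega> {\<omega> \<in> space \<Omega>. R (v j) \<omega> \<in> A j}"
      using channel_rotate[where f=f, OF X Y joint prob f v(1)[OF j] A[of j]] unfolding measure_def R_def Z_def by simp
    finally show ?thesis .
  qed
  define C where "C j = mat n t (mmult n (v (j - 1)) b)" for j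
  define hit where "hit i y \<longleftrightarrow> small_angle n r ts \<gamma> (v i) (entries y)" for i y
  \<comment> \<open>The first accepting word wins. \<open>Suc\<close> passes from words numbered
    from 0 to messages numbered from 1, and outputs that no word accepts are decoded as message 1 to
    keep \<open>g\<close> total.\<close>
  define g where "g y = (if \<exists>i<m. hit i y then Suc (LEAST i. i < m \<and> hit i y) else 1)" for y
  have g_range: "g y \<in> {1..m}" for y
  proof (cases "\<exists>i<m. hit i y")
    case True
    then have "(LEAST i. i < m \<and> hit i y) < m" using LeastI_ex[of "\<lambda>i. i < m \<and> hit i y"] by blast
    then show ?thesis using True by (simp add: g_def)
  next
    case False then show ?thesis using m1 by (auto simp: g_def)
  qed
  have g_eq: "g y = Suc j \<longleftrightarrow> (hit j y \<and> (\<forall>i<j. \<not> hit i y)) \<or> (j = 0 \<and> (\<forall>i<m. \<not> hit i y))" if j: "j < m" for j y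
  proof (cases "\<exists>i<m. hit i y")
    case True
    let ?L = "LEAST i. i < m \<and> hit i y"
    have L: "?L < m" "hit ?L y" using LeastI_ex[of "\<lambda>i. i < m \<and> hit i y"] True by blast+
    have L': "\<not> hit i y" if "i < ?L" for i
      using not_less_Least[OF that] that L(1) by auto
    have "?L = j \<longleftrightarrow> hit j y \<and> (\<forall>i<j. \<not> hit i y)"
      using L L' by (metis linorder_neqE_nat)
    moreover have "g y = Suc j \<longleftrightarrow> ?L = j" using True by (simp add: g_def)
    ultimately show ?thesis using True by blast
  next
    case False
    then show ?thesis using j by (auto simp: g_def)
  qed
  have hit_R: "hit i (C (Suc j) * H \<omega> + W \<omega>) \<longleftrightarrow> R (v j) \<omega> \<in> decoding_set n r ts \<gamma> (v i)"
    if \<omega>: "\<omega> \<in> space \<Omega>" for i j \<omega>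
  proof -
    have H: "H \<omega> \<in> carrier_mat t r" and W: "W \<omega> \<in> carrier_mat n r"
      using H_dim W_dim \<omega> by auto
    have "(C (Suc j) * H \<omega> + W \<omega>) $$ (i, k) = mmult n (v j) (f (X \<omega>)) (i, k) + Y \<omega> (i, k)" if ik: "i < n" "k < r" for i k
    proof -
      have "(C (Suc j) * H \<omega> + W \<omega>) $$ (i, k) = mmult t (mmult n (v j) b) (entries (H \<omega>)) (i, k) + W \<omega> $$ (i, k)"
        using ik H W by (simp add: C_def scalar_prod_def atLeast0LessThan mmult_apply[of t])
      also have "mmult t (mmult n (v j) b) (entries (H \<omega>)) (i, k) = mmult t (mmult n (v j) b) (X \<omega>) (i, k)"
        using ik by (intro mmult_cong) (auto simp: X_def)
      finally show ?thesis using ik by (simp add: f_def mmult_assoc Y_def)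
    qed
    then have "hit i (C (Suc j) * H \<omega> + W \<omega>) \<longleftrightarrow> small_angle n r ts \<gamma> (v i) (\<lambda>p. mmult n (v j) (f (X \<omega>)) p + Y \<omega> p)"
      unfolding hit_def by (intro small_angle_cong) auto
    also have "\<dots> \<longleftrightarrow> R (v j) \<omega> \<in> decoding_set n r ts \<gamma> (v i)"
      unfolding R_def by (rule restrict_mem_decoding_set[symmetric])
    finally show ?thesis .
  qed
  have "is_code_no \<Omega> H W t \<rho> n m \<epsilon>"
    unfolding is_code_no_def
  proof (intro exI[of _ C] exI[of _ g] conjI ballI allI g_range)
    fix j assume "j \<in> {1..m}"
    then obtain i where i: "j = Suc i" "i < m" by (cases j) auto
    show "C j \<in> carrier_mat n t" by (simp add: C_def)
    have "Re (cmat_trace Qs) \<le> \<rho>" using Qs by (simp add: input_set_def)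
    then show "frob_sq (C j) \<le> real n * \<rho>"
      unfolding C_def b_def using i v(1)[of i] by (intro frob_sq_codeword[OF _ U rn(2)]) auto
    let ?B = "{\<omega> \<in> space \<Omega>. g (C j * H \<omega> + W \<omega>) \<noteq> j}"
    let ?S = "{\<omega> \<in> space \<Omega>. R (v i) \<omega> \<in> A i}"
    have dec: "{\<omega> \<in> space \<Omega>. R (v i) \<omega> \<in> decoding_set n r ts \<gamma> (v l)} \<in> sets \<Omega>" for l
      using measurable_sets[OF R sets_decoding_set, of "v i" ts \<gamma> "v l"] by (simp add: vimage_def Int_def conj_commute)
    have S: "?S \<in> sets \<Omega>"
      using measurable_sets[OF R A, of "v i" i] by (simp add: vimage_def Int_def conj_commute)
    \<comment> \<open>For \<open>i = 0\<close>, message 1, the default also decodes correctly when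
      no word accepts. The exact formula yields measurability; the probability bound uses only the
      inclusion below.\<close>
    have "?B = space \<Omega> - (?S \<union> (if i = 0 then space \<Omega> - (\<Union>l<m. {\<omega> \<in> space \<Omega>. R (v i) \<omega> \<in> decoding_set n r ts \<gamma> (v l)}) else {}))"
      unfolding i(1) using measurable_space[OF R[of "v i"]] by (auto simp: g_eq[OF i(2)] hit_R A_def)
    moreover have "\<dots> \<in> sets \<Omega>"
      using S dec by (intro sets.Diff sets.Un) auto
    ultimately show "?B \<in> sets \<Omega>" by simp
    have "?B \<subseteq> space \<Omega> - ?S"
      unfolding i(1) by (auto simp: g_eq[OF i(2)] hit_R A_def)
    then have "measure \<Omega> ?B \<le> measure \<Omega> (space \<Omega> - ?S)"
      using S by (intro \<Omega>.finite_measure_mono) auto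
    also have "\<dots> = 1 - measure \<Omega> ?S"
      by (rule \<Omega>.prob_compl[OF S])
    also have "\<dots> \<le> \<epsilon>" using R_ge[OF i(2)] by simp
    finally show "measure \<Omega> ?B \<le> \<epsilon>" .
  qed
  moreover have "ln (\<tau> / ?\<beta>) \<le> ln (real m)"
  proof (cases "\<tau> / ?\<beta> = 0")
    \<comment> \<open>As \<open>\<tau>\<close> is positive, this is the case
      \<open>?\<beta> = 0\<close>, where the left side is \<open>ln 0 = 0\<close>.\<close>
    case True
    then show ?thesis unfolding True using m1 by simp
  next
    case False
    then have "0 < \<tau> / ?\<beta>" using \<beta> tau by (simp add: less_le)
    moreover have "\<tau> / ?\<beta> \<le> real m" unfolding m_def by linarith
    ultimately show ?thesis by simp
  qed
  then have "1 / real n * ln (\<tau> / ?\<beta>) \<le> ln (real m) / real n"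
    by (simp add: divide_right_mono)
  ultimately show ?thesis by blast
qed

end
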